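(* Let $d\geq 2$ be an integer, let $w\geq 121d^2$ be a real number, and let $a,b,c\in\mathbb{F}_q[T]$ be distinct non-constant polynomials. Let $0<\eta<\sqrt{w}/d$ and put $m_i:=\bigl\lfloor(\lfloor w^{i+1}\rfloor-\lfloor w^i-1\rfloor)/\lfloor\eta w^i\rfloor\bigr\rfloor$ for all $i\geq1$. Define $(a_{n,w,\eta})_{n\geq1}$ by: $a_{n,w,\eta}=b$ if $n=\lfloor w^i\rfloor$ for some integer $i\geq0$; $a_{n,w,\eta}=c$ if $n\neq\lfloor w^i\rfloor$ for all integers $i\geq0$ and $n=\lfloor w^j\rfloor+m\lfloor\eta w^j\rfloor$ for some integers $1\leq m\leq m_j$, $j\geq1$; and $a_{n,w,\eta}=a$ otherwise. Let $\xi_{w,\eta}:=[0,a_{1,w,\eta},a_{2,w,\eta},\ldots]\in\mathbb{F}_q((T^{-1}))$. Then for all $2\leq n\leq d$, \[ w_n^{*}(\xi_{w,\eta})=\frac{2w-2-\eta}{2+\eta},\qquad w_n(\xi_{w,\eta})=\frac{2w-\eta}{2+\eta}, \] and hence $w_n(\xi_{w,\eta})-w_n^{*}(\xi_{w,\eta})=\dfrac{2}{2+\eta}$.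
   Context: Let $p$ be a prime and $q$ a power of $p$. $\mathbb{F}_q((T^{-1}))$ is the field of Laurent series $\xi=\sum_{n\geq N}a_nT^{-n}$ ($a_n\in\mathbb{F}_q$), with absolute value $|0|=0$ and $|\xi|=q^{-N}$ if $a_N\neq 0$; this absolute value is extended uniquely to an algebraic closure $\overline{\mathbb{F}_q(T)}$. For $a_0\in\mathbb{F}_q[T]$ and $a_1,a_2,\ldots\in\mathbb{F}_q[T]$ of degree $\geq1$, $[a_0,a_1,a_2,\ldots]$ denotes the continued fraction $a_0+1/(a_1+1/(a_2+\cdots))$ in $\mathbb{F}_q((T^{-1}))$. The height $H(P)$ of $P\in(\mathbb{F}_q[T])[X]$ is the maximum of the absolute values of its coefficients. Every $\alpha\in\overline{\mathbb{F}_q(T)}$ is a root of a unique non-constant, irreducible, primitive $P\in(\mathbb{F}_q[T])[X]$ whose leading coefficient is monic in $T$; $H(\alpha)$ and $\deg\alpha$ denote the height and degree of this polynomial. For $\xi\in\mathbb{F}_q((T^{-1}))$ and $n\geq1$, $w_n(\xi)$ is the supremum of real $w$ such that $0<|P(\xi)|\leq H(P)^{-w}$ for infinitely many $P\in(\mathbb{F}_q[T])[X]$ of degree at most $n$, and $w_n^{*}(\xi)$ is the supremum of real $w^*$ such that $0<|\xi-\alpha|\leq H(\alpha)^{-w^*-1}$ for infinitely many $\alpha\in\overline{\mathbb{F}_q(T)}$ of degree at most $n$. *)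

theory Defs
  imports "HOL-Algebra.Algebraic_Closure_Type" "HOL-Library.Cardinality" "HOL-Library.Extended_Real"
begin

text \<open>
  The field of Laurent series in \<open>T\<^sup>-\<^sup>1\<close> over a finite field with \<open>q = CARD('a)\<close> elements is
  \<^typ>\<open>'a fls\<close>, with the formal variable \<^const>\<open>fls_X\<close> playing the role of \<open>T\<^sup>-\<^sup>1\<close>; hence
  \<open>T\<close> is \<^const>\<open>fls_X_inv\<close>, and \<^const>\<open>fls_subdegree\<close> is the index of the first nonzero coefficient.
\<close>

definition laurent_abs :: "'a::finite_field fls \<Rightarrow> real" where
  "laurent_abs \<xi> = (if \<xi> = 0 then 0 else real CARD('a) powi (- fls_subdegree \<xi>))"

definition of_Tpoly :: "'a::finite_field poly \<Rightarrow> 'a fls" where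
  "of_Tpoly f = poly (map_poly fls_const f) fls_X_inv"

definition poly_height :: "'a::finite_field poly poly \<Rightarrow> real" where
  "poly_height P = Max ((\<lambda>i. laurent_abs (of_Tpoly (Polynomial.coeff P i))) ` {..Polynomial.degree P})"


text \<open>
  The algebraic closure of \<open>\<bbbF>\<^sub>q(T)\<close> is taken inside the algebraic closure
  \<^typ>\<open>'a fls alg_closure\<close> of the complete field \<^typ>\<open>'a fls\<close>: on the latter the extension of the
  absolute value is unique, and differences \<open>\<xi> - \<alpha>\<close> make sense there.
  Denominators being cleared, algebraicity over \<open>\<bbbF>\<^sub>q(T)\<close> is tested with coefficients in \<open>\<bbbF>\<^sub>q[T]\<close>.
\<close>

definition extends_laurent_abs :: "('a::finite_field fls alg_closure \<Rightarrow> real) \<Rightarrow> bool" where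
  "extends_laurent_abs v \<longleftrightarrow>
     (\<forall>x. 0 \<le> v x) \<and> (\<forall>x. v x = 0 \<longleftrightarrow> x = 0) \<and>
     (\<forall>x y. v (x * y) = v x * v y) \<and> (\<forall>x y. v (x + y) \<le> v x + v y) \<and>
     (\<forall>\<xi>. v (to_ac \<xi>) = laurent_abs \<xi>)"

definition eval_laurent :: "'a::finite_field poly poly \<Rightarrow> 'a fls \<Rightarrow> 'a fls" where
  "eval_laurent P \<xi> = poly (map_poly of_Tpoly P) \<xi>"

definition eval_ac :: "'a::finite_field poly poly \<Rightarrow> 'a fls alg_closure \<Rightarrow> 'a fls alg_closure" where
  "eval_ac P \<alpha> = poly (map_poly (\<lambda>f. to_ac (of_Tpoly f)) P) \<alpha>"

definition algebraic_elements :: "'a::finite_field fls alg_closure set" where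
  "algebraic_elements = {\<alpha>. \<exists>P. P \<noteq> 0 \<and> eval_ac P \<alpha> = 0}"

definition primitive_poly :: "'a::finite_field poly poly \<Rightarrow> bool" where
  "primitive_poly P \<longleftrightarrow> (\<forall>f. (\<forall>i. f dvd Polynomial.coeff P i) \<longrightarrow> is_unit f)"

definition min_poly :: "'a::finite_field fls alg_closure \<Rightarrow> 'a poly poly" where
  "min_poly \<alpha> = (THE P. eval_ac P \<alpha> = 0 \<and> Polynomial.degree P > 0 \<and>
     Factorial_Ring.irreducible P \<and> primitive_poly P \<and>
     Polynomial.lead_coeff (Polynomial.lead_coeff P) = 1)"

definition alg_height :: "'a::finite_field fls alg_closure \<Rightarrow> real" where
  "alg_height \<alpha> = poly_height (min_poly \<alpha>)"

definition alg_degree :: "'a::finite_field fls alg_closure \<Rightarrow> nat" where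
  "alg_degree \<alpha> = Polynomial.degree (min_poly \<alpha>)"

text \<open>The suprema are taken in the extended reals, as the exponents may be infinite.\<close>

definition w_exp :: "nat \<Rightarrow> 'a::finite_field fls \<Rightarrow> ereal" where
  "w_exp n \<xi> = Sup (ereal ` {w. infinite {P. Polynomial.degree P \<le> n \<and>
     0 < laurent_abs (eval_laurent P \<xi>) \<and>
     laurent_abs (eval_laurent P \<xi>) \<le> poly_height P powr (- w)}})"

definition w_star_exp ::
    "('a::finite_field fls alg_closure \<Rightarrow> real) \<Rightarrow> nat \<Rightarrow> 'a fls \<Rightarrow> ereal" where
  "w_star_exp v n \<xi> = Sup (ereal ` {w. infinite {\<alpha> \<in> algebraic_elements. alg_degree \<alpha> \<le> n \<and>
     0 < v (to_ac \<xi> - \<alpha>) \<and>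
     v (to_ac \<xi> - \<alpha>) \<le> alg_height \<alpha> powr (- w - 1)}})"


fun cf_convergent :: "(nat \<Rightarrow> 'a::finite_field poly) \<Rightarrow> nat \<Rightarrow> 'a fls" where
  "cf_convergent a 0 = of_Tpoly (a 0)"
| "cf_convergent a (Suc k) = of_Tpoly (a 0) + 1 / cf_convergent (\<lambda>i. a (Suc i)) k"

text \<open>The library metric on \<^typ>\<open>'a fls\<close> uses base \<open>2\<close> instead of \<open>q\<close>; the topology is the same.\<close>

definition cf_value :: "(nat \<Rightarrow> 'a::finite_field poly) \<Rightarrow> 'a fls" where
  "cf_value a = lim (cf_convergent a)"


text \<open>
  If \<open>\<lfloor>\<eta> w\<^sup>i\<rfloor> = 0\<close>, the quotient below is \<open>0\<close> by the convention on division by zero. The value is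
  immaterial: for such \<open>i\<close> the second clause of \<open>cf_seq\<close> could only be met by \<open>n = \<lfloor>w\<^sup>i\<rfloor>\<close>,
  which is already covered by the first.
\<close>

definition m_bound :: "real \<Rightarrow> real \<Rightarrow> nat \<Rightarrow> int" where
  "m_bound w \<eta> i =
     \<lfloor>real_of_int (\<lfloor>w ^ (i + 1)\<rfloor> - \<lfloor>w ^ i - 1\<rfloor>) / real_of_int \<lfloor>\<eta> * w ^ i\<rfloor>\<rfloor>"

text \<open>Partial quotients; the value at index \<open>0\<close> is the integral part \<open>0\<close> of the continued fraction.\<close>

definition cf_seq ::
    "'a::finite_field poly \<Rightarrow> 'a poly \<Rightarrow> 'a poly \<Rightarrow> real \<Rightarrow> real \<Rightarrow> nat \<Rightarrow> 'a poly" where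
  "cf_seq a b c w \<eta> n =
     (if n = 0 then 0
      else if \<exists>i::nat. int n = \<lfloor>w ^ i\<rfloor> then b
      else if \<exists>j\<ge>1. \<exists>m. 1 \<le> m \<and> m \<le> m_bound w \<eta> j \<and> int n = \<lfloor>w ^ j\<rfloor> + m * \<lfloor>\<eta> * w ^ j\<rfloor> then c
      else a)"

definition xi :: "'a::finite_field poly \<Rightarrow> 'a poly \<Rightarrow> 'a poly \<Rightarrow> real \<Rightarrow> real \<Rightarrow> 'a fls" where
  "xi a b c w \<eta> = cf_value (cf_seq a b c w \<eta>)"

end

theory Submission
  imports Defs
begin

text \<open>
  Cutting \<open>\<xi>\<close> off just before the index \<open>\<lfloor>w\<^sup>i\<^sup>+\<^sup>1\<rfloor>\<close> and continuing periodically with the word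
  \<open>a \<dots> a c\<close> of length \<open>\<lfloor>\<eta> w\<^sup>i\<rfloor>\<close> gives quadratic Laurent series \<open>\<alpha>\<^sub>i\<close>. On the logarithmic scale
  \<open>w\<^sup>i deg a\<close>, the height of \<open>\<alpha>\<^sub>i\<close> is \<open>2 + \<eta>\<close>, its distance to \<open>\<xi>\<close> is \<open>- 2 w\<close>, and its minimal
  polynomial takes at \<open>\<xi>\<close> a value of size \<open>\<eta> - 2 w\<close>; the two exponents are the resulting ratios. They are
  optimal: an irreducible polynomial of degree at most \<open>d\<close> which is not proportional to one of these
  minimal polynomials satisfies a Liouville inequality at a suitable \<open>\<alpha>\<^sub>i\<close>, which carries over to \<open>\<xi>\<close>
  and is stronger than needed because \<open>w\<close> is large compared with \<open>d\<^sup>2\<close>. Values at \<open>\<xi>\<close> and heights being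
  multiplicative, this extends to reducible polynomials.
\<close>

subsection \<open>Absolute values and heights\<close>

text \<open>The three rates come from sizes of continuants. Up to index w^(i+1) all but O(i) partial
  quotients equal \<open>a\<close>, so the logarithm of the n-th continuant is n log |a| with an
  error linear in i, negligible against w^i. The quadratic polynomial of \<alpha>_i is built from
  linear forms at the indices w^i and (1 + \<eta>) w^i, whence the height 2 + \<eta>; the expansions
  of \<xi> and \<alpha>_i separate at index w^(i+1), and the squared continuant there gives - 2 w;
  the derivative at \<alpha>_i has size \<eta>. An obstacle is that these polynomials may have a
  content, which would lower the height of the irreducible polynomial proportional to them. The
  shape of the period settles this: the content divides c - a, whatever the length of the period.
  For all other polynomials the Liouville loss at \<alpha>_i is governed by d (2 + \<eta>), and it
  leads to an exponent of that order. This stays below the claimed exponents, of order 2 w / (2 +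
  \<eta>), once d (2 + \<eta>)^2 is below a suitable multiple of w; the bounds on w and \<eta>
  ensure it.\<close>

abbreviation tabs :: "'a::finite_field poly \<Rightarrow> real" where
  "tabs f \<equiv> laurent_abs (of_Tpoly f)"

lemma card_gt_1: "1 < real CARD('a::finite_field)"
proof -
  have "card {0, 1 :: 'a} \<le> CARD('a)" by (intro card_mono) auto
  thus ?thesis by simp
qed

lemma laurent_abs_0 [simp]: "laurent_abs 0 = 0"
  by (simp add: laurent_abs_def)

lemma laurent_abs_nonneg [simp]: "0 \<le> laurent_abs x"
  by (simp add: laurent_abs_def)

lemma laurent_abs_pos_iff [simp]: "0 < laurent_abs x \<longleftrightarrow> x \<noteq> 0"
  using card_gt_1[where 'a='a] by (simp add: laurent_abs_def)

lemma laurent_abs_eq_0_iff [simp]: "laurent_abs x = 0 \<longleftrightarrow> x = 0"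
  using laurent_abs_pos_iff[of x] by (metis laurent_abs_0 less_irrefl)

lemma laurent_abs_1 [simp]: "laurent_abs 1 = 1"
  by (simp add: laurent_abs_def)

lemma laurent_abs_mult: "laurent_abs (x * y) = laurent_abs x * laurent_abs y"
  using card_gt_1[where 'a='a]
  by (auto simp: laurent_abs_def power_int_add[symmetric] intro!: arg_cong[where f="\<lambda>k. real CARD('a) powi k"])

lemma laurent_abs_minus [simp]: "laurent_abs (- x) = laurent_abs x"
  by (simp add: laurent_abs_def)

lemma laurent_abs_diff_commute: "laurent_abs (x - y) = laurent_abs (y - x)"
  by (metis laurent_abs_minus minus_diff_eq)

lemma laurent_abs_inverse: "laurent_abs (inverse x) = inverse (laurent_abs x)"
proof (cases "x = 0")
  case False
  have "laurent_abs x * laurent_abs (inverse x) = 1"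
    using False by (simp add: laurent_abs_mult[symmetric])
  thus ?thesis by (simp add: inverse_unique)
qed simp

lemma laurent_abs_divide: "laurent_abs (x / y) = laurent_abs x / laurent_abs y"
  by (simp add: divide_inverse laurent_abs_mult laurent_abs_inverse)

lemma laurent_abs_power: "laurent_abs (x ^ n) = laurent_abs x ^ n"
  by (induction n) (simp_all add: laurent_abs_mult)

lemma laurent_abs_add_le: "laurent_abs (x + y) \<le> max (laurent_abs x) (laurent_abs y)"
proof (cases "x = 0 \<or> y = 0 \<or> x + y = 0")
  case False
  hence "min (fls_subdegree x) (fls_subdegree y) \<le> fls_subdegree (x + y)"
    by (intro fls_plus_subdegree) auto
  hence "- fls_subdegree (x + y) \<le> - fls_subdegree x \<or> - fls_subdegree (x + y) \<le> - fls_subdegree y"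
    by linarith
  moreover have "real CARD('a) powi m \<le> real CARD('a) powi n" if "m \<le> n" for m n
    using that card_gt_1[where 'a='a] by (intro power_int_increasing) auto
  ultimately show ?thesis using False unfolding laurent_abs_def le_max_iff_disj by auto
qed (auto simp: le_max_iff_disj)

lemma laurent_abs_add_bound:
  "laurent_abs x \<le> B \<Longrightarrow> laurent_abs y \<le> B \<Longrightarrow> laurent_abs (x + y) \<le> B"
  using laurent_abs_add_le[of x y] by simp

lemma laurent_abs_diff_bound:
  "laurent_abs x \<le> B \<Longrightarrow> laurent_abs y \<le> B \<Longrightarrow> laurent_abs (x - y) \<le> B"
  using laurent_abs_add_bound[of x B "- y"] by simp

lemma laurent_abs_add_eq:
  assumes "laurent_abs y < laurent_abs x"
  shows "laurent_abs (x + y) = laurent_abs x"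
proof (rule antisym)
  show "laurent_abs (x + y) \<le> laurent_abs x"
    using laurent_abs_add_le[of x y] assms by simp
  have "laurent_abs x \<le> max (laurent_abs (x + y)) (laurent_abs y)"
    using laurent_abs_add_le[of "x + y" "- y"] by simp
  thus "laurent_abs x \<le> laurent_abs (x + y)" using assms by simp
qed

lemma laurent_abs_diff_eq:
  "laurent_abs y < laurent_abs x \<Longrightarrow> laurent_abs (x - y) = laurent_abs x"
  using laurent_abs_add_eq[of "- y" x] by simp


text \<open>The coefficient maps \<open>fls_const\<close>, \<open>of_Tpoly\<close> and
  \<open>to_ac\<close> after \<open>of_Tpoly\<close> are all ring homomorphisms. With the
  homomorphism laws as hypotheses, these four rules serve the three evaluations at once.\<close>

lemma map_poly_hom_pCons:
  assumes "f 0 = 0"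
  shows "poly (map_poly f (pCons c p)) x = f c + x * poly (map_poly f p) x"
  using assms by (simp add: map_poly_pCons)

lemma map_poly_hom_add:
  fixes f :: "'a::comm_ring_1 \<Rightarrow> 'b::comm_ring_1"
  assumes "f 0 = 0" and "\<And>x y. f (x + y) = f x + f y"
  shows "poly (map_poly f (p + q)) x = poly (map_poly f p) x + poly (map_poly f q) x"
  by (induction p q rule: poly_induct2)
     (simp_all add: map_poly_hom_pCons assms algebra_simps)

lemma map_poly_hom_smult:
  fixes f :: "'a::comm_ring_1 \<Rightarrow> 'b::comm_ring_1"
  assumes "f 0 = 0" and "\<And>x y. f (x * y) = f x * f y"
  shows "poly (map_poly f (smult c p)) x = f c * poly (map_poly f p) x"
  by (induction p) (simp_all add: map_poly_hom_pCons assms algebra_simps)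

lemma map_poly_hom_mult:
  fixes f :: "'a::comm_ring_1 \<Rightarrow> 'b::comm_ring_1"
  assumes "f 0 = 0" and "\<And>x y. f (x + y) = f x + f y" and "\<And>x y. f (x * y) = f x * f y"
  shows "poly (map_poly f (p * q)) x = poly (map_poly f p) x * poly (map_poly f q) x"
  by (induction p)
     (simp_all add: map_poly_hom_pCons map_poly_hom_add map_poly_hom_smult assms algebra_simps)

section \<open>The embedding of F_q[T] into the Laurent series\<close>

lemma of_Tpoly_0 [simp]: "of_Tpoly 0 = 0"
  by (simp add: of_Tpoly_def)

lemma of_Tpoly_pCons: "of_Tpoly (pCons c f) = fls_const c + fls_X_inv * of_Tpoly f"
  unfolding of_Tpoly_def by (rule map_poly_hom_pCons) simp

lemma of_Tpoly_1 [simp]: "of_Tpoly 1 = 1"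
  by (simp add: one_pCons of_Tpoly_pCons)

lemma of_Tpoly_add: "of_Tpoly (f + g) = of_Tpoly f + of_Tpoly g"
  unfolding of_Tpoly_def by (rule map_poly_hom_add) (simp_all add: fls_plus_const)

lemma of_Tpoly_mult: "of_Tpoly (f * g) = of_Tpoly f * of_Tpoly g"
  unfolding of_Tpoly_def
  by (rule map_poly_hom_mult) (simp_all add: fls_plus_const fls_const_mult_const)

lemma of_Tpoly_minus: "of_Tpoly (- f) = - of_Tpoly f"
proof -
  have "of_Tpoly (- f) + of_Tpoly f = 0" by (simp flip: of_Tpoly_add)
  thus ?thesis by (simp add: eq_neg_iff_add_eq_0)
qed

lemma of_Tpoly_diff: "of_Tpoly (f - g) = of_Tpoly f - of_Tpoly g"
  using of_Tpoly_add[of f "- g"] by (simp add: of_Tpoly_minus)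

lemma of_Tpoly_power: "of_Tpoly (f ^ n) = of_Tpoly f ^ n"
  by (induction n) (simp_all add: of_Tpoly_mult)

lemma tabs_eq: "f \<noteq> 0 \<Longrightarrow> tabs f = real CARD('a) ^ Polynomial.degree (f :: 'a::finite_field poly)"
proof (induction f)
  case (pCons c f)
  have c: "laurent_abs (fls_const c) \<le> 1" by (simp add: laurent_abs_def)
  have T: "laurent_abs (fls_X_inv :: 'a fls) = real CARD('a)"
    by (simp add: laurent_abs_def)
  show ?case
  proof (cases "f = 0")
    case True
    hence "c \<noteq> 0" using pCons.hyps by auto
    thus ?thesis using True by (simp add: of_Tpoly_pCons laurent_abs_def)
  next
    case False
    have *: "laurent_abs (fls_X_inv * of_Tpoly f) = real CARD('a) ^ Suc (Polynomial.degree f)"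
      using pCons.IH[OF False] by (simp add: laurent_abs_mult T)
    have "1 < real CARD('a) ^ Suc (Polynomial.degree f)"
      using card_gt_1[where 'a='a] by (rule one_less_power) simp
    hence "laurent_abs (fls_X_inv * of_Tpoly f + fls_const c) = real CARD('a) ^ Suc (Polynomial.degree f)"
      using c * laurent_abs_add_eq by (metis le_less_trans)
    thus ?thesis using False by (simp add: of_Tpoly_pCons add.commute)
  qed
qed simp

text \<open>Discreteness of F_q[T] among the Laurent series; the irrationality proof and the
  Liouville inequality both rest on it.\<close>

lemma tabs_ge_1: "f \<noteq> 0 \<Longrightarrow> 1 \<le> tabs f"
  using card_gt_1[where 'a='a] tabs_eq[of f] by (simp add: one_le_power)

lemma of_Tpoly_eq_0_iff [simp]: "of_Tpoly f = 0 \<longleftrightarrow> f = 0"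
  using tabs_ge_1[of f] by fastforce

lemma tabs_less_1_iff: "tabs f < 1 \<longleftrightarrow> f = 0"
  using tabs_ge_1[of f] by fastforce

lemma tabs_mult: "tabs (f * g) = tabs f * tabs g"
  by (simp add: of_Tpoly_mult laurent_abs_mult)

lemma tabs_gt_1: "0 < Polynomial.degree (f :: 'a::finite_field poly) \<Longrightarrow> 1 < tabs f"
  using card_gt_1[where 'a='a] tabs_eq[of f] by (cases "f = 0") (simp_all add: one_less_power)


section \<open>The height as a Gauss norm, and the Northcott property\<close>

lemma coeff_le_poly_height: "tabs (Polynomial.coeff P i) \<le> poly_height P"
proof (cases "i \<le> Polynomial.degree P")
  case True
  thus ?thesis unfolding poly_height_def by (intro Max_ge) auto
next
  case False
  have "tabs (Polynomial.coeff P 0) \<le> poly_height P"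
    unfolding poly_height_def by (intro Max_ge) auto
  moreover have "0 \<le> tabs (Polynomial.coeff P 0)" by simp
  ultimately have "0 \<le> poly_height P" by linarith
  thus ?thesis using False by (simp add: coeff_eq_0)
qed

lemma poly_height_nonneg [simp]: "0 \<le> poly_height P"
  by (rule order_trans[OF laurent_abs_nonneg coeff_le_poly_height[of P 0]])

lemma poly_height_le_iff: "poly_height P \<le> B \<longleftrightarrow> (\<forall>i. tabs (Polynomial.coeff P i) \<le> B)"
proof
  assume "poly_height P \<le> B"
  thus "\<forall>i. tabs (Polynomial.coeff P i) \<le> B" using coeff_le_poly_height order_trans by blast
next
  assume "\<forall>i. tabs (Polynomial.coeff P i) \<le> B"
  thus "poly_height P \<le> B" unfolding poly_height_def by (subst Max_le_iff) auto
qed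

lemma poly_height_attained: "\<exists>i\<le>Polynomial.degree P. poly_height P = tabs (Polynomial.coeff P i)"
proof -
  have "poly_height P \<in> (\<lambda>i. tabs (Polynomial.coeff P i)) ` {..Polynomial.degree P}"
    unfolding poly_height_def by (intro Max_in) auto
  thus ?thesis by auto
qed

lemma poly_height_ge_1: "P \<noteq> 0 \<Longrightarrow> 1 \<le> poly_height P"
  using coeff_le_poly_height[of P "Polynomial.degree P"] tabs_ge_1[of "Polynomial.lead_coeff P"]
  by (simp add: order_trans)

lemma poly_height_const [simp]: "poly_height [:c:] = tabs c"
  by (simp add: poly_height_def)

lemma poly_height_coeff_pCons:
  "poly_height P \<le> poly_height (pCons c P)"
  unfolding poly_height_le_iff using coeff_le_poly_height[of "pCons c P" "Suc _"] by simp

lemma tabs_sum_le: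
  assumes "finite I" "0 \<le> B" "\<And>i. i \<in> I \<Longrightarrow> tabs (f i) \<le> B"
  shows "tabs (sum f I) \<le> B"
  using assms by (induction I rule: finite_induct) (auto simp: of_Tpoly_add laurent_abs_add_bound)

lemma tabs_sum_less:
  assumes "finite I" "0 < B" "\<And>i. i \<in> I \<Longrightarrow> tabs (f i) < B"
  shows "tabs (sum f I) < B"
  using assms
proof (induction I rule: finite_induct)
  case (insert x F)
  hence "tabs (f x) < B" "tabs (sum f F) < B" by auto
  thus ?case using insert.hyps laurent_abs_add_le[of "of_Tpoly (f x)" "of_Tpoly (sum f F)"]
    by (simp add: of_Tpoly_add)
qed simp

lemma poly_height_mult_le: "poly_height (P * Q) \<le> poly_height P * poly_height Q"
  unfolding poly_height_le_iff coeff_mult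
  by (intro allI tabs_sum_le) (auto simp: tabs_mult intro!: mult_mono coeff_le_poly_height)

text \<open>At the sum of the two largest indices where the heights are attained, one summand of the
  coefficient of the product dominates.\<close>
lemma poly_height_mult: "poly_height (P * Q) = poly_height P * poly_height Q"
proof (cases "P = 0 \<or> Q = 0")
  case True
  thus ?thesis by (auto simp: poly_height_def)
next
  case False
  have ex: "\<exists>i. tabs (Polynomial.coeff R i) = poly_height R \<and>
      (\<forall>k>i. tabs (Polynomial.coeff R k) < poly_height R)" if "R \<noteq> 0" for R :: "'a poly poly"
  proof -
    let ?S = "{i. i \<le> Polynomial.degree R \<and> tabs (Polynomial.coeff R i) = poly_height R}"
    have fin: "finite ?S" by simp
    have "?S \<noteq> {}" using poly_height_attained[of R] by auto
    hence "Max ?S \<in> ?S" using fin by (rule Max_in[rotated])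
    moreover have "tabs (Polynomial.coeff R k) < poly_height R" if "k > Max ?S" for k
    proof (cases "k \<le> Polynomial.degree R")
      case True
      have "k \<notin> ?S" using that Max_ge[OF fin, of k] by linarith
      thus ?thesis using True coeff_le_poly_height[of R k] by auto
    next
      case False
      thus ?thesis using poly_height_ge_1[OF \<open>R \<noteq> 0\<close>] by (simp add: coeff_eq_0)
    qed
    ultimately show ?thesis by blast
  qed
  obtain i where i: "tabs (Polynomial.coeff P i) = poly_height P"
    "\<And>k. k > i \<Longrightarrow> tabs (Polynomial.coeff P k) < poly_height P" using ex[of P] False by blast
  obtain j where j: "tabs (Polynomial.coeff Q j) = poly_height Q"
    "\<And>k. k > j \<Longrightarrow> tabs (Polynomial.coeff Q k) < poly_height Q" using ex[of Q] False by blast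
  let ?B = "poly_height P * poly_height Q"
  have pos: "0 < poly_height P" "0 < poly_height Q"
    using poly_height_ge_1[of P] poly_height_ge_1[of Q] False by linarith+
  let ?f = "\<lambda>k. Polynomial.coeff P k * Polynomial.coeff Q (i + j - k)"
  have "tabs (sum ?f ({..i + j} - {i})) < ?B"
  proof (rule tabs_sum_less)
    fix k assume k: "k \<in> {..i + j} - {i}"
    show "tabs (?f k) < ?B"
    proof (cases "k > i")
      case True
      hence "tabs (Polynomial.coeff P k) * poly_height Q < ?B"
        using pos i(2) by (intro mult_strict_right_mono) auto
      moreover have "tabs (Polynomial.coeff P k) * tabs (Polynomial.coeff Q (i + j - k))
          \<le> tabs (Polynomial.coeff P k) * poly_height Q"
        by (intro mult_left_mono coeff_le_poly_height) auto
      ultimately show ?thesis unfolding tabs_mult by linarith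
    next
      case False
      hence "i + j - k > j" using k by auto
      hence "poly_height P * tabs (Polynomial.coeff Q (i + j - k)) < ?B"
        using pos j(2) by (intro mult_strict_left_mono) auto
      moreover have "tabs (Polynomial.coeff P k) * tabs (Polynomial.coeff Q (i + j - k))
          \<le> poly_height P * tabs (Polynomial.coeff Q (i + j - k))"
        by (intro mult_right_mono coeff_le_poly_height) auto
      ultimately show ?thesis unfolding tabs_mult by linarith
    qed
  qed (use pos in auto)
  moreover have "tabs (?f i) = ?B" using i j by (simp add: tabs_mult)
  moreover have "Polynomial.coeff (P * Q) (i + j) = ?f i + sum ?f ({..i + j} - {i})"
    unfolding coeff_mult by (subst sum.remove[of _ i]) auto
  ultimately have "tabs (Polynomial.coeff (P * Q) (i + j)) = ?B"
    by (metis laurent_abs_add_eq of_Tpoly_add)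
  thus ?thesis using coeff_le_poly_height[of "P * Q" "i + j"] poly_height_mult_le[of P Q] by linarith
qed

lemma poly_height_smult: "poly_height (smult g P) = tabs g * poly_height P"
  using poly_height_mult[of "[:g:]" P] by simp

lemma finite_bounded_degree: "finite {f :: 'a::{zero,finite} poly. Polynomial.degree f \<le> n}"
proof (rule finite_subset)
  show "{f :: 'a poly. Polynomial.degree f \<le> n} \<subseteq> Poly ` {xs. set xs \<subseteq> UNIV \<and> length xs \<le> Suc n}"
  proof
    fix f :: "'a poly" assume "f \<in> {f. Polynomial.degree f \<le> n}"
    hence "length (coeffs f) \<le> Suc n" by (cases "f = 0") (auto simp: length_coeffs_degree)
    thus "f \<in> Poly ` {xs. set xs \<subseteq> UNIV \<and> length xs \<le> Suc n}"
      by (intro image_eqI[of _ _ "coeffs f"]) auto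
  qed
  show "finite (Poly ` {xs :: 'a list. set xs \<subseteq> UNIV \<and> length xs \<le> Suc n})"
    by (intro finite_imageI finite_lists_length_le) simp
qed

lemma finite_tabs_le: "finite {f :: 'a::finite_field poly. tabs f \<le> B}"
proof -
  obtain n where n: "B < real CARD('a) ^ n" using real_arch_pow[OF card_gt_1] by blast
  have "{f :: 'a poly. tabs f \<le> B} \<subseteq> {f. Polynomial.degree f \<le> n}"
  proof safe
    fix f :: "'a poly" assume f: "tabs f \<le> B"
    show "Polynomial.degree f \<le> n"
    proof (cases "f = 0")
      case False
      hence "real CARD('a) ^ Polynomial.degree f < real CARD('a) ^ n" using f n by (simp add: tabs_eq)
      thus ?thesis using power_less_imp_less_exp[OF card_gt_1] less_imp_le by blast
    qed simp
  qed
  thus ?thesis by (rule finite_subset) (rule finite_bounded_degree)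
qed

text \<open>Northcott property. It turns a lower bound for values at \<xi> into an upper bound for
  an exponent: competitors beating the bound have bounded height.\<close>

lemma finite_bounded_height:
  "finite {P :: 'a::finite_field poly poly. Polynomial.degree P \<le> n \<and> poly_height P \<le> B}"
proof (rule finite_subset)
  let ?F = "{f :: 'a poly. tabs f \<le> B}"
  show "{P :: 'a poly poly. Polynomial.degree P \<le> n \<and> poly_height P \<le> B}
      \<subseteq> Poly ` {xs. set xs \<subseteq> ?F \<and> length xs \<le> Suc n}"
  proof
    fix P :: "'a poly poly" assume "P \<in> {P. Polynomial.degree P \<le> n \<and> poly_height P \<le> B}"
    hence P: "Polynomial.degree P \<le> n" "poly_height P \<le> B" by auto
    hence "length (coeffs P) \<le> Suc n" by (cases "P = 0") (auto simp: length_coeffs_degree)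
    moreover have "set (coeffs P) \<subseteq> ?F"
      using P(2) unfolding poly_height_le_iff by (auto simp: coeffs_def)
    ultimately show "P \<in> Poly ` {xs. set xs \<subseteq> ?F \<and> length xs \<le> Suc n}"
      by (intro image_eqI[of _ _ "coeffs P"]) auto
  qed
  show "finite (Poly ` {xs. set xs \<subseteq> ?F \<and> length xs \<le> Suc n})"
    by (intro finite_imageI finite_lists_length_le finite_tabs_le)
qed


section \<open>Evaluation of polynomials over F_q[T]\<close>

lemma eval_laurent_0 [simp]: "eval_laurent 0 x = 0"
  by (simp add: eval_laurent_def)

lemma eval_laurent_pCons: "eval_laurent (pCons c P) x = of_Tpoly c + x * eval_laurent P x"
  unfolding eval_laurent_def by (rule map_poly_hom_pCons) simp

lemma eval_laurent_add: "eval_laurent (P + Q) x = eval_laurent P x + eval_laurent Q x"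
  unfolding eval_laurent_def by (rule map_poly_hom_add) (simp_all add: of_Tpoly_add)

lemma eval_laurent_mult: "eval_laurent (P * Q) x = eval_laurent P x * eval_laurent Q x"
  unfolding eval_laurent_def by (rule map_poly_hom_mult) (simp_all add: of_Tpoly_add of_Tpoly_mult)

lemma eval_laurent_smult: "eval_laurent (smult c P) x = of_Tpoly c * eval_laurent P x"
  unfolding eval_laurent_def by (rule map_poly_hom_smult) (simp_all add: of_Tpoly_mult)

lemma eval_ac_0 [simp]: "eval_ac 0 x = 0"
  by (simp add: eval_ac_def)

lemma eval_ac_pCons: "eval_ac (pCons c P) x = to_ac (of_Tpoly c) + x * eval_ac P x"
  unfolding eval_ac_def by (rule map_poly_hom_pCons) simp

lemma eval_ac_add: "eval_ac (P + Q) x = eval_ac P x + eval_ac Q x"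
  unfolding eval_ac_def by (rule map_poly_hom_add) (simp_all add: of_Tpoly_add)

lemma eval_ac_mult: "eval_ac (P * Q) x = eval_ac P x * eval_ac Q x"
  unfolding eval_ac_def by (rule map_poly_hom_mult) (simp_all add: of_Tpoly_add of_Tpoly_mult)

lemma eval_ac_smult: "eval_ac (smult c P) x = to_ac (of_Tpoly c) * eval_ac P x"
  unfolding eval_ac_def by (rule map_poly_hom_smult) (simp_all add: of_Tpoly_mult)

lemma eval_ac_to_ac: "eval_ac P (to_ac x) = to_ac (eval_laurent P x)"
  by (induction P) (simp_all add: eval_ac_pCons eval_laurent_pCons)

lemma to_ac_eq_0_iff [simp]: "to_ac x = 0 \<longleftrightarrow> x = 0"
proof
  assume "to_ac x = 0"
  show "x = 0"
  proof (rule ccontr)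
    assume "x \<noteq> 0"
    hence "to_ac (x * inverse x) = 1" by (simp del: to_ac_mult)
    thus False using \<open>to_ac x = 0\<close> by simp
  qed
qed simp

lemma finite_eval_ac_roots:
  assumes "P \<noteq> 0" shows "finite {\<alpha>. eval_ac P \<alpha> = 0}"
proof -
  have "map_poly (\<lambda>f. to_ac (of_Tpoly f)) P \<noteq> 0"
    using assms by (simp add: map_poly_eq_0_iff)
  thus ?thesis unfolding eval_ac_def by (rule poly_roots_finite)
qed

lemma laurent_abs_eval_le:
  assumes "laurent_abs x \<le> 1"
  shows "laurent_abs (eval_laurent P x) \<le> poly_height P"
proof (induction P)
  case (pCons c P)
  have "laurent_abs (x * eval_laurent P x) \<le> 1 * poly_height P"
    unfolding laurent_abs_mult by (intro mult_mono pCons.IH assms) auto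
  thus ?case unfolding eval_laurent_pCons
    using poly_height_coeff_pCons[of P c] coeff_le_poly_height[of "pCons c P" 0]
    by (intro laurent_abs_add_bound) auto
qed simp

text \<open>By the ultrametric inequality the Lipschitz constant on the unit ball is the height
  itself, with no factor from the degree.\<close>

lemma laurent_abs_eval_diff_le:
  assumes "laurent_abs x \<le> 1" "laurent_abs y \<le> 1"
  shows "laurent_abs (eval_laurent P x - eval_laurent P y) \<le> poly_height P * laurent_abs (x - y)"
proof (induction P)
  case (pCons c P)
  have eq: "eval_laurent (pCons c P) x - eval_laurent (pCons c P) y =
     eval_laurent P x * (x - y) + y * (eval_laurent P x - eval_laurent P y)"
    by (simp add: eval_laurent_pCons algebra_simps)
  have "laurent_abs (eval_laurent P x * (x - y)) \<le> poly_height P * laurent_abs (x - y)"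
    unfolding laurent_abs_mult by (intro mult_mono laurent_abs_eval_le assms) auto
  moreover have "laurent_abs (y * (eval_laurent P x - eval_laurent P y)) \<le> 1 * (poly_height P * laurent_abs (x - y))"
    unfolding laurent_abs_mult by (intro mult_mono pCons.IH assms) auto
  ultimately have "laurent_abs (eval_laurent (pCons c P) x - eval_laurent (pCons c P) y)
      \<le> poly_height P * laurent_abs (x - y)"
    unfolding eq by (intro laurent_abs_add_bound) auto
  also have "\<dots> \<le> poly_height (pCons c P) * laurent_abs (x - y)"
    by (intro mult_right_mono poly_height_coeff_pCons) auto
  finally show ?case .
qed simp

subsection \<open>Irreducible polynomials\<close>

lemma is_unit_degree: "p dvd 1 \<Longrightarrow> Polynomial.degree (p :: 'a::idom poly) = 0"
  by (auto simp: is_unit_poly_iff)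

lemma ex_prime_factor:
  fixes c :: "'a::field poly"
  assumes "0 < Polynomial.degree c"
  shows "\<exists>f. prime_elem f \<and> f dvd c \<and> 0 < Polynomial.degree f"
proof -
  define n where "n = (LEAST n. 0 < n \<and> (\<exists>f. f dvd c \<and> Polynomial.degree f = n))"
  have "0 < n \<and> (\<exists>f. f dvd c \<and> Polynomial.degree f = n)"
    unfolding n_def by (rule LeastI[of _ "Polynomial.degree c"]) (intro conjI exI[of _ c] assms dvd_refl refl)
  then obtain f where f: "f dvd c" "Polynomial.degree f = n" "0 < n" by blast
  have min: "n \<le> Polynomial.degree g" if "g dvd c" "0 < Polynomial.degree g" for g
    unfolding n_def by (rule Least_le) (use that in auto)
  have "Factorial_Ring.irreducible f"
  proof (rule irreducibleI)
    show "f \<noteq> 0" using f by auto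
    show "\<not> f dvd 1" using f by (auto dest: is_unit_degree)
    fix a b assume ab: "f = a * b"
    have nz: "a \<noteq> 0" "b \<noteq> 0" using ab \<open>f \<noteq> 0\<close> by auto
    hence deg: "Polynomial.degree a + Polynomial.degree b = n" using ab f by (simp add: degree_mult_eq)
    have "Polynomial.degree a = 0 \<or> n \<le> Polynomial.degree a"
      using min[of a] f(1) ab dvd_mult_left by blast
    hence "Polynomial.degree a = 0 \<or> Polynomial.degree b = 0" using deg by auto
    thus "a dvd 1 \<or> b dvd 1" using nz by (auto simp: is_unit_iff_degree)
  qed
  thus ?thesis using f field_poly_irreducible_imp_prime by blast
qed

text \<open>Gauss' lemma, in a form that needs no factorial structure on \<open>\<bbbF>\<^sub>q[T][X]\<close>: the prime factors of
  \<open>c\<close> are cancelled one at a time.\<close>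
lemma smult_eq_mult_split:
  fixes P Q R :: "'a::field poly poly"
  assumes "smult c P = Q * R" "c \<noteq> 0"
  shows "\<exists>c1 c2 Q' R'. c = c1 * c2 \<and> Q = smult c1 Q' \<and> R = smult c2 R' \<and> P = Q' * R'"
  using assms
proof (induction "Polynomial.degree c" arbitrary: c Q R rule: less_induct)
  case less
  show ?case
  proof (cases "Polynomial.degree c = 0")
    case True
    hence "c dvd 1" using less.prems by (simp add: is_unit_iff_degree)
    then obtain e where e: "1 = c * e" by (elim dvdE)
    have "smult e (smult c P) = Q * smult e R" using less.prems by simp
    hence "P = Q * smult e R" using e by (simp add: mult.commute)
    moreover have "R = smult c (smult e R)" using e by simp
    ultimately show ?thesis
      by (intro exI[of _ 1] exI[of _ c] exI[of _ Q] exI[of _ "smult e R"]) simp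
  next
    case False
    then obtain f c' where f: "prime_elem f" "0 < Polynomial.degree f" and c: "c = f * c'"
      using ex_prime_factor[of c] by (auto elim!: dvdE)
    have nz: "f \<noteq> 0" "c' \<noteq> 0" using c less.prems by auto
    have lt: "Polynomial.degree c' < Polynomial.degree c" using c nz f by (simp add: degree_mult_eq)
    have "[:f:] dvd Q * R"
      using less.prems c by (intro dvdI[of _ _ "smult c' P"]) (simp add: mult.commute)
    moreover have "prime_elem [:f:]" using f by (simp add: prime_elem_const_poly_iff)
    ultimately have "[:f:] dvd Q \<or> [:f:] dvd R" by (rule prime_elem_dvd_multD[rotated])
    thus ?thesis
    proof
      assume "[:f:] dvd Q"
      then obtain Q1 where Q1: "Q = smult f Q1" by (auto elim!: dvdE)
      have "smult f (smult c' P) = smult f (Q1 * R)" using less.prems c Q1 by simp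
      hence "smult c' P = Q1 * R" using nz by (metis smult_cancel)
      from less.hyps[OF lt this nz(2)] obtain c1 c2 Q' R' where
        "c' = c1 * c2" "Q1 = smult c1 Q'" "R = smult c2 R'" "P = Q' * R'" by blast
      thus ?thesis using c Q1
        by (intro exI[of _ "f * c1"] exI[of _ c2] exI[of _ Q'] exI[of _ R']) (simp add: mult_ac)
    next
      assume "[:f:] dvd R"
      then obtain R1 where R1: "R = smult f R1" by (auto elim!: dvdE)
      have "smult f (smult c' P) = smult f (Q * R1)" using less.prems c R1 by simp
      hence "smult c' P = Q * R1" using nz by (metis smult_cancel)
      from less.hyps[OF lt this nz(2)] obtain c1 c2 Q' R' where
        "c' = c1 * c2" "Q = smult c1 Q'" "R1 = smult c2 R'" "P = Q' * R'" by blast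
      thus ?thesis using c R1
        by (intro exI[of _ c1] exI[of _ "f * c2"] exI[of _ Q'] exI[of _ R']) (simp add: mult_ac)
    qed
  qed
qed

lemma unit_poly_poly:
  fixes U :: "'a::field poly poly"
  assumes "U dvd 1" shows "\<exists>u. u \<noteq> 0 \<and> U = [:[:u:]:]"
proof -
  have U: "Polynomial.degree U = 0" using assms by (auto dest: is_unit_degree)
  then obtain g where g: "U = [:g:]" by (rule degree_eq_zeroE)
  hence "g dvd 1" using assms by (simp add: is_unit_const_poly_iff)
  hence "Polynomial.degree g = 0" "g \<noteq> 0" by (auto dest: is_unit_degree)
  thus ?thesis using g by (auto elim!: degree_eq_zeroE)
qed

text \<open>Divisibility over the field F_q(T) brought back to F_q[T]: after the scalar
  \<open>c\<close> is distributed over the factors, the one of positive degree takes all of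
  \<open>P\<close> up to a constant of F_q.\<close>

lemma irreducible_dvd_scaled:
  fixes P Q R :: "'a::field poly poly"
  assumes P: "Factorial_Ring.irreducible P" and eq: "smult c P = Q * R" and c: "c \<noteq> 0"
    and R: "0 < Polynomial.degree R"
  shows "\<exists>g. R = smult g P"
proof -
  obtain c1 c2 Q' R' where *: "Q = smult c1 Q'" "R = smult c2 R'" "P = Q' * R'"
    using smult_eq_mult_split[OF eq c] by blast
  have "\<not> R' dvd 1" using R * by (auto dest: is_unit_degree split: if_splits)
  hence "Q' dvd 1" using irreducibleD[OF P *(3)] by blast
  then obtain u where u: "u \<noteq> 0" "Q' = [:[:u:]:]" using unit_poly_poly by blast
  have "smult [:inverse u:] P = R'" using * u by (simp flip: one_pCons)
  hence "R = smult (c2 * [:inverse u:]) P" using * by (metis smult_smult)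
  thus ?thesis by blast
qed

text \<open>The remainder of \<open>P\<close> on pseudo-division by \<open>S\<close> has degree at
  most 1 and vanishes at the irrational \<alpha>, so it is 0. The scalar \<open>g\<close> remains
  because \<open>S\<close> may have a content.\<close>

lemma irreducible_root_of_quadratic:
  fixes P S :: "'a::finite_field poly poly"
  assumes P: "Factorial_Ring.irreducible P"
    and S: "Polynomial.degree S = 2" "eval_laurent S \<alpha> = 0"
    and irr: "\<And>r s. eval_laurent [:s, r:] \<alpha> = 0 \<Longrightarrow> r = 0 \<and> s = 0"
    and root: "eval_laurent P \<alpha> = 0"
  shows "\<exists>g. S = smult g P"
proof -
  have "S \<noteq> 0" using S by auto
  obtain c q where cq: "c \<noteq> 0" "smult c P = S * q + pseudo_mod P S"
    using pseudo_mod(1)[OF \<open>S \<noteq> 0\<close>] by blast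
  define M where "M = pseudo_mod P S"
  have deg: "Polynomial.degree M \<le> 1"
    using pseudo_mod(2)[OF \<open>S \<noteq> 0\<close>, of P] S(1) unfolding M_def by auto
  have "eval_laurent (smult c P) \<alpha> = eval_laurent (S * q + M) \<alpha>" using cq M_def by simp
  hence "eval_laurent M \<alpha> = 0"
    using root S(2) by (simp add: eval_laurent_add eval_laurent_mult eval_laurent_smult)
  moreover have "M = [:Polynomial.coeff M 0, Polynomial.coeff M 1:]"
    using deg by (intro poly_eqI) (auto simp: coeff_pCons coeff_eq_0 split: nat.splits)
  ultimately have "M = 0" using irr by (metis pCons_0_0)
  hence "smult c P = q * S" using cq M_def by (simp add: mult.commute)
  thus ?thesis by (rule irreducible_dvd_scaled[OF P _ cq(1)]) (use S(1) in simp)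
qed

subsection \<open>Minimal polynomials\<close>

lemma minimal_degree_dvd:
  fixes P Q :: "'a::finite_field poly poly"
  assumes Q: "Factorial_Ring.irreducible Q" "eval_ac Q \<alpha> = 0"
    and P: "P \<noteq> 0" "eval_ac P \<alpha> = 0" "0 < Polynomial.degree P"
    and min: "\<And>R. R \<noteq> 0 \<Longrightarrow> eval_ac R \<alpha> = 0 \<Longrightarrow> Polynomial.degree P \<le> Polynomial.degree R"
  shows "\<exists>g. P = smult g Q"
proof -
  obtain c q where cq: "c \<noteq> 0" "smult c Q = P * q + pseudo_mod Q P"
    using pseudo_mod(1)[OF \<open>P \<noteq> 0\<close>] by blast
  have "eval_ac (smult c Q) \<alpha> = eval_ac (P * q + pseudo_mod Q P) \<alpha>" using cq by simp
  hence "eval_ac (pseudo_mod Q P) \<alpha> = 0"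
    using Q P by (simp add: eval_ac_add eval_ac_mult eval_ac_smult)
  hence "pseudo_mod Q P = 0" using min[of "pseudo_mod Q P"] pseudo_mod(2)[OF \<open>P \<noteq> 0\<close>, of Q] by force
  hence "smult c Q = q * P" using cq by (simp add: mult.commute)
  thus ?thesis by (rule irreducible_dvd_scaled[OF Q(1) _ cq(1)]) (use P in simp)
qed

definition is_min_poly :: "'a::finite_field fls alg_closure \<Rightarrow> 'a poly poly \<Rightarrow> bool" where
  "is_min_poly \<alpha> P \<longleftrightarrow> eval_ac P \<alpha> = 0 \<and> Polynomial.degree P > 0 \<and>
     Factorial_Ring.irreducible P \<and> primitive_poly P \<and>
     Polynomial.lead_coeff (Polynomial.lead_coeff P) = 1"

lemma eval_ac_degree_0:
  assumes "P \<noteq> 0" "eval_ac P \<alpha> = 0" shows "0 < Polynomial.degree P"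
proof (rule ccontr)
  assume "\<not> 0 < Polynomial.degree P"
  then obtain c where "P = [:c:]" by (auto elim: degree_eq_zeroE)
  thus False using assms by (simp add: eval_ac_pCons)
qed

lemma irreducible_primitive:
  fixes P :: "'a::finite_field poly poly"
  assumes "Factorial_Ring.irreducible P" "0 < Polynomial.degree P"
  shows "primitive_poly P"
  unfolding primitive_poly_def
proof (intro allI impI)
  fix f assume "\<forall>i. f dvd Polynomial.coeff P i"
  hence "[:f:] dvd P" by (simp add: const_poly_dvd_iff)
  then obtain R where R: "P = [:f:] * R" by (elim dvdE)
  hence "[:f:] dvd 1 \<or> R dvd 1" using irreducibleD[OF assms(1)] by blast
  thus "f dvd 1"
  proof
    assume "R dvd 1"
    hence "Polynomial.degree R = 0" by (auto dest: is_unit_degree)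
    hence "Polynomial.degree P = 0" using R by auto
    thus ?thesis using assms by simp
  qed (simp add: is_unit_const_poly_iff)
qed

text \<open>Minimise the degree in X, then the degree in T of the leading coefficient. In a
  factorisation whose first factor vanishes at \<alpha>, the first minimality makes the second
  factor constant in X, the second makes it constant in T; so irreducibility over F_q[T] comes out
  directly.\<close>

lemma is_min_poly_exists:
  fixes \<alpha> :: "'a::finite_field fls alg_closure"
  assumes "\<alpha> \<in> algebraic_elements"
  shows "\<exists>P. is_min_poly \<alpha> P"
proof -
  let ?S = "\<lambda>P. P \<noteq> 0 \<and> eval_ac P \<alpha> = 0"
  let ?f = "\<lambda>P :: 'a poly poly. Polynomial.degree P"
  let ?g = "\<lambda>P :: 'a poly poly. Polynomial.degree (Polynomial.lead_coeff P)"
  have "\<exists>P. ?S P" using assms by (auto simp: algebraic_elements_def)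
  then obtain P0 where P0: "?S P0" "\<And>R. ?S R \<Longrightarrow> ?f P0 \<le> ?f R"
    using ex_has_least_nat[of ?S _ ?f] by blast
  then obtain P where P: "?S P" "?f P = ?f P0" and minP: "\<And>R. ?S R \<Longrightarrow> ?f R = ?f P0 \<Longrightarrow> ?g P \<le> ?g R"
    using ex_has_least_nat[of "\<lambda>P. ?S P \<and> ?f P = ?f P0" P0 ?g] by blast
  have pos: "0 < ?f P" using P eval_ac_degree_0 by blast
  have *: "B dvd 1" if "P = A * B" "eval_ac A \<alpha> = 0" for A B
  proof -
    have nz: "A \<noteq> 0" "B \<noteq> 0" using that P by auto
    hence "?f A + ?f B = ?f P" using that by (simp add: degree_mult_eq)
    moreover have "?f P \<le> ?f A" using P0(2)[of A] P(2) that nz by simp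
    ultimately have B: "?f B = 0" "?f A = ?f P0" using P(2) by simp_all
    have "Polynomial.lead_coeff P = Polynomial.lead_coeff A * Polynomial.lead_coeff B"
      using that lead_coeff_mult by blast
    hence "?g P = ?g A + ?g B" using nz by (simp add: degree_mult_eq)
    moreover have "?g P \<le> ?g A" using minP[of A] B that nz by simp
    ultimately have "?g B = 0" by simp
    then obtain b where "B = [:b:]" "Polynomial.degree b = 0" using B by (auto elim!: degree_eq_zeroE)
    thus ?thesis using nz by (auto simp: is_unit_iff_degree is_unit_const_poly_iff)
  qed
  have irr: "Factorial_Ring.irreducible P"
  proof (rule irreducibleI)
    show "P \<noteq> 0" using P by simp
    show "\<not> P dvd 1" using pos by (auto dest: is_unit_degree)
    fix A B assume AB: "P = A * B"
    hence "eval_ac A \<alpha> = 0 \<or> eval_ac B \<alpha> = 0" using P by (auto simp: eval_ac_mult)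
    thus "A dvd 1 \<or> B dvd 1" using *[of A B] *[of B A] AB by (auto simp: mult.commute)
  qed
  define u where "u = Polynomial.lead_coeff (Polynomial.lead_coeff P)"
  define R where "R = smult [:inverse u:] P"
  have u: "u \<noteq> 0" unfolding u_def using P(1) by (simp only: leading_coeff_0_iff simp_thms)
  have un: "[:[:inverse u:]:] dvd 1" using u by (simp add: is_unit_const_poly_iff dvd_field_iff)
  have R: "R = [:[:inverse u:]:] * P" by (simp add: R_def)
  have "Factorial_Ring.irreducible R"
    unfolding R using irr un by (simp only: irreducible_mult_unit_left)
  moreover have "?f R = ?f P" using u by (simp add: R_def)
  moreover have "eval_ac R \<alpha> = 0" using P by (simp add: R_def eval_ac_smult)
  moreover have "Polynomial.lead_coeff (Polynomial.lead_coeff R) = 1"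
    using u by (simp add: R_def lead_coeff_smult u_def[symmetric])
  ultimately have "is_min_poly \<alpha> R"
    unfolding is_min_poly_def using pos irreducible_primitive[of R] by simp
  thus ?thesis by blast
qed

text \<open>Both polynomials divide one of least degree up to scalars, so they are proportional over
  F_q(T), hence \<open>Q = smult k P\<close>. Irreducibility of \<open>Q\<close> forces
  \<open>k\<close> into F_q, and the monic normalisation makes it 1.\<close>

lemma is_min_poly_unique:
  fixes \<alpha> :: "'a::finite_field fls alg_closure"
  assumes P: "is_min_poly \<alpha> P" and Q: "is_min_poly \<alpha> Q"
  shows "P = Q"
proof -
  let ?S = "\<lambda>P. P \<noteq> 0 \<and> eval_ac P \<alpha> = 0"
  let ?f = "\<lambda>P :: 'a poly poly. Polynomial.degree P"
  have "?S P" using P by (auto simp: is_min_poly_def)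
  then obtain M where M: "?S M" "\<And>R. ?S R \<Longrightarrow> ?f M \<le> ?f R"
    using ex_has_least_nat[of ?S _ ?f] by blast
  have pos: "0 < ?f M" using M eval_ac_degree_0 by blast
  obtain g where g: "M = smult g P"
    using minimal_degree_dvd[of P \<alpha> M] P M pos by (auto simp: is_min_poly_def)
  obtain h where h: "M = smult h Q"
    using minimal_degree_dvd[of Q \<alpha> M] Q M pos by (auto simp: is_min_poly_def)
  have "g \<noteq> 0" using g M by auto
  moreover have "smult g P = [:h:] * Q" using g h by simp
  ultimately obtain k where k: "Q = smult k P"
    using irreducible_dvd_scaled[of P g "[:h:]" Q] P Q by (auto simp: is_min_poly_def)
  hence "Q = [:k:] * P" by simp
  hence "[:k:] dvd 1 \<or> P dvd 1" using Q irreducibleD unfolding is_min_poly_def by blast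
  moreover have "\<not> P dvd 1" using P by (auto simp: is_min_poly_def dest: is_unit_degree)
  ultimately have "k dvd 1" by (simp add: is_unit_const_poly_iff)
  then obtain e where e: "k = [:e:]" by (auto dest!: is_unit_degree elim!: degree_eq_zeroE)
  have "Polynomial.lead_coeff (Polynomial.lead_coeff Q) = e * Polynomial.lead_coeff (Polynomial.lead_coeff P)"
    using k e by (simp add: lead_coeff_smult)
  hence "e = 1" using P Q by (simp add: is_min_poly_def)
  thus ?thesis using k e by (simp flip: one_pCons)
qed

lemma min_poly_eqI: "is_min_poly \<alpha> P \<Longrightarrow> min_poly \<alpha> = P"
  unfolding min_poly_def
  by (rule the_equality) (auto simp: is_min_poly_def intro: is_min_poly_unique[unfolded is_min_poly_def])

lemma is_min_poly_min_poly: "\<alpha> \<in> algebraic_elements \<Longrightarrow> is_min_poly \<alpha> (min_poly \<alpha>)"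
  using is_min_poly_exists min_poly_eqI by metis

lemma is_min_polyD:
  assumes "is_min_poly \<alpha> P"
  shows "eval_ac P \<alpha> = 0" "Polynomial.degree P > 0" "Factorial_Ring.irreducible P" "P \<noteq> 0"
  using assms by (auto simp: is_min_poly_def)

lemma finite_alg_bounded_height:
  "finite {\<alpha> \<in> algebraic_elements. alg_degree \<alpha> \<le> n \<and> alg_height \<alpha> \<le> B}"
proof (rule finite_subset)
  let ?F = "{P. Polynomial.degree P \<le> n \<and> poly_height P \<le> B} - {0}"
  show "{\<alpha> \<in> algebraic_elements. alg_degree \<alpha> \<le> n \<and> alg_height \<alpha> \<le> B} \<subseteq> (\<Union>P\<in>?F. {\<alpha>. eval_ac P \<alpha> = 0})"
    using is_min_polyD[OF is_min_poly_min_poly] by (fastforce simp: alg_degree_def alg_height_def)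
  show "finite (\<Union>P\<in>?F. {\<alpha>. eval_ac P \<alpha> = 0})"
    by (intro finite_UN_I finite_Diff finite_bounded_height finite_eval_ac_roots) auto
qed

subsection \<open>Convergence of continued fractions\<close>

unbundle fps_syntax

lemma laurent_abs_ge_nth:
  fixes x :: "'a::finite_field fls"
  assumes "x $$ n \<noteq> 0" shows "real CARD('a) powi (- n) \<le> laurent_abs x"
proof -
  have "x \<noteq> 0" using assms by auto
  moreover have "fls_subdegree x \<le> n" using assms by (rule fls_subdegree_leI)
  ultimately show ?thesis using card_gt_1[where 'a='a]
    unfolding laurent_abs_def by (auto intro!: power_int_increasing)
qed

lemma laurent_abs_telescope:
  assumes "\<And>k. laurent_abs (f (Suc k) - f k) \<le> (1/2) ^ k"
  shows "laurent_abs (f (k + j) - f k) \<le> (1/2) ^ k"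
proof (induction j)
  case (Suc j)
  have "f (k + Suc j) - f k = (f (Suc (k + j)) - f (k + j)) + (f (k + j) - f k)" by simp
  moreover have "laurent_abs (f (Suc (k + j)) - f (k + j)) \<le> (1/2) ^ k"
    by (rule order_trans[OF assms]) (intro power_decreasing, auto)
  ultimately show ?case using Suc.IH by (metis laurent_abs_add_bound)
qed simp

lemma powi_card_pos: "0 < real CARD('a::finite_field) powi n"
  using card_gt_1[where 'a='a] by (intro zero_less_power_int) simp

lemma half_power_less: "0 < e \<Longrightarrow> \<exists>K. \<forall>k\<ge>K. (1/2 :: real) ^ k < e"
proof -
  assume "0 < e"
  then obtain K where "(1/2 :: real) ^ K < e" using real_arch_pow_inv[of e "1/2"] by auto
  moreover have "(1/2 :: real) ^ k \<le> (1/2) ^ K" if "K \<le> k" for k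
    using that by (intro power_decreasing) auto
  ultimately show ?thesis by (meson le_less_trans)
qed

text \<open>The coefficients of a Cauchy sequence of Laurent series are eventually constant.\<close>
lemma laurent_Cauchy_limit:
  fixes f :: "nat \<Rightarrow> 'a::finite_field fls"
  assumes f: "\<And>k. laurent_abs (f (Suc k) - f k) \<le> (1/2) ^ k"
  shows "\<exists>L. \<forall>k. laurent_abs (f k - L) \<le> (1/2) ^ k"
proof -
  have "\<exists>K. \<forall>k\<ge>K. f k $$ n = f K $$ n" for n
  proof -
    obtain K where K: "\<forall>k\<ge>K. (1/2 :: real) ^ k < real CARD('a) powi (- n)"
      using half_power_less[OF powi_card_pos] by blast
    have "f k $$ n = f K $$ n" if "k \<ge> K" for k
    proof (rule ccontr)
      assume "f k $$ n \<noteq> f K $$ n"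
      hence "real CARD('a) powi (- n) \<le> laurent_abs (f k - f K)"
        by (intro laurent_abs_ge_nth) simp
      also have "\<dots> \<le> (1/2) ^ K" using laurent_abs_telescope[of f K "k - K"] f that by simp
      finally show False using K by (meson order_refl not_less)
    qed
    thus ?thesis by blast
  qed
  then obtain K where K: "\<And>n k. k \<ge> K n \<Longrightarrow> f k $$ n = f (K n) $$ n" by metis
  define g where "g = (\<lambda>n. f (K n) $$ n)"
  \<comment> \<open>A common bound for the whole sequence bounds the order of the pole, so that
    \<open>g\<close> really is the coefficient sequence of a Laurent series.\<close>
  define B where "B = max (laurent_abs (f 0)) 1"
  have fB: "laurent_abs (f k) \<le> B" for k
    using laurent_abs_telescope[of f 0 k] f laurent_abs_add_bound[of "f k - f 0" B "f 0"]
    by (simp add: B_def)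
  obtain M where M: "B < real CARD('a) ^ M" using real_arch_pow[OF card_gt_1] by blast
  have zero: "g n = 0" if "n < - int M" for n
  proof (rule ccontr)
    assume "g n \<noteq> 0"
    hence "real CARD('a) powi (- n) \<le> B"
      using laurent_abs_ge_nth fB unfolding g_def by (metis order_trans)
    moreover have "real CARD('a) powi (int M) \<le> real CARD('a) powi (- n)"
      using that card_gt_1[where 'a='a] by (intro power_int_increasing) auto
    ultimately show False using M by simp
  qed
  define L where "L = Abs_fls g"
  have L: "L $$ n = g n" for n
    unfolding L_def by (rule nth_Abs_fls_lower_bound[of "- int M"]) (use zero in blast)
  have "laurent_abs (f k - L) \<le> (1/2) ^ k" for k
  proof (cases "f k = L")
    case False
    define n where "n = fls_subdegree (f k - L)"
    define j where "j = max k (K n)"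
    have "(f k - L) $$ n \<noteq> 0" using False unfolding n_def by (intro nth_fls_subdegree_nonzero) simp
    hence "f k $$ n \<noteq> f j $$ n" using L K[of n j] by (simp add: g_def j_def)
    hence "real CARD('a) powi (- n) \<le> laurent_abs (f j - f k)"
      by (intro laurent_abs_ge_nth) simp
    also have "\<dots> \<le> (1/2) ^ k" using laurent_abs_telescope[of f k "j - k"] f by (simp add: j_def)
    finally show ?thesis using False by (simp add: laurent_abs_def n_def)
  qed simp
  thus ?thesis by blast
qed

unbundle no fps_syntax

text \<open>The absolute value has base q and the library metric base 2; the two are compared
  through the subdegree.\<close>

lemma laurent_abs_tendsto:
  fixes f :: "nat \<Rightarrow> 'a::finite_field fls"
  assumes "\<And>k. laurent_abs (f k - L) \<le> (1/2) ^ k"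
  shows "f \<longlonglongrightarrow> L"
proof (rule metric_LIMSEQ_I)
  fix e :: real assume "0 < e"
  then obtain N where N: "(1/2 :: real) ^ N < e" using half_power_less by blast
  obtain K where K: "\<forall>k\<ge>K. (1/2 :: real) ^ k < real CARD('a) powi (- int N)"
    using half_power_less[OF powi_card_pos] by blast
  have "dist (f k) L < e" if "k \<ge> K" for k
  proof (cases "f k = L")
    case False
    have "laurent_abs (f k - L) < real CARD('a) powi (- int N)" using assms[of k] K that by fastforce
    hence "\<not> fls_subdegree (f k - L) \<le> int N"
      using False power_int_increasing[of "- int N" "- fls_subdegree (f k - L)" "real CARD('a)"]
        card_gt_1[where 'a='a] by (auto simp: laurent_abs_def)
    hence "dist (f k) L = (1/2) ^ nat (fls_subdegree (f k - L))" and "N \<le> nat (fls_subdegree (f k - L))"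
      using False by (auto simp: dist_fls_def power_one_over inverse_eq_divide)
    moreover from this have "(1/2 :: real) ^ nat (fls_subdegree (f k - L)) \<le> (1/2) ^ N"
      by (intro power_decreasing) auto
    ultimately show ?thesis using N by linarith
  qed (use \<open>0 < e\<close> in simp)
  thus "\<exists>K. \<forall>k\<ge>K. dist (f k) L < e" by blast
qed

lemma one_divide_less_1: "1 < (x::real) \<Longrightarrow> 1 / x < 1"
  by simp

lemma tabs_ge_2: "0 < Polynomial.degree (f :: 'a::finite_field poly) \<Longrightarrow> 2 \<le> tabs f"
proof -
  assume f: "0 < Polynomial.degree f"
  have "2 \<le> real CARD('a)" using card_gt_1[where 'a='a] by simp
  moreover have "real CARD('a) ^ 1 \<le> real CARD('a) ^ Polynomial.degree f"
    using f card_gt_1[where 'a='a] by (intro power_increasing) auto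
  moreover have "f \<noteq> 0" using f by auto
  ultimately show ?thesis using tabs_eq[of f] unfolding power_one_right by linarith
qed

lemma laurent_abs_cf_convergent:
  assumes "\<And>n. 0 < Polynomial.degree (t n)"
  shows "laurent_abs (cf_convergent t k) = tabs (t 0)"
  using assms
proof (induction k arbitrary: t)
  case (Suc k)
  have "laurent_abs (1 / cf_convergent (\<lambda>i. t (Suc i)) k) = 1 / tabs (t 1)"
    using Suc.IH[of "\<lambda>i. t (Suc i)"] Suc.prems by (simp add: laurent_abs_divide)
  also have "\<dots> < tabs (t 0)" using tabs_gt_1[OF Suc.prems, of 0] tabs_gt_1[OF Suc.prems, of 1]
    by (smt (verit) divide_less_eq_1)
  finally show ?case by (simp add: laurent_abs_add_eq)
qed simp

lemma laurent_abs_inverse_diff: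
  assumes "x \<noteq> 0" "y \<noteq> 0"
  shows "laurent_abs (1 / x - 1 / y) = laurent_abs (x - y) / (laurent_abs x * laurent_abs y)"
proof -
  have "1 / x - 1 / y = (y - x) / (x * y)" using assms by (simp add: field_simps)
  thus ?thesis by (simp add: laurent_abs_divide laurent_abs_mult laurent_abs_diff_commute)
qed

lemma laurent_abs_inverse_diff_le:
  assumes "1 \<le> laurent_abs x" "2 \<le> laurent_abs y" "laurent_abs (x - y) \<le> e"
  shows "laurent_abs (1 / x - 1 / y) \<le> e / 2"
proof -
  have nz: "x \<noteq> 0" "y \<noteq> 0" using assms by auto
  have "1 * 2 \<le> laurent_abs x * laurent_abs y" using assms by (intro mult_mono) auto
  hence "laurent_abs (x - y) / (laurent_abs x * laurent_abs y) \<le> e / 2"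
    using assms by (intro frac_le) (auto intro: order_trans[OF laurent_abs_nonneg])
  thus ?thesis using nz by (simp add: laurent_abs_inverse_diff)
qed

text \<open>Induction on \<open>k\<close> with shifted sequences: taking reciprocals of two tails
  divides their distance by the product of their sizes, hence by at least 2. The rate is crude but
  gives convergence.\<close>

lemma cf_convergent_diff_le:
  assumes "\<And>n. 0 < n \<Longrightarrow> 0 < Polynomial.degree (s n)"
  shows "laurent_abs (cf_convergent s (Suc k) - cf_convergent s k) \<le> (1/2) ^ k"
  using assms
proof (induction k arbitrary: s)
  case 0
  have "laurent_abs (1 / of_Tpoly (s 1)) \<le> 1"
    using one_divide_less_1[OF tabs_gt_1[of "s 1"]] 0 by (simp add: laurent_abs_divide less_imp_le)
  thus ?case by simp
next
  case (Suc k)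
  let ?t = "\<lambda>i. s (Suc i)"
  have abs: "laurent_abs (cf_convergent ?t k) = tabs (s 1)" for k
    using laurent_abs_cf_convergent[of ?t k] Suc.prems by simp
  have "2 \<le> tabs (s 1)" using Suc.prems by (intro tabs_ge_2) simp
  moreover have "laurent_abs (cf_convergent ?t (Suc k) - cf_convergent ?t k) \<le> (1/2) ^ k"
    by (rule Suc.IH) (rule Suc.prems, simp)
  ultimately have "laurent_abs (1 / cf_convergent ?t (Suc k) - 1 / cf_convergent ?t k) \<le> (1/2) ^ k / 2"
    using abs[of k] abs[of "Suc k"] by (intro laurent_abs_inverse_diff_le) linarith+
  thus ?case by simp
qed

lemma cf_value_approx:
  assumes "\<And>n. 0 < n \<Longrightarrow> 0 < Polynomial.degree (s n)"
  shows "laurent_abs (cf_convergent s k - cf_value s) \<le> (1/2) ^ k"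
proof -
  have "\<exists>L. \<forall>k. laurent_abs (cf_convergent s k - L) \<le> (1/2) ^ k"
    by (intro laurent_Cauchy_limit cf_convergent_diff_le assms)
  then obtain L where L: "\<And>k. laurent_abs (cf_convergent s k - L) \<le> (1/2) ^ k" by blast
  hence "cf_value s = L" unfolding cf_value_def by (intro limI laurent_abs_tendsto)
  thus ?thesis using L by simp
qed

lemma cf_value_abs:
  assumes "\<And>n. 0 < Polynomial.degree (t n)"
  shows "laurent_abs (cf_value t) = tabs (t 0)"
proof -
  have "laurent_abs (cf_convergent t 0 - cf_value t) \<le> 1" using cf_value_approx[of t 0] assms by simp
  moreover have "1 < laurent_abs (cf_convergent t 0)" using tabs_gt_1[OF assms, of 0] by simp
  ultimately have "laurent_abs (cf_convergent t 0 - (cf_convergent t 0 - cf_value t)) = laurent_abs (cf_convergent t 0)"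
    by (intro laurent_abs_diff_eq) simp
  thus ?thesis by simp
qed

lemma cf_value_rec:
  assumes "\<And>n. 0 < n \<Longrightarrow> 0 < Polynomial.degree (s n)"
  shows "cf_value s = of_Tpoly (s 0) + 1 / cf_value (\<lambda>i. s (Suc i))"
proof -
  let ?t = "\<lambda>i. s (Suc i)"
  let ?y = "of_Tpoly (s 0) + 1 / cf_value ?t"
  have "2 \<le> tabs (s 1)" using assms by (intro tabs_ge_2) simp
  moreover have "laurent_abs (cf_value ?t) = tabs (s 1)" using cf_value_abs[of ?t] assms by simp
  moreover have "laurent_abs (cf_convergent ?t k) = tabs (s 1)" for k
    using laurent_abs_cf_convergent[of ?t k] assms by simp
  ultimately have "laurent_abs (1 / cf_convergent ?t k - 1 / cf_value ?t) \<le> (1/2) ^ k / 2" for k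
    using cf_value_approx[of ?t] assms by (intro laurent_abs_inverse_diff_le) simp_all
  moreover have "(1/2 :: real) ^ k / 2 \<le> (1/2) ^ k" for k by simp
  ultimately have "laurent_abs (1 / cf_convergent ?t k - 1 / cf_value ?t) \<le> (1/2) ^ k" for k
    by (meson order_trans)
  hence "(\<lambda>k. cf_convergent s (Suc k)) \<longlonglongrightarrow> ?y" by (intro laurent_abs_tendsto) simp
  moreover have "(\<lambda>k. cf_convergent s (Suc k)) \<longlonglongrightarrow> cf_value s"
    by (intro LIMSEQ_Suc laurent_abs_tendsto cf_value_approx assms)
  ultimately show ?thesis by (rule LIMSEQ_unique[rotated])
qed

subsection \<open>Continuants\<close>

fun cf_num :: "(nat \<Rightarrow> 'a::comm_ring_1) \<Rightarrow> nat \<Rightarrow> 'a" where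
  "cf_num s 0 = 1"
| "cf_num s (Suc 0) = s 0"
| "cf_num s (Suc (Suc n)) = s (Suc n) * cf_num s (Suc n) + cf_num s n"

text \<open>Indices are shifted by one: the \<open>k\<close>-th convergent is \<open>cf_num s (k + 1) / cf_den s (k + 1)\<close>.\<close>
fun cf_den :: "(nat \<Rightarrow> 'a::comm_ring_1) \<Rightarrow> nat \<Rightarrow> 'a" where
  "cf_den s 0 = 0"
| "cf_den s (Suc 0) = 1"
| "cf_den s (Suc (Suc n)) = s (Suc n) * cf_den s (Suc n) + cf_den s n"

lemma cf_det: "cf_den s n * cf_num s (Suc n) - cf_num s n * cf_den s (Suc n) = (- 1) ^ Suc n"
proof (induction n)
  case (Suc n)
  have "cf_den s (Suc n) * cf_num s (Suc (Suc n)) - cf_num s (Suc n) * cf_den s (Suc (Suc n))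
      = - (cf_den s n * cf_num s (Suc n) - cf_num s n * cf_den s (Suc n))"
    by (simp add: algebra_simps)
  thus ?case using Suc by simp
qed simp

text \<open>The size of the denominator \<open>cf_den s (Suc n)\<close>. The letter
  \<open>s 0\<close> is left out because denominators do not contain it.\<close>

definition cf_size :: "(nat \<Rightarrow> 'a::finite_field poly) \<Rightarrow> nat \<Rightarrow> real" where
  "cf_size s n = (\<Prod>k\<in>{1..n}. tabs (s k))"

lemma cf_size_0 [simp]: "cf_size s 0 = 1"
  by (simp add: cf_size_def)

lemma cf_size_Suc: "cf_size s (Suc n) = tabs (s (Suc n)) * cf_size s n"
  by (simp add: cf_size_def)

definition cf_form :: "(nat \<Rightarrow> 'a::finite_field poly) \<Rightarrow> nat \<Rightarrow> 'a fls \<Rightarrow> 'a fls" where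
  "cf_form s k x = of_Tpoly (cf_den s k) * x - of_Tpoly (cf_num s k)"

definition cf_lin :: "(nat \<Rightarrow> 'a::finite_field poly) \<Rightarrow> nat \<Rightarrow> 'a poly poly" where
  "cf_lin s k = [: - cf_num s k, cf_den s k :]"

lemma eval_cf_lin: "eval_laurent (cf_lin s k) x = cf_form s k x"
  by (simp add: cf_lin_def cf_form_def eval_laurent_pCons of_Tpoly_minus)

lemma cf_form_Suc_Suc: "cf_form s (Suc (Suc k)) x = of_Tpoly (s (Suc k)) * cf_form s (Suc k) x + cf_form s k x"
  by (simp add: cf_form_def of_Tpoly_add of_Tpoly_mult algebra_simps)

locale cfrac =
  fixes s :: "nat \<Rightarrow> 'a::finite_field poly"
  assumes s_0: "s 0 = 0" and deg_pos: "0 < n \<Longrightarrow> 0 < Polynomial.degree (s n)"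
begin

text \<open>The complete quotients of the continued fraction.\<close>

definition quot :: "nat \<Rightarrow> 'a fls" where "quot k = cf_value (\<lambda>i. s (i + k))"

lemma quot_rec: "quot k = of_Tpoly (s k) + 1 / quot (Suc k)"
  unfolding quot_def using cf_value_rec[of "\<lambda>i. s (i + k)"] deg_pos by simp

lemma laurent_abs_quot: "0 < k \<Longrightarrow> laurent_abs (quot k) = tabs (s k)"
  unfolding quot_def using cf_value_abs[of "\<lambda>i. s (i + k)"] deg_pos by simp

lemma quot_nonzero: "0 < k \<Longrightarrow> quot k \<noteq> 0"
  using laurent_abs_quot[of k] deg_pos[of k] tabs_gt_1[of "s k"] by force

lemma cf_value_eq_quot: "cf_value s = quot 0"
  by (simp add: quot_def)

lemma laurent_abs_value: "laurent_abs (cf_value s) < 1"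
  using quot_rec[of 0] laurent_abs_quot[of 1] tabs_gt_1[OF deg_pos, of 1]
  by (simp add: cf_value_eq_quot s_0 laurent_abs_divide one_divide_less_1)

lemma cf_size_ge: "2 ^ n \<le> cf_size s n"
proof (induction n)
  case (Suc n)
  have "2 * 2 ^ n \<le> tabs (s (Suc n)) * cf_size s n"
    using Suc.IH tabs_ge_2[OF deg_pos] by (intro mult_mono) auto
  thus ?case by (simp add: cf_size_Suc)
qed simp

lemma cf_size_pos [simp]: "0 < cf_size s n"
  using cf_size_ge[of n] by (meson less_le_trans zero_less_numeral zero_less_power)

lemma cf_size_strict_mono: "m < n \<Longrightarrow> cf_size s m < cf_size s n"
proof (rule lift_Suc_mono_less)
  fix n
  have "1 * cf_size s n < tabs (s (Suc n)) * cf_size s n"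
    using tabs_gt_1[OF deg_pos, of "Suc n"] by (intro mult_strict_right_mono) auto
  thus "cf_size s n < cf_size s (Suc n)" by (simp add: cf_size_Suc)
qed

lemma cf_size_mono: "m \<le> n \<Longrightarrow> cf_size s m \<le> cf_size s n"
  using cf_size_strict_mono[of m n] by (cases "m = n") auto

lemma tabs_cf_den: "tabs (cf_den s (Suc n)) = cf_size s n"
proof -
  have "tabs (cf_den s (Suc n)) = cf_size s n \<and> tabs (cf_den s n) < cf_size s n"
  proof (induction n)
    case (Suc n)
    have *: "tabs (s (Suc n) * cf_den s (Suc n)) = cf_size s (Suc n)"
      using Suc by (simp add: tabs_mult cf_size_Suc)
    have "tabs (cf_den s n) < cf_size s (Suc n)"
      using Suc cf_size_strict_mono[of n "Suc n"] by linarith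
    hence "tabs (cf_den s (Suc (Suc n))) = cf_size s (Suc n)"
      using * by (simp add: of_Tpoly_add laurent_abs_add_eq)
    thus ?case using Suc cf_size_strict_mono[of n "Suc n"] by simp
  qed simp
  thus ?thesis ..
qed

text \<open>This is x = (p X + p') / (q X + q') for the complete quotient X, cleared of its
  denominator. Each linear form is thus minus the next one times a complete quotient, which makes
  its size an exact product of sizes of letters.\<close>

lemma cf_form_quot: "cf_form s (Suc k) (cf_value s) * quot (Suc k) + cf_form s k (cf_value s) = 0"
proof (induction k)
  case 0
  have "cf_value s = 1 / quot 1" using quot_rec[of 0] by (simp add: cf_value_eq_quot s_0)
  thus ?case using quot_nonzero[of 1] by (simp add: cf_form_def s_0)
next
  case (Suc k)
  define x where "x = cf_value s"
  have nz: "quot (Suc (Suc k)) \<noteq> 0" by (rule quot_nonzero) simp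
  have "cf_form s k x = - cf_form s (Suc k) x * quot (Suc k)"
    using Suc.IH by (simp add: x_def eq_neg_iff_add_eq_0 add.commute)
  hence "cf_form s (Suc (Suc k)) x = - cf_form s (Suc k) x * (quot (Suc k) - of_Tpoly (s (Suc k)))"
    by (simp add: cf_form_Suc_Suc algebra_simps)
  also have "quot (Suc k) - of_Tpoly (s (Suc k)) = 1 / quot (Suc (Suc k))"
    using quot_rec[of "Suc k"] by simp
  finally show ?case using nz by (simp add: x_def)
qed

lemma laurent_abs_cf_form: "laurent_abs (cf_form s k (cf_value s)) = 1 / cf_size s k"
proof (induction k)
  case 0
  show ?case by (simp add: cf_form_def)
next
  case (Suc k)
  have "cf_form s k (cf_value s) = - (cf_form s (Suc k) (cf_value s) * quot (Suc k))"
    using cf_form_quot[of k] by (simp add: eq_neg_iff_add_eq_0 add.commute)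
  hence "1 / cf_size s k = laurent_abs (cf_form s (Suc k) (cf_value s)) * tabs (s (Suc k))"
    using Suc.IH by (simp add: laurent_abs_mult laurent_abs_quot)
  moreover have "tabs (s (Suc k)) > 0" using tabs_gt_1[OF deg_pos, of "Suc k"] by linarith
  moreover have "b = 1 / (c * a)" if "1 / a = b * c" "0 < c" "0 < a" for a b c :: real
    using that by (simp add: field_simps)
  ultimately show ?case by (simp only: cf_size_Suc cf_size_pos)
qed

lemma tabs_cf_num_le: "0 < k \<Longrightarrow> tabs (cf_num s k) \<le> cf_size s (k - 1)"
proof -
  assume k: "0 < k"
  define x where "x = cf_value s"
  have "of_Tpoly (cf_num s k) = of_Tpoly (cf_den s k) * x - cf_form s k x"
    by (simp add: cf_form_def)
  moreover have "laurent_abs (of_Tpoly (cf_den s k) * x) \<le> cf_size s (k - 1)"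
    using tabs_cf_den[of "k - 1"] k laurent_abs_value
    by (simp add: laurent_abs_mult x_def mult_left_le)
  moreover have "1 / cf_size s k \<le> cf_size s (k - 1)"
    using cf_size_ge[of k] cf_size_ge[of "k - 1"] one_le_power[of "2::real"]
    by (smt (verit) divide_le_eq_1)
  hence "laurent_abs (cf_form s k x) \<le> cf_size s (k - 1)"
    using laurent_abs_cf_form[of k] by (simp add: x_def)
  ultimately show ?thesis using laurent_abs_diff_bound by metis
qed

text \<open>A linear relation makes \<open>r\<close> times any form \<open>cf_form s k x\<close> a
  polynomial in T. For large \<open>k\<close> its size is below 1, so it vanishes; but the forms
  themselves never do.\<close>

lemma irrational:
  assumes "eval_laurent [:e, r:] (cf_value s) = 0"
  shows "r = 0 \<and> e = 0"
proof (cases "r = 0")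
  case True
  thus ?thesis using assms by (simp add: eval_laurent_pCons)
next
  case False
  define x where "x = cf_value s"
  obtain k where k: "tabs r < 2 ^ k" using real_arch_pow[of 2] by auto
  have rx: "of_Tpoly r * x = - of_Tpoly e"
    using assms by (simp add: eval_laurent_pCons x_def eq_neg_iff_add_eq_0 algebra_simps)
  have "of_Tpoly r * cf_form s k x = of_Tpoly (cf_den s k) * (of_Tpoly r * x) - of_Tpoly r * of_Tpoly (cf_num s k)"
    by (simp add: cf_form_def algebra_simps)
  also have "\<dots> = of_Tpoly (- (cf_den s k * e) - r * cf_num s k)"
    unfolding rx by (simp add: of_Tpoly_minus of_Tpoly_diff of_Tpoly_mult)
  finally have eq: "of_Tpoly r * cf_form s k x = of_Tpoly (- (cf_den s k * e) - r * cf_num s k)" .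
  have abs: "laurent_abs (of_Tpoly r * cf_form s k x) = tabs r / cf_size s k"
    by (simp add: laurent_abs_mult laurent_abs_cf_form x_def)
  also have "\<dots> < 1" using k cf_size_ge[of k] by simp
  finally have "- (cf_den s k * e) - r * cf_num s k = 0"
    unfolding eq tabs_less_1_iff .
  hence "tabs r / cf_size s k = 0" using abs eq by simp
  thus ?thesis using False cf_size_pos[of k] by simp
qed

end

text \<open>Subtracting complete quotients, \<open>x\<^sub>k - y\<^sub>k = - (x\<^sub>k\<^sub>+\<^sub>1 - y\<^sub>k\<^sub>+\<^sub>1) / (x\<^sub>k\<^sub>+\<^sub>1 y\<^sub>k\<^sub>+\<^sub>1)\<close> as long as
  the partial quotients agree.\<close>
lemma cfrac_diff:
  assumes s: "cfrac s" and t: "cfrac t"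
    and eq: "\<And>k. k \<le> N \<Longrightarrow> s k = t k" and ne: "s (Suc N) \<noteq> t (Suc N)"
  shows "laurent_abs (cf_value s - cf_value t) =
    tabs (s (Suc N) - t (Suc N)) / (tabs (s (Suc N)) * tabs (t (Suc N)) * (cf_size s N)\<^sup>2)"
proof -
  interpret S: cfrac s by (rule s)
  interpret T: cfrac t by (rule t)
  define D where "D = laurent_abs (S.quot (Suc N) - T.quot (Suc N))"
  have inv1: "laurent_abs (1 / S.quot k) < 1" "laurent_abs (1 / T.quot k) < 1" if "0 < k" for k
    using that tabs_gt_1[OF S.deg_pos, of k] tabs_gt_1[OF T.deg_pos, of k]
    by (simp_all add: laurent_abs_divide S.laurent_abs_quot T.laurent_abs_quot one_divide_less_1)
  have "S.quot (Suc N) - T.quot (Suc N) = of_Tpoly (s (Suc N) - t (Suc N)) +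
      (1 / S.quot (Suc (Suc N)) - 1 / T.quot (Suc (Suc N)))"
    using S.quot_rec[of "Suc N"] T.quot_rec[of "Suc N"] by (simp add: of_Tpoly_diff)
  moreover have "laurent_abs (1 / S.quot (Suc (Suc N)) - 1 / T.quot (Suc (Suc N))) < tabs (s (Suc N) - t (Suc N))"
  proof -
    have "laurent_abs (1 / S.quot (Suc (Suc N)) - 1 / T.quot (Suc (Suc N))) < 1"
      using laurent_abs_add_le[of "1 / S.quot (Suc (Suc N))" "- (1 / T.quot (Suc (Suc N)))"]
        inv1[of "Suc (Suc N)"] by auto
    also have "1 \<le> tabs (s (Suc N) - t (Suc N))" using ne by (intro tabs_ge_1) simp
    finally show ?thesis .
  qed
  ultimately have D: "D = tabs (s (Suc N) - t (Suc N))"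
    unfolding D_def by (simp add: laurent_abs_add_eq)
  have step: "laurent_abs (S.quot k - T.quot k) =
      laurent_abs (S.quot (Suc k) - T.quot (Suc k)) / (tabs (s (Suc k)) * tabs (t (Suc k)))" if "k \<le> N" for k
  proof -
    have "S.quot k - T.quot k = 1 / S.quot (Suc k) - 1 / T.quot (Suc k)"
      using S.quot_rec[of k] T.quot_rec[of k] eq[OF that] by simp
    thus ?thesis
      using laurent_abs_inverse_diff[of "S.quot (Suc k)" "T.quot (Suc k)"] S.quot_nonzero T.quot_nonzero
      by (simp add: S.laurent_abs_quot T.laurent_abs_quot)
  qed
  have "laurent_abs (S.quot 0 - T.quot 0) = laurent_abs (S.quot k - T.quot k) / (cf_size s k)\<^sup>2" if "k \<le> N" for k
    using that
  proof (induction k)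
    case (Suc k)
    thus ?case using step[of k] eq[of "Suc k"] by (simp add: cf_size_Suc power2_eq_square mult_ac)
  qed simp
  from this[of N] step[of N] D show ?thesis
    by (simp add: D_def S.cf_value_eq_quot T.cf_value_eq_quot mult_ac)
qed

subsection \<open>Eventually periodic continued fractions\<close>

lemma eval_laurent_diff: "eval_laurent (P - Q) x = eval_laurent P x - eval_laurent Q x"
  using eval_laurent_add[of "P - Q" Q x] by (simp add: eq_diff_eq)

lemma poly_height_diff_le: "poly_height (P - Q) \<le> max (poly_height P) (poly_height Q)"
  unfolding poly_height_le_iff
proof
  fix i
  have "tabs (Polynomial.coeff P i) \<le> max (poly_height P) (poly_height Q)"
    "tabs (Polynomial.coeff Q i) \<le> max (poly_height P) (poly_height Q)"
    using coeff_le_poly_height[of P i] coeff_le_poly_height[of Q i] by linarith+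
  thus "tabs (Polynomial.coeff (P - Q) i) \<le> max (poly_height P) (poly_height Q)"
    by (simp add: of_Tpoly_diff laurent_abs_diff_bound del: max.bounded_iff)
qed

text \<open>If the complete quotients at \<open>Suc n\<close> and \<open>Suc (n + E)\<close> agree,
  both equal minus a ratio of consecutive linear forms; cross-multiplying eliminates the quotient
  and leaves this quadratic polynomial.\<close>

definition cf_quad :: "(nat \<Rightarrow> 'a::finite_field poly) \<Rightarrow> nat \<Rightarrow> nat \<Rightarrow> 'a poly poly" where
  "cf_quad s n E = cf_lin s n * cf_lin s (Suc (n + E)) - cf_lin s (n + E) * cf_lin s (Suc n)"

lemma cf_lin_Suc_Suc: "cf_lin s (Suc (Suc k)) = smult (s (Suc k)) (cf_lin s (Suc k)) + cf_lin s k"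
  by (simp add: cf_lin_def algebra_simps)

lemma cf_quad_shift:
  assumes "s (Suc (n + E)) = s (Suc n)"
  shows "cf_quad s (Suc n) E = - cf_quad s n E"
  using assms by (simp add: cf_quad_def cf_lin_Suc_Suc algebra_simps)

text \<open>The starting point inside the periodic part matters only for the sign, so the content
  can be computed at the start where the period is easiest to read.\<close>

lemma cf_quad_shift_power:
  assumes "\<And>k. n < k \<Longrightarrow> s (k + E) = s k"
  shows "cf_quad s (n + j) E = smult ((- 1) ^ j) (cf_quad s n E)"
proof (induction j)
  case (Suc j)
  have "cf_quad s (Suc (n + j)) E = - cf_quad s (n + j) E"
    using assms[of "Suc (n + j)"] by (intro cf_quad_shift) simp
  thus ?case using Suc.IH by simp
qed simp

text \<open>The coefficients are those of a binary quadratic form in \<open>x\<close> and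
  \<open>y\<close>, so a common divisor of them divides all values of the form, in particular at
  specially chosen points.\<close>

lemma quad_form_dvd:
  fixes A B C D x y :: "'a::comm_ring_1"
  assumes "\<And>i. g dvd Polynomial.coeff ([:-B, A:] * [:-B', A':] - [:-D, C:] * [:-D', C':]) i"
  shows "g dvd (A * x - B * y) * (A' * x - B' * y) - (C * x - D * y) * (C' * x - D' * y)"
proof -
  have "g dvd B * B' - D * D'" using assms[of 0] by (simp add: coeff_pCons mult.commute)
  moreover have "g dvd - A * B' - B * A' - (- C * D' - D * C')"
    using assms[of 1] by (simp add: coeff_pCons algebra_simps)
  moreover have "g dvd A * A' - C * C'" using assms[of 2] by (simp add: coeff_pCons numeral_2_eq_2 mult.commute)
  ultimately have "g dvd (A * A' - C * C') * x\<^sup>2 + (- A * B' - B * A' - (- C * D' - D * C')) * (x * y) + (B * B' - D * D') * y\<^sup>2"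
    by (intro dvd_add dvd_mult2)
  also have "\<dots> = (A * x - B * y) * (A' * x - B' * y) - (C * x - D * y) * (C' * x - D' * y)"
    by (simp add: power2_eq_square algebra_simps)
  finally show ?thesis .
qed

text \<open>Consecutive continuants of the constant word \<open>a a \<dots> a\<close> are coprime, and the content of the
  quadratic form attached to the period \<open>a \<dots> a c\<close> divides \<open>(c - a)\<close> times one of them.\<close>
lemma content_cf_quad:
  fixes s :: "nat \<Rightarrow> 'a::finite_field poly"
  assumes E: "2 \<le> E" and sa: "\<And>j. 0 < j \<Longrightarrow> j < E \<Longrightarrow> s (m + j) = a" and sc: "s (m + E) = c"
    and g: "\<And>i. g dvd Polynomial.coeff (cf_quad s m E) i"
  shows "g dvd c - a"
proof -
  define F where "F = (\<lambda>x y k. cf_den s k * x - cf_num s k * y)"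
  \<comment> \<open>At the points given by two consecutive convergents, \<open>cf_det\<close> leaves
    a single continuant of the form: up to sign it is \<open>G E\<close> at the first point and
    \<open>K (Suc E)\<close> at the second.\<close>
  define G where "G = (\<lambda>j. F (cf_num s m) (cf_den s m) (m + j))"
  define K where "K = (\<lambda>j. F (cf_num s (Suc m)) (cf_den s (Suc m)) (m + j))"
  have rec: "F x y (Suc (Suc k)) = s (Suc k) * F x y (Suc k) + F x y k" for x y k
    by (simp add: F_def algebra_simps)
  have Grec: "G (Suc (Suc j)) = s (m + Suc j) * G (Suc j) + G j" for j
    using rec[of _ _ "m + j"] by (simp add: G_def)
  have Krec: "K (Suc (Suc j)) = s (m + Suc j) * K (Suc j) + K j" for j
    using rec[of _ _ "m + j"] by (simp add: K_def)
  have dvd: "g dvd F x y m * F x y (Suc (m + E)) - F x y (m + E) * F x y (Suc m)" for x y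
    using quad_form_dvd[OF g[unfolded cf_quad_def cf_lin_def], of x y] by (simp add: F_def)
  have init: "G 0 = 0" "G 1 = - ((- 1) ^ Suc m)" "K 0 = (- 1) ^ Suc m" "K 1 = 0"
    using cf_det[of s m] by (simp_all add: G_def K_def F_def algebra_simps)
  \<comment> \<open>Before position \<open>E\<close> the word is constant, so a shift by one does
    not change the recursion; only the last letter \<open>c\<close> distinguishes
    \<open>K (Suc E)\<close> from \<open>- G E\<close>.\<close>
  have Kshift: "j < E \<Longrightarrow> K (Suc j) = - G j" for j
  proof (induction j rule: induct_nat_012)
    case (ge2 j)
    thus ?case using Grec[of j] Krec[of "Suc j"] sa[of "Suc j"] sa[of "Suc (Suc j)"] by simp
  qed (use init E Krec[of 0] in auto)
  have "g dvd - G E * (- ((- 1) ^ Suc m))"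
    using dvd[of "cf_num s m" "cf_den s m"] init by (simp add: G_def)
  hence GE: "g dvd G E"
    by (cases "even m") auto
  have "g dvd (- 1) ^ Suc m * K (Suc E)"
    using dvd[of "cf_num s (Suc m)" "cf_den s (Suc m)"] init by (simp add: K_def)
  hence KE: "g dvd K (Suc E)"
    by (cases "even m") auto
  obtain e where e: "E = Suc (Suc e)" using E by (metis add_2_eq_Suc le_Suc_ex)
  have "K (Suc E) = c * K (Suc (Suc e)) + K (Suc e)" using Krec[of "Suc e"] e sc by simp
  also have "\<dots> = - (c * G (Suc e) + G e)" using Kshift[of "Suc e"] Kshift[of e] e by simp
  finally have K: "K (Suc E) = - (c * G (Suc e) + G e)" .
  have GE': "G E = a * G (Suc e) + G e" using Grec[of e] e sa[of "Suc e"] by simp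
  have "g dvd - K (Suc E) - G E" using GE KE by (intro dvd_diff) auto
  also have "- K (Suc E) - G E = (c - a) * G (Suc e)" unfolding K GE' by (simp add: algebra_simps)
  finally have 1: "g dvd (c - a) * G (Suc e)" .
  have 2: "g dvd (c - a) * G (Suc (Suc e))" using GE e by simp
  \<comment> \<open>The Euclidean algorithm run downwards: two consecutive multiples divisible by
    \<open>g\<close> give the preceding one, until \<open>G 1\<close>, which is 1 or - 1.\<close>
  have "j < E \<Longrightarrow> g dvd (c - a) * G j \<Longrightarrow> g dvd (c - a) * G (Suc j) \<Longrightarrow> g dvd (c - a) * G 1" for j
  proof (induction j)
    case (Suc j)
    have "(c - a) * G j = (c - a) * G (Suc (Suc j)) - a * ((c - a) * G (Suc j))"
      using Grec[of j] sa[of "Suc j"] Suc.prems by (simp add: algebra_simps)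
    hence "g dvd (c - a) * G j" using Suc.prems by (metis dvd_diff dvd_mult)
    thus ?case using Suc by simp
  qed simp
  from this[of "Suc e"] have "g dvd (c - a) * G 1" using 1 2 e by simp
  hence "g dvd (c - a) * (- 1) ^ Suc m" unfolding init by (simp only: mult_minus_right dvd_minus_iff)
  thus ?thesis using dvd_mult2[of g "(c - a) * (- 1) ^ Suc m" "(- 1) ^ Suc m"]
    by (simp add: mult.assoc flip: power_mult_distrib)
qed

lemma quad_expand:
  fixes z :: "'a::comm_ring_1"
  shows "(p + A * z) * (q + B * z) - (r + C * z) * (t + D * z) =
    p * q - r * t + z * (A * q + B * p - C * t - D * r + (A * B - C * D) * z)"
  by (simp add: algebra_simps)

text \<open>By \<open>preperiod\<close>, \<open>n\<close> is the last index outside the period. The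
  difference of these two letters is the leading factor of \<open>lc\<close>, so that
  \<open>lc\<close> has full size; this later keeps the conjugate root bounded.\<close>

locale periodic_cfrac = cfrac s for s :: "nat \<Rightarrow> 'a::finite_field poly" +
  fixes n E :: nat
  assumes n_pos: "0 < n" and E_pos: "0 < E"
    and periodic: "n < k \<Longrightarrow> s (k + E) = s k" and preperiod: "s (n + E) \<noteq> s n"
begin

definition lc :: "'a poly" where
  "lc = cf_den s n * cf_den s (Suc (n + E)) - cf_den s (n + E) * cf_den s (Suc n)"

lemma coeff_2_cf_quad: "Polynomial.coeff (cf_quad s n E) 2 = lc"
  by (simp add: cf_quad_def cf_lin_def coeff_pCons numeral_2_eq_2 lc_def)

lemma degree_cf_quad_le: "Polynomial.degree (cf_quad s n E) \<le> 2"
proof -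
  have "Polynomial.degree (cf_lin s k) \<le> 1" for k by (simp add: cf_lin_def)
  hence "Polynomial.degree (cf_lin s k * cf_lin s j) \<le> 2" for j k
    by (metis degree_mult_le add_mono one_add_one order_trans)
  thus ?thesis unfolding cf_quad_def by (intro degree_diff_le)
qed

text \<open>One step of the recursion in the two later denominators isolates the difference of the
  letters at \<open>n + E\<close> and \<open>n\<close>. The remaining terms are strictly smaller,
  since the difference is nonzero.\<close>

lemma tabs_lc: "tabs lc = tabs (s (n + E) - s n) * (cf_size s (n - 1) * cf_size s (n + E - 1))"
proof -
  obtain k where k: "n = Suc k" using n_pos by (cases n) auto
  obtain j where j: "n + E = Suc j" using n_pos by (cases "n + E") auto
  have kj: "k < j" using k j E_pos by simp
  have "lc = (s (n + E) - s n) * cf_den s n * cf_den s (n + E) +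
     (cf_den s n * cf_den s j - cf_den s (n + E) * cf_den s k)"
    unfolding lc_def using j by (simp add: k algebra_simps)
  moreover have "tabs (cf_den s n) = cf_size s k" "tabs (cf_den s (n + E)) = cf_size s j"
    using tabs_cf_den[of k] tabs_cf_den[of j] k j by simp_all
  moreover have less: "tabs (cf_den s i) < cf_size s i" for i
    using tabs_cf_den[of "i - 1"] cf_size_strict_mono[of "i - 1" i] by (cases i) auto
  have "tabs (cf_den s n * cf_den s j) < cf_size s k * cf_size s j"
    using calculation(2) less[of j] by (simp add: tabs_mult)
  moreover have "tabs (cf_den s (n + E) * cf_den s k) < cf_size s k * cf_size s j"
    using calculation(3) less[of k] by (simp add: tabs_mult)
  ultimately have "tabs (cf_den s n * cf_den s j - cf_den s (n + E) * cf_den s k) < cf_size s k * cf_size s j"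
    using laurent_abs_add_le[of "of_Tpoly (cf_den s n * cf_den s j)" "- of_Tpoly (cf_den s (n + E) * cf_den s k)"]
    by (simp add: of_Tpoly_diff)
  also have "1 \<le> tabs (s (n + E) - s n)" using preperiod by (intro tabs_ge_1) simp
  hence "cf_size s k * cf_size s j \<le> tabs (s (n + E) - s n) * (cf_size s k * cf_size s j)"
    using cf_size_pos[of k] cf_size_pos[of j] mult_right_mono[of 1 "tabs (s (n + E) - s n)" "cf_size s k * cf_size s j"]
    by (simp add: less_imp_le)
  also have "\<dots> = tabs ((s (n + E) - s n) * cf_den s n * cf_den s (n + E))"
    by (simp add: tabs_mult \<open>tabs (cf_den s n) = _\<close> \<open>tabs (cf_den s (n + E)) = _\<close>)
  finally have "tabs lc = tabs ((s (n + E) - s n) * cf_den s n * cf_den s (n + E))"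
    using \<open>lc = _\<close> by (simp add: of_Tpoly_add laurent_abs_add_eq)
  thus ?thesis using k j \<open>tabs (cf_den s n) = _\<close> \<open>tabs (cf_den s (n + E)) = _\<close>
    by (simp add: tabs_mult)
qed

lemma lc_nonzero: "lc \<noteq> 0"
proof -
  have "0 < tabs lc" unfolding tabs_lc using preperiod by (intro mult_pos_pos) auto
  thus ?thesis by simp
qed

lemma degree_cf_quad: "Polynomial.degree (cf_quad s n E) = 2"
  using degree_cf_quad_le coeff_2_cf_quad lc_nonzero le_degree[of "cf_quad s n E" 2] by simp

lemma quot_periodic: "quot (Suc (n + E)) = quot (Suc n)"
proof -
  have "s (i + Suc (n + E)) = s (i + Suc n)" for i
    using periodic[of "i + Suc n"] by (simp add: algebra_simps)
  thus ?thesis by (simp add: quot_def)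
qed

lemma eval_cf_quad_root: "eval_laurent (cf_quad s n E) (cf_value s) = 0"
proof -
  define x where "x = cf_value s"
  have f: "cf_form s k x = - (cf_form s (Suc k) x * quot (Suc k))" for k
    using cf_form_quot[of k] by (simp add: x_def eq_neg_iff_add_eq_0 add.commute)
  have "eval_laurent (cf_quad s n E) x =
    cf_form s n x * cf_form s (Suc (n + E)) x - cf_form s (n + E) x * cf_form s (Suc n) x"
    by (simp add: cf_quad_def eval_laurent_diff eval_laurent_mult eval_cf_lin)
  also have "\<dots> = 0" using f[of n] f[of "n + E"] quot_periodic by simp
  finally show ?thesis by (simp add: x_def)
qed

text \<open>The derivative of the quadratic polynomial at its root \<open>cf_value s\<close>.\<close>
definition slope :: "'a fls" where
  "slope = of_Tpoly (cf_den s n) * cf_form s (Suc (n + E)) (cf_value s)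
     + of_Tpoly (cf_den s (Suc (n + E))) * cf_form s n (cf_value s)
     - of_Tpoly (cf_den s (n + E)) * cf_form s (Suc n) (cf_value s)
     - of_Tpoly (cf_den s (Suc n)) * cf_form s (n + E) (cf_value s)"

lemma eval_cf_quad:
  "eval_laurent (cf_quad s n E) x = (x - cf_value s) * (slope + of_Tpoly lc * (x - cf_value s))"
proof -
  define y where "y = cf_value s"
  have f: "cf_form s k x = cf_form s k y + of_Tpoly (cf_den s k) * (x - y)" for k
    by (simp add: cf_form_def algebra_simps)
  have ev: "eval_laurent (cf_quad s n E) z =
    cf_form s n z * cf_form s (Suc (n + E)) z - cf_form s (n + E) z * cf_form s (Suc n) z" for z
    by (simp add: cf_quad_def eval_laurent_diff eval_laurent_mult eval_cf_lin)
  have "eval_laurent (cf_quad s n E) x = eval_laurent (cf_quad s n E) y + (x - y) * (slope + of_Tpoly lc * (x - y))"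
    unfolding ev slope_def lc_def y_def[symmetric] f[of n] f[of "n + E"] f[of "Suc n"] f[of "Suc (n + E)"]
    unfolding of_Tpoly_diff of_Tpoly_mult by (rule quad_expand)
  thus ?thesis using eval_cf_quad_root by (simp add: y_def)
qed

text \<open>Of the four summands only the largest denominator times the earliest form reaches this
  size; the others are strictly smaller, so nothing cancels.\<close>

lemma laurent_abs_slope: "laurent_abs slope = cf_size s (n + E) / cf_size s n"
proof -
  define y where "y = cf_value s"
  define M where "M = cf_size s (n + E) / cf_size s n"
  have den: "tabs (cf_den s (Suc k)) = cf_size s k" for k by (rule tabs_cf_den)
  obtain k where k: "n = Suc k" using n_pos by (cases n) auto
  obtain j where j: "n + E = Suc j" using n_pos by (cases "n + E") auto
  have lt: "cf_size s n < cf_size s (n + E)" using E_pos by (intro cf_size_strict_mono) simp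
  have M1: "1 < M" using lt by (simp add: M_def)
  have t1: "laurent_abs (of_Tpoly (cf_den s n) * cf_form s (Suc (n + E)) y) < M"
  proof -
    have "laurent_abs (of_Tpoly (cf_den s n) * cf_form s (Suc (n + E)) y) = cf_size s k / cf_size s (Suc (n + E))"
      using den[of k] k by (simp add: laurent_abs_mult y_def laurent_abs_cf_form)
    also have "\<dots> < 1" using cf_size_strict_mono[of k "Suc (n + E)"] k by simp
    finally show ?thesis using M1 by linarith
  qed
  have t2: "laurent_abs (of_Tpoly (cf_den s (Suc (n + E))) * cf_form s n y) = M"
    by (simp add: laurent_abs_mult y_def laurent_abs_cf_form den M_def)
  have t3: "laurent_abs (of_Tpoly (cf_den s (n + E)) * cf_form s (Suc n) y) < M"
  proof -
    have "laurent_abs (of_Tpoly (cf_den s (n + E)) * cf_form s (Suc n) y) = cf_size s j / cf_size s (Suc n)"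
      using den[of j] j by (simp add: laurent_abs_mult y_def laurent_abs_cf_form)
    also have "\<dots> < cf_size s (n + E) / cf_size s n"
      using cf_size_strict_mono[of j "n + E"] cf_size_strict_mono[of n "Suc n"] j
      by (intro frac_less) (auto intro: less_imp_le)
    finally show ?thesis by (simp add: M_def)
  qed
  have t4: "laurent_abs (of_Tpoly (cf_den s (Suc n)) * cf_form s (n + E) y) < M"
  proof -
    have "laurent_abs (of_Tpoly (cf_den s (Suc n)) * cf_form s (n + E) y) = cf_size s n / cf_size s (n + E)"
      using den[of n] by (simp add: laurent_abs_mult y_def laurent_abs_cf_form)
    also have "\<dots> < 1" using lt by simp
    finally show ?thesis using M1 by linarith
  qed
  have "laurent_abs (of_Tpoly (cf_den s (Suc (n + E))) * cf_form s n y
     + of_Tpoly (cf_den s n) * cf_form s (Suc (n + E)) y) = M"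
    using t1 t2 laurent_abs_add_eq by metis
  hence "laurent_abs (of_Tpoly (cf_den s (Suc (n + E))) * cf_form s n y
     + of_Tpoly (cf_den s n) * cf_form s (Suc (n + E)) y
     - of_Tpoly (cf_den s (n + E)) * cf_form s (Suc n) y) = M"
    using t3 laurent_abs_diff_eq by metis
  hence "laurent_abs (of_Tpoly (cf_den s (Suc (n + E))) * cf_form s n y
     + of_Tpoly (cf_den s n) * cf_form s (Suc (n + E)) y
     - of_Tpoly (cf_den s (n + E)) * cf_form s (Suc n) y
     - of_Tpoly (cf_den s (Suc n)) * cf_form s (n + E) y) = M"
    using t4 laurent_abs_diff_eq by metis
  thus ?thesis unfolding slope_def y_def M_def by (simp add: add.commute)
qed

lemma poly_height_cf_lin: "0 < k \<Longrightarrow> poly_height (cf_lin s k) \<le> cf_size s (k - 1)"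
  unfolding poly_height_le_iff cf_lin_def
  using tabs_cf_num_le[of k] tabs_cf_den[of "k - 1"]
  by (auto simp: coeff_pCons of_Tpoly_minus less_imp_le split: nat.splits)

lemma poly_height_cf_quad: "poly_height (cf_quad s n E) \<le> cf_size s n * cf_size s (n + E)"
proof -
  have le: "poly_height (cf_lin s i * cf_lin s j) \<le> cf_size s n * cf_size s (n + E)"
    if "0 < i" "0 < j" "i - 1 \<le> n" "j - 1 \<le> n + E" for i j
    unfolding poly_height_mult using that
    by (intro mult_mono order_trans[OF poly_height_cf_lin] cf_size_mono) (auto intro: less_imp_le)
  have "poly_height (cf_lin s n * cf_lin s (Suc (n + E))) \<le> cf_size s n * cf_size s (n + E)"
    using n_pos by (intro le) auto
  moreover have "poly_height (cf_lin s (Suc n) * cf_lin s (n + E)) \<le> cf_size s n * cf_size s (n + E)"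
    using n_pos by (intro le) auto
  ultimately show ?thesis
    using poly_height_diff_le[of "cf_lin s n * cf_lin s (Suc (n + E))" "cf_lin s (n + E) * cf_lin s (Suc n)"]
    by (simp add: cf_quad_def mult.commute)
qed

end

subsection \<open>A Liouville inequality for quadratic Laurent series\<close>

text \<open>Horner's scheme modulo the quadratic: replacing c2 x^2 by - (c1 x + c0) costs one factor
  \<open>c2\<close> on the left and one factor \<open>H\<close> in the coefficients per
  step.\<close>

lemma quadratic_reduction:
  fixes P :: "'a::finite_field poly poly"
  assumes "Polynomial.degree P \<le> Suc m"
    and H: "tabs c0 \<le> H" "tabs c1 \<le> H" "tabs c2 \<le> H"
  shows "\<exists>r e. tabs r \<le> H ^ m * poly_height P \<and> tabs e \<le> H ^ m * poly_height P \<and>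
    (\<forall>x. of_Tpoly c2 * x\<^sup>2 + of_Tpoly c1 * x + of_Tpoly c0 = 0 \<longrightarrow>
      of_Tpoly c2 ^ m * eval_laurent P x = of_Tpoly r * x + of_Tpoly e)"
  using assms(1)
proof (induction m arbitrary: P)
  case 0
  have "P = [:Polynomial.coeff P 0, Polynomial.coeff P 1:]"
    using 0 by (intro poly_eqI) (auto simp: coeff_pCons coeff_eq_0 split: nat.splits)
  hence "eval_laurent P x = of_Tpoly (Polynomial.coeff P 1) * x + of_Tpoly (Polynomial.coeff P 0)" for x
    by (metis (no_types, lifting) eval_laurent_pCons eval_laurent_0 add.commute add.right_neutral mult.commute mult_zero_right)
  thus ?case
    by (intro exI[of _ "Polynomial.coeff P 1"] exI[of _ "Polynomial.coeff P 0"])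
       (auto simp: coeff_le_poly_height)
next
  case (Suc m)
  obtain c P' where P: "P = pCons c P'" by (cases P)
  have H0: "0 \<le> H" using H(1) laurent_abs_nonneg order_trans by blast
  have "Polynomial.degree P' \<le> Suc m" using Suc.prems P by (auto split: if_splits)
  from Suc.IH[OF this] obtain r e where re:
    "tabs r \<le> H ^ m * poly_height P'" "tabs e \<le> H ^ m * poly_height P'"
    "\<And>x. of_Tpoly c2 * x\<^sup>2 + of_Tpoly c1 * x + of_Tpoly c0 = 0 \<Longrightarrow>
      of_Tpoly c2 ^ m * eval_laurent P' x = of_Tpoly r * x + of_Tpoly e" by blast
  have le: "H ^ m * poly_height P' \<le> H ^ m * poly_height P"
    unfolding P using H0 by (intro mult_left_mono poly_height_coeff_pCons) auto
  hence re': "tabs r \<le> H ^ m * poly_height P" "tabs e \<le> H ^ m * poly_height P" using re by linarith+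
  have prod: "tabs (f * g) \<le> H ^ Suc m * poly_height P"
    if "tabs f \<le> H" "tabs g \<le> H ^ m * poly_height P" for f g
    using mult_mono[OF that] H0 by (simp add: tabs_mult mult_ac)
  have "tabs (c2 ^ Suc m) \<le> H ^ Suc m"
    unfolding of_Tpoly_power laurent_abs_power using H(3) by (intro power_mono) auto
  moreover have "tabs c \<le> poly_height P" using coeff_le_poly_height[of P 0] P by simp
  ultimately have c: "tabs (c2 ^ Suc m * c) \<le> H ^ Suc m * poly_height P"
    unfolding tabs_mult using H0 by (intro mult_mono) auto
  show ?case
  proof (rule exI[of _ "c2 * e - c1 * r"], rule exI[of _ "c2 ^ Suc m * c - c0 * r"], intro conjI allI impI)
    show "tabs (c2 * e - c1 * r) \<le> H ^ Suc m * poly_height P"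
      unfolding of_Tpoly_diff using prod H re' by (intro laurent_abs_diff_bound) auto
    show "tabs (c2 ^ Suc m * c - c0 * r) \<le> H ^ Suc m * poly_height P"
      unfolding of_Tpoly_diff using prod H re' c by (intro laurent_abs_diff_bound) auto
    fix x assume x: "of_Tpoly c2 * x\<^sup>2 + of_Tpoly c1 * x + of_Tpoly c0 = 0"
    have sq: "of_Tpoly c2 * x\<^sup>2 = - (of_Tpoly c1 * x + of_Tpoly c0)"
      unfolding eq_neg_iff_add_eq_0 using x by (simp only: add.assoc)
    have "of_Tpoly c2 ^ Suc m * eval_laurent P x =
        of_Tpoly c2 ^ Suc m * of_Tpoly c + of_Tpoly c2 * x * (of_Tpoly c2 ^ m * eval_laurent P' x)"
      by (simp add: P eval_laurent_pCons algebra_simps)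
    also have "\<dots> = of_Tpoly c2 ^ Suc m * of_Tpoly c + of_Tpoly c2 * x * (of_Tpoly r * x + of_Tpoly e)"
      by (simp only: re(3)[OF x])
    also have "\<dots> = of_Tpoly c2 ^ Suc m * of_Tpoly c + of_Tpoly r * (of_Tpoly c2 * x\<^sup>2) + of_Tpoly c2 * of_Tpoly e * x"
      by (simp add: power2_eq_square algebra_simps)
    also have "\<dots> = of_Tpoly (c2 * e - c1 * r) * x + of_Tpoly (c2 ^ Suc m * c - c0 * r)"
      unfolding sq by (simp add: of_Tpoly_diff of_Tpoly_mult of_Tpoly_power algebra_simps)
    finally show "of_Tpoly c2 ^ Suc m * eval_laurent P x =
        of_Tpoly (c2 * e - c1 * r) * x + of_Tpoly (c2 ^ Suc m * c - c0 * r)" .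
  qed
qed

lemma eval_quadratic:
  assumes "Polynomial.degree S = 2"
  shows "eval_laurent S x = of_Tpoly (Polynomial.coeff S 2) * x\<^sup>2 + of_Tpoly (Polynomial.coeff S 1) * x
    + of_Tpoly (Polynomial.coeff S 0)"
proof -
  have "S = [:Polynomial.coeff S 0, Polynomial.coeff S 1, Polynomial.coeff S 2:]"
    using assms by (intro poly_eqI) (auto simp: coeff_pCons coeff_eq_0 numeral_2_eq_2 split: nat.splits)
  hence "eval_laurent S x = eval_laurent [:Polynomial.coeff S 0, Polynomial.coeff S 1, Polynomial.coeff S 2:] x"
    by simp
  thus ?thesis by (simp add: eval_laurent_pCons power2_eq_square algebra_simps)
qed

text \<open>The norm of \<open>r \<alpha> + e\<close> is a nonzero polynomial, hence has absolute value at least \<open>1\<close>.\<close>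
lemma liouville_quadratic:
  fixes P S :: "'a::finite_field poly poly"
  assumes S: "Polynomial.degree S = 2" "eval_laurent S \<alpha> = 0"
    and irr: "\<And>r e. eval_laurent [:e, r:] \<alpha> = 0 \<Longrightarrow> r = 0 \<and> e = 0"
    and \<alpha>: "laurent_abs \<alpha> \<le> 1" and K: "1 \<le> K" "poly_height S \<le> K * tabs (Polynomial.coeff S 2)"
    and P: "0 < d" "Polynomial.degree P \<le> d" "eval_laurent P \<alpha> \<noteq> 0"
  shows "1 \<le> K * poly_height S ^ (2 * d) * poly_height P * laurent_abs (eval_laurent P \<alpha>)"
proof -
  obtain m where m: "d = Suc m" using P(1) by (cases d) auto
  define c0 c1 c2 where "c0 = Polynomial.coeff S 0" and "c1 = Polynomial.coeff S 1" and "c2 = Polynomial.coeff S 2"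
  define H where "H = poly_height S"
  have Hc: "tabs c0 \<le> H" "tabs c1 \<le> H" "tabs c2 \<le> H"
    unfolding c0_def c1_def c2_def H_def by (rule coeff_le_poly_height)+
  have c2: "c2 \<noteq> 0" unfolding c2_def using S(1) by (metis leading_coeff_0_iff degree_0 zero_neq_numeral)
  have "S \<noteq> 0" using S(1) by auto
  hence H1: "1 \<le> H" unfolding H_def by (rule poly_height_ge_1)
  obtain r e where re: "tabs r \<le> H ^ m * poly_height P" "tabs e \<le> H ^ m * poly_height P"
    "\<And>x. of_Tpoly c2 * x\<^sup>2 + of_Tpoly c1 * x + of_Tpoly c0 = 0 \<Longrightarrow>
      of_Tpoly c2 ^ m * eval_laurent P x = of_Tpoly r * x + of_Tpoly e"
    using quadratic_reduction[of P m c0 H c1 c2] P(2) m Hc by blast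
  \<comment> \<open>The conjugate root, defined through the sum of the roots. It lies in the same
    field as \<alpha>, so the norm can be estimated among Laurent series.\<close>
  define \<beta> where "\<beta> = - (of_Tpoly c1 / of_Tpoly c2) - \<alpha>"
  have root: "of_Tpoly c2 * \<alpha>\<^sup>2 + of_Tpoly c1 * \<alpha> + of_Tpoly c0 = 0"
    using S eval_quadratic[OF S(1)] by (simp add: c0_def c1_def c2_def)
  have sum: "of_Tpoly c2 * (\<alpha> + \<beta>) = - of_Tpoly c1" using c2 by (simp add: \<beta>_def)
  hence cb: "of_Tpoly c2 * \<beta> = - of_Tpoly c1 - of_Tpoly c2 * \<alpha>" by (simp add: algebra_simps)
  have prod: "of_Tpoly c2 * (\<alpha> * \<beta>) = of_Tpoly c0"
  proof -
    have "of_Tpoly c2 * (\<alpha> * \<beta>) = \<alpha> * (of_Tpoly c2 * \<beta>)" by simp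
    also have "\<dots> = - (of_Tpoly c2 * \<alpha>\<^sup>2 + of_Tpoly c1 * \<alpha>)"
      unfolding cb by (simp add: power2_eq_square algebra_simps)
    also have "\<dots> = of_Tpoly c0" using root by (rule minus_unique)
    finally show ?thesis .
  qed
  define u where "u = of_Tpoly r * \<alpha> + of_Tpoly e"
  define z where "z = of_Tpoly r * \<beta> + of_Tpoly e"
  have u: "u = of_Tpoly c2 ^ m * eval_laurent P \<alpha>" unfolding u_def by (rule re(3)[OF root, symmetric])
  have u0: "u \<noteq> 0" using u c2 P(3) by simp
  have z0: "z \<noteq> 0"
  proof
    assume "z = 0"
    hence "of_Tpoly c2 * z = 0" by simp
    hence "of_Tpoly r * (of_Tpoly c2 * \<beta>) + of_Tpoly c2 * of_Tpoly e = 0"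
      by (simp add: z_def algebra_simps)
    hence "eval_laurent [:c2 * e - r * c1, - (r * c2):] \<alpha> = 0"
      unfolding cb by (simp add: eval_laurent_pCons of_Tpoly_diff of_Tpoly_minus of_Tpoly_mult algebra_simps)
    hence "- (r * c2) = 0" "c2 * e - r * c1 = 0" using irr by blast+
    hence "r = 0" "e = 0" using c2 by auto
    thus False using u0 by (simp add: u_def)
  qed
  have "of_Tpoly c2 * (u * z) = of_Tpoly r ^ 2 * (of_Tpoly c2 * (\<alpha> * \<beta>))
      + of_Tpoly r * of_Tpoly e * (of_Tpoly c2 * (\<alpha> + \<beta>)) + of_Tpoly c2 * of_Tpoly e ^ 2"
    by (simp add: u_def z_def power2_eq_square algebra_simps)
  also have "\<dots> = of_Tpoly (r\<^sup>2 * c0 - r * e * c1 + c2 * e\<^sup>2)"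
    unfolding sum prod by (simp add: of_Tpoly_diff of_Tpoly_add of_Tpoly_mult of_Tpoly_power)
  finally have N: "of_Tpoly c2 * (u * z) = of_Tpoly (r\<^sup>2 * c0 - r * e * c1 + c2 * e\<^sup>2)" .
  hence "r\<^sup>2 * c0 - r * e * c1 + c2 * e\<^sup>2 \<noteq> 0" using u0 z0 c2 by (metis mult_eq_0_iff of_Tpoly_eq_0_iff)
  hence "1 \<le> laurent_abs (of_Tpoly c2 * (u * z))" unfolding N by (rule tabs_ge_1)
  hence 1: "1 \<le> tabs c2 * laurent_abs u * laurent_abs z" by (simp add: laurent_abs_mult mult_ac)
  \<comment> \<open>Here the large leading coefficient enters: it bounds the conjugate \<beta>, and
    with it the conjugate factor \<open>z\<close> of the norm.\<close>
  have "tabs c1 / tabs c2 \<le> K"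
    using Hc(2) K(2) c2 by (simp add: divide_le_eq H_def c2_def)
  hence b: "laurent_abs \<beta> \<le> K"
    unfolding \<beta>_def using \<alpha> K(1) by (intro laurent_abs_diff_bound) (simp_all add: laurent_abs_divide)
  have "laurent_abs z \<le> K * (H ^ m * poly_height P)"
    unfolding z_def
  proof (rule laurent_abs_add_bound)
    show "laurent_abs (of_Tpoly r * \<beta>) \<le> K * (H ^ m * poly_height P)"
      unfolding laurent_abs_mult using mult_mono[OF b re(1)] K(1) by (simp add: mult.commute)
    have "1 * tabs e \<le> K * (H ^ m * poly_height P)"
      using K(1) re(2) by (intro mult_mono) auto
    thus "tabs e \<le> K * (H ^ m * poly_height P)" by simp
  qed
  moreover have "tabs c2 * laurent_abs u \<le> H ^ Suc m * laurent_abs (eval_laurent P \<alpha>)"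
  proof -
    have "tabs c2 ^ Suc m \<le> H ^ Suc m" using Hc(3) by (intro power_mono) auto
    hence "tabs c2 ^ Suc m * laurent_abs (eval_laurent P \<alpha>) \<le> H ^ Suc m * laurent_abs (eval_laurent P \<alpha>)"
      by (intro mult_right_mono) auto
    thus ?thesis by (simp add: u laurent_abs_mult laurent_abs_power mult.assoc)
  qed
  ultimately have "tabs c2 * laurent_abs u * laurent_abs z
      \<le> (H ^ Suc m * laurent_abs (eval_laurent P \<alpha>)) * (K * (H ^ m * poly_height P))"
    using H1 by (intro mult_mono[of "tabs c2 * laurent_abs u"]) auto
  also have "\<dots> = H ^ (Suc m + m) * (K * poly_height P * laurent_abs (eval_laurent P \<alpha>))"
    by (simp add: power_add mult_ac)
  also have "\<dots> \<le> H ^ (2 * d) * (K * poly_height P * laurent_abs (eval_laurent P \<alpha>))"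
    using H1 K(1) m by (intro mult_right_mono power_increasing mult_nonneg_nonneg) auto
  finally show ?thesis using 1 by (simp add: H_def mult_ac)
qed

section \<open>Polynomials under the extended absolute value\<close>

lemma extends_laurent_absD:
  assumes "extends_laurent_abs v"
  shows "0 \<le> v x" "v x = 0 \<longleftrightarrow> x = 0" "v (x * y) = v x * v y" "v (x + y) \<le> v x + v y"
    "v (to_ac \<xi>) = laurent_abs \<xi>"
  using assms by (auto simp: extends_laurent_abs_def)

text \<open>For \<open>v\<close> the triangle inequality takes the place of the ultrametric one, so
  the constant grows with the degree. It depends on \<open>d\<close> and \<open>R\<close> alone,
  which is enough for the exponents.\<close>

lemma eval_ac_bound:
  assumes v: "extends_laurent_abs v" and R: "0 \<le> R"
  shows "\<exists>C\<ge>0. \<forall>P x. Polynomial.degree P \<le> d \<longrightarrow> v x \<le> R \<longrightarrow> v (eval_ac P x) \<le> C * poly_height P"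
proof (induction d)
  case 0
  have "v (eval_ac P x) \<le> 1 * poly_height P" if "Polynomial.degree P = 0" for P x
    using that by (auto simp: eval_ac_pCons extends_laurent_absD[OF v] elim!: degree_eq_zeroE)
  thus ?case by (intro exI[of _ 1]) auto
next
  case (Suc d)
  then obtain C where C: "0 \<le> C"
    "\<And>P x. Polynomial.degree P \<le> d \<Longrightarrow> v x \<le> R \<Longrightarrow> v (eval_ac P x) \<le> C * poly_height P" by blast
  have "v (eval_ac P x) \<le> (1 + R * C) * poly_height P" if P: "Polynomial.degree P \<le> Suc d" and x: "v x \<le> R" for P x
  proof -
    obtain c P' where P': "P = pCons c P'" by (cases P)
    have "Polynomial.degree P' \<le> d" using P P' by (auto split: if_splits)
    hence "v (eval_ac P' x) \<le> C * poly_height P'" using C x by blast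
    also have "\<dots> \<le> C * poly_height P" unfolding P' using C by (intro mult_left_mono poly_height_coeff_pCons) auto
    finally have "v x * v (eval_ac P' x) \<le> R * (C * poly_height P)"
      using x R extends_laurent_absD[OF v] by (intro mult_mono) auto
    moreover have "v (to_ac (of_Tpoly c)) \<le> poly_height P"
      using coeff_le_poly_height[of P 0] by (simp add: P' extends_laurent_absD[OF v])
    moreover have "v (eval_ac P x) \<le> v (to_ac (of_Tpoly c)) + v x * v (eval_ac P' x)"
      unfolding P' eval_ac_pCons using extends_laurent_absD(3,4)[OF v] by metis
    ultimately show ?thesis by (simp add: algebra_simps)
  qed
  thus ?case using C R by (intro exI[of _ "1 + R * C"]) auto
qed

lemma eval_ac_diff_bound:
  assumes v: "extends_laurent_abs v" and R: "0 \<le> R"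
  shows "\<exists>C\<ge>0. \<forall>P x y. Polynomial.degree P \<le> d \<longrightarrow> v x \<le> R \<longrightarrow> v y \<le> R \<longrightarrow>
    v (eval_ac P x - eval_ac P y) \<le> C * poly_height P * v (x - y)"
proof (induction d)
  case 0
  have "eval_ac P x - eval_ac P y = 0" if "Polynomial.degree P = 0" for P x y
    using that by (auto simp: eval_ac_pCons elim!: degree_eq_zeroE)
  hence "v (eval_ac P x - eval_ac P y) = 0" if "Polynomial.degree P = 0" for P x y
    using that extends_laurent_absD(2)[OF v] by blast
  thus ?case by (intro exI[of _ 0]) simp
next
  case (Suc d)
  then obtain C where C: "0 \<le> C"
    "\<And>P x y. Polynomial.degree P \<le> d \<Longrightarrow> v x \<le> R \<Longrightarrow> v y \<le> R \<Longrightarrow>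
      v (eval_ac P x - eval_ac P y) \<le> C * poly_height P * v (x - y)" by blast
  obtain B where B: "0 \<le> B"
    "\<And>P x. Polynomial.degree P \<le> d \<Longrightarrow> v x \<le> R \<Longrightarrow> v (eval_ac P x) \<le> B * poly_height P"
    using eval_ac_bound[OF v R] by blast
  have "v (eval_ac P x - eval_ac P y) \<le> (B + R * C) * poly_height P * v (x - y)"
    if P: "Polynomial.degree P \<le> Suc d" and x: "v x \<le> R" and y: "v y \<le> R" for P x y
  proof -
    obtain c P' where P': "P = pCons c P'" by (cases P)
    have d: "Polynomial.degree P' \<le> d" using P P' by (auto split: if_splits)
    have h: "poly_height P' \<le> poly_height P" unfolding P' by (rule poly_height_coeff_pCons)
    have nn: "0 \<le> v t" for t by (rule extends_laurent_absD(1)[OF v])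
    have "v (eval_ac P' x) \<le> B * poly_height P"
      using B(2)[OF d x] mult_left_mono[OF h B(1)] by linarith
    hence 1: "v ((x - y) * eval_ac P' x) \<le> v (x - y) * (B * poly_height P)"
      unfolding extends_laurent_absD(3)[OF v] using nn by (intro mult_left_mono) auto
    have "C * poly_height P' * v (x - y) \<le> C * poly_height P * v (x - y)"
      using C(1) h nn by (intro mult_right_mono mult_left_mono) auto
    hence "v (eval_ac P' x - eval_ac P' y) \<le> C * poly_height P * v (x - y)"
      using C(2)[OF d x y] by linarith
    hence 2: "v (y * (eval_ac P' x - eval_ac P' y)) \<le> R * (C * poly_height P * v (x - y))"
      unfolding extends_laurent_absD(3)[OF v] using nn y R by (intro mult_mono) auto
    have "eval_ac P x - eval_ac P y = (x - y) * eval_ac P' x + y * (eval_ac P' x - eval_ac P' y)"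
      by (simp add: P' eval_ac_pCons algebra_simps)
    hence "v (eval_ac P x - eval_ac P y) \<le> v ((x - y) * eval_ac P' x) + v (y * (eval_ac P' x - eval_ac P' y))"
      using extends_laurent_absD(4)[OF v] by metis
    also have "\<dots> \<le> v (x - y) * (B * poly_height P) + R * (C * poly_height P * v (x - y))"
      using 1 2 by linarith
    also have "\<dots> = (B + R * C) * poly_height P * v (x - y)" by (simp add: algebra_simps)
    finally show ?thesis .
  qed
  thus ?case using B C R by (intro exI[of _ "B + R * C"]) auto
qed

subsection \<open>Exponents from a sequence of quadratic approximations\<close>

lemma eventually_le_of_limit:
  fixes f :: "nat \<Rightarrow> real"
  assumes "(\<lambda>i. f i / w ^ i) \<longlonglongrightarrow> l" "l < u" "0 < w"
  shows "\<exists>N. \<forall>i\<ge>N. f i \<le> u * w ^ i"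
proof -
  have "\<forall>\<^sub>F i in sequentially. f i / w ^ i < u" using assms(1,2) by (rule order_tendstoD)
  then obtain N where "\<And>i. i \<ge> N \<Longrightarrow> f i / w ^ i < u" by (auto simp: eventually_sequentially)
  hence "\<forall>i\<ge>N. f i \<le> u * w ^ i" using assms(3) by (auto simp: divide_less_eq less_imp_le)
  thus ?thesis ..
qed

lemma eventually_ge_of_limit:
  fixes f :: "nat \<Rightarrow> real"
  assumes "(\<lambda>i. f i / w ^ i) \<longlonglongrightarrow> l" "u < l" "0 < w"
  shows "\<exists>N. \<forall>i\<ge>N. u * w ^ i \<le> f i"
proof -
  have "(\<lambda>i. - f i / w ^ i) \<longlonglongrightarrow> - l" using tendsto_minus[OF assms(1)] by simp
  from eventually_le_of_limit[OF this, of "- u"] assms show ?thesis by auto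
qed

text \<open>Membership is asked only on an interval below \<open>W\<close>, because the lower bounds
  for the exponents are proved for nonnegative values.\<close>

lemma Sup_ereal_eqI:
  assumes "\<And>y. y \<in> A \<Longrightarrow> y \<le> W" and "\<And>y. V \<le> y \<Longrightarrow> y < W \<Longrightarrow> y \<in> A" and "V < W"
  shows "Sup (ereal ` A) = ereal W"
proof (rule antisym)
  show "Sup (ereal ` A) \<le> ereal W" using assms(1) by (auto intro!: Sup_least)
  show "ereal W \<le> Sup (ereal ` A)"
  proof (rule dense_le)
    fix z assume z: "z < ereal W"
    obtain t where t: "z < ereal t" "ereal t < ereal W" using ereal_dense2[OF z] by blast
    have "max t V \<in> A" using assms(2)[of "max t V"] assms(3) t by auto
    hence "ereal (max t V) \<le> Sup (ereal ` A)" by (intro Sup_upper imageI)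
    moreover have "z \<le> ereal (max t V)" using t(1) by (metis ereal_less_eq(3) less_imp_le max.cobounded1 order_trans)
    ultimately show "z \<le> Sup (ereal ` A)" by (rule order_trans[rotated])
  qed
qed

text \<open>The data on which the exponents depend, detached from continued fractions. The three
  limits fix the sizes on the scale w^i, \<open>lead\<close> controls the conjugate of \<alpha>_i in
  the Liouville inequality, and \<open>content\<close> controls the loss in passing from
  \<open>S i\<close> to an irreducible polynomial.\<close>

locale quad_approx =
  fixes \<xi> :: "'a::finite_field fls" and v :: "'a fls alg_closure \<Rightarrow> real"
    and S :: "nat \<Rightarrow> 'a poly poly" and \<alpha> :: "nat \<Rightarrow> 'a fls"
    and w \<eta> A K :: real and d i0 :: nat
  assumes ext: "extends_laurent_abs v"
    and d_ge: "2 \<le> d" and w_ge: "121 * (real d)\<^sup>2 \<le> w"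
    and eta_pos: "0 < \<eta>" and eta_less: "\<eta> < sqrt w / real d"
    and A_pos: "0 < A" and K_ge: "1 \<le> K"
    and xi_le: "laurent_abs \<xi> \<le> 1"
    and alpha_le: "i0 \<le> i \<Longrightarrow> laurent_abs (\<alpha> i) \<le> 1"
    and degree_S: "i0 \<le> i \<Longrightarrow> Polynomial.degree (S i) = 2"
    and root: "i0 \<le> i \<Longrightarrow> eval_laurent (S i) (\<alpha> i) = 0"
    and irrational: "i0 \<le> i \<Longrightarrow> eval_laurent [:e, r:] (\<alpha> i) = 0 \<Longrightarrow> r = 0 \<and> e = 0"
    and lead: "i0 \<le> i \<Longrightarrow> poly_height (S i) \<le> K * tabs (Polynomial.coeff (S i) 2)"
    and content: "i0 \<le> i \<Longrightarrow> S i = smult g R \<Longrightarrow> tabs g \<le> K"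
    and alpha_ne: "i0 \<le> i \<Longrightarrow> \<alpha> i \<noteq> \<xi>"
    and S_xi_nz: "i0 \<le> i \<Longrightarrow> eval_laurent (S i) \<xi> \<noteq> 0"
    and lim_height: "(\<lambda>i. ln (poly_height (S i)) / w ^ i) \<longlonglongrightarrow> (2 + \<eta>) * A"
    and lim_dist: "(\<lambda>i. ln (laurent_abs (\<xi> - \<alpha> i)) / w ^ i) \<longlonglongrightarrow> - (2 * w * A)"
    and lim_eval: "(\<lambda>i. ln (laurent_abs (eval_laurent (S i) \<xi>)) / w ^ i) \<longlonglongrightarrow> (\<eta> - 2 * w) * A"
begin

text \<open>\<rho> measures the Liouville loss: 2 d ln H(S_i) grows like 2 \<rho> A w^i. \<kappa> is
  the exponent for polynomials not proportional to any \<open>S i\<close>: at the index used, 9/5 A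
  w^i is at most about 2 ln H(P), while the loss is at most 21/10 \<rho> A w^i, that is, 7/3 \<rho>
  ln H(P). \<open>W0\<close> and \<open>W1\<close> are the claimed values.\<close>

definition \<rho> :: real where "\<rho> = real d * (2 + \<eta>)"
definition \<kappa> :: real where "\<kappa> = 1 + 7 / 3 * \<rho>"
definition W0 :: real where "W0 = (2 * w - \<eta>) / (2 + \<eta>)"
definition W1 :: real where "W1 = (2 * w - 2 - \<eta>) / (2 + \<eta>)"

lemma sqrt_w: "11 * real d \<le> sqrt w" "22 \<le> sqrt w" "sqrt w * sqrt w = w" "484 \<le> w"
proof -
  have "(11 * real d)\<^sup>2 \<le> w" using w_ge by (simp add: power_mult_distrib)
  thus 1: "11 * real d \<le> sqrt w" by (rule real_le_rsqrt)
  thus 2: "22 \<le> sqrt w" using d_ge by simp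
  have "0 \<le> w" using w_ge by (meson order_trans zero_le_mult_iff zero_le_numeral zero_le_power2)
  thus 3: "sqrt w * sqrt w = w" by simp
  have "22 * 22 \<le> sqrt w * sqrt w" using 2 \<open>0 \<le> w\<close> by (intro mult_mono) auto
  thus "484 \<le> w" using 3 by simp
qed

lemma w_pos: "0 < w" "1 < w" using sqrt_w by auto

lemma rho_pos: "0 < \<rho>" using d_ge eta_pos by (simp add: \<rho>_def)

lemma rho_le: "\<rho> \<le> 13 / 11 * sqrt w"
proof -
  have "\<eta> * real d < sqrt w" using eta_less d_ge by (simp add: pos_less_divide_eq)
  thus ?thesis using sqrt_w(1) by (simp add: \<rho>_def algebra_simps)
qed

lemma sqrt_w_le: "22 * sqrt w \<le> w"
  using mult_right_mono[OF sqrt_w(2), of "sqrt w"] sqrt_w by simp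

lemma rho_less: "\<rho> < w / 10"
  using rho_le sqrt_w_le sqrt_w by linarith

text \<open>Here the constant 121 is spent. As d \<ge> 2, 2 + \<eta> is at most \<rho> / 2, so
  (\<kappa> + 1) (2 + \<eta>) is at most \<rho> + 7/6 \<rho>^2. With \<rho> below w / 10 and
  \<rho>^2 at most 169/121 w, this is less than 2 w.\<close>

lemma kappa_less: "\<kappa> < W1"
proof -
  have "2 * (2 + \<eta>) \<le> real d * (2 + \<eta>)" using d_ge eta_pos by (intro mult_right_mono) auto
  hence "2 + \<eta> \<le> \<rho> / 2" by (simp add: \<rho>_def)
  hence "(2 + 7 / 3 * \<rho>) * (2 + \<eta>) \<le> (2 + 7 / 3 * \<rho>) * (\<rho> / 2)"
    using rho_pos by (intro mult_left_mono) auto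
  moreover have "(2 + 7 / 3 * \<rho>) * (\<rho> / 2) = \<rho> + 7 / 6 * (\<rho> * \<rho>)" by (simp add: distrib_right)
  moreover have "\<rho> * \<rho> \<le> (13 / 11 * sqrt w) * (13 / 11 * sqrt w)"
    using rho_le rho_pos w_pos by (intro mult_mono) auto
  moreover have "(13 / 11 * sqrt w) * (13 / 11 * sqrt w) = 169 / 121 * (sqrt w * sqrt w)" by simp
  ultimately have "(2 + 7 / 3 * \<rho>) * (2 + \<eta>) \<le> \<rho> + 7 / 6 * (169 / 121 * w)"
    unfolding sqrt_w(3) by linarith
  also have "\<dots> < 2 * w" using rho_less w_pos by simp
  finally have "(2 + 7 / 3 * \<rho>) * (2 + \<eta>) < 2 * w" .
  thus ?thesis using eta_pos by (simp add: \<kappa>_def W1_def pos_less_divide_eq algebra_simps)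
qed

lemma W1_less_W0: "W1 < W0"
  using eta_pos by (simp add: W0_def W1_def divide_strict_right_mono)

lemma kappa_ge: "1 \<le> \<kappa>" using rho_pos by (simp add: \<kappa>_def)

lemma S_nonzero: "i0 \<le> i \<Longrightarrow> S i \<noteq> 0"
  using degree_S[of i] by auto

lemma dist_bound: "\<exists>N. \<forall>i\<ge>N. 2 * real d * ln (poly_height (S i)) + ln (laurent_abs (\<xi> - \<alpha> i)) \<le> - (9/5 * A * w) * w ^ i"
proof (rule eventually_le_of_limit[OF _ _ w_pos(1)])
  show "(\<lambda>i. (2 * real d * ln (poly_height (S i)) + ln (laurent_abs (\<xi> - \<alpha> i))) / w ^ i)
      \<longlonglongrightarrow> 2 * real d * ((2 + \<eta>) * A) + - (2 * w * A)"
    using tendsto_add[OF tendsto_mult_left[OF lim_height, of "2 * real d"] lim_dist]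
    by (simp add: add_divide_distrib)
  have "2 * real d * ((2 + \<eta>) * A) + - (2 * w * A) = (2 * \<rho> - 2 * w) * A"
    by (simp add: \<rho>_def algebra_simps)
  also have "\<dots> < - (9/5 * w) * A" using rho_less A_pos by (intro mult_strict_right_mono) auto
  finally show "2 * real d * ((2 + \<eta>) * A) + - (2 * w * A) < - (9/5 * A * w)" by (simp add: mult_ac)
qed

text \<open>The factor 21/10 exceeds the limiting factor 2 and is 7/6 times the 9/5 of
  \<open>dist_bound\<close>, so the two bounds combine to 7/6 \<rho>.\<close>

lemma height_bound: "\<exists>N. \<forall>i\<ge>N. 2 * real d * ln (poly_height (S i)) \<le> (21/10 * \<rho> * A) * w ^ i"
proof (rule eventually_le_of_limit[OF _ _ w_pos(1)])
  show "(\<lambda>i. (2 * real d * ln (poly_height (S i))) / w ^ i) \<longlonglongrightarrow> 2 * real d * ((2 + \<eta>) * A)"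
    using tendsto_mult_left[OF lim_height, of "2 * real d"] by simp
  have "2 * real d * ((2 + \<eta>) * A) = 2 * (\<rho> * A)" by (simp add: \<rho>_def algebra_simps)
  also have "\<dots> < 21/10 * (\<rho> * A)" using rho_pos A_pos by simp
  finally show "2 * real d * ((2 + \<eta>) * A) < 21/10 * \<rho> * A" by (simp add: mult_ac)
qed

text \<open>\<open>P(\<xi>)\<close> is compared with \<open>P(\<alpha>\<^sub>i)\<close> for the first \<open>i\<close> at which \<open>\<alpha>\<^sub>i\<close> is so close to \<open>\<xi>\<close> that the
  Liouville bound for \<open>P(\<alpha>\<^sub>i)\<close> exceeds \<open>P(\<xi>) - P(\<alpha>\<^sub>i)\<close>.\<close>
lemma irreducible_lower_bound:
  "\<exists>c. 0 < c \<and> (\<forall>P. Factorial_Ring.irreducible P \<longrightarrow> Polynomial.degree P \<le> d \<longrightarrow>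
     c * poly_height P powr (- \<kappa>) \<le> laurent_abs (eval_laurent P \<xi>) \<or> (\<exists>i\<ge>i1. i0 \<le> i \<and> (\<exists>g. S i = smult g P)))"
proof -
  obtain N1 N2 where
    N1: "\<And>i. N1 \<le> i \<Longrightarrow> 2 * real d * ln (poly_height (S i)) + ln (laurent_abs (\<xi> - \<alpha> i)) \<le> - (9/5 * A * w) * w ^ i"
    and N2: "\<And>i. N2 \<le> i \<Longrightarrow> 2 * real d * ln (poly_height (S i)) \<le> (21/10 * \<rho> * A) * w ^ i"
    using dist_bound height_bound by blast
  \<comment> \<open>Starting at \<open>i1\<close> or later ensures that exceptional polynomials
    belong to indices at which a caller's asymptotic estimates already hold.\<close>
  define i2 where "i2 = max (max i0 i1) (max N1 N2)"
  have i2: "i0 \<le> i2" "i1 \<le> i2" "N1 \<le> i2" "N2 \<le> i2" by (auto simp: i2_def)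
  define k where "k = ln K"
  have k: "0 \<le> k" using K_ge by (simp add: k_def)
  \<comment> \<open>One term for each case below: if the least good index is \<open>i2\<close>, it
    has no predecessor and a constant absorbs the height of \<open>S i2\<close>; otherwise the
    predecessor fails and only multiples of \<open>k\<close> are left over.\<close>
  define C where "C = max (k + 2 * real d * ln (poly_height (S i2))) (k + 7 / 6 * \<rho> * k)"
  have "exp (- C) * poly_height P powr (- \<kappa>) \<le> laurent_abs (eval_laurent P \<xi>)"
    if P: "Factorial_Ring.irreducible P" "Polynomial.degree P \<le> d"
      and no: "\<And>i g. i2 \<le> i \<Longrightarrow> S i \<noteq> smult g P" for P
  proof -
    define h where "h = ln (poly_height P)"
    have "P \<noteq> 0" using P(1) by auto
    hence HP: "1 \<le> poly_height P" by (rule poly_height_ge_1)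
    hence h: "0 \<le> h" by (simp add: h_def)
    define good where "good = (\<lambda>i. k + 2 * h + 2 * real d * ln (poly_height (S i)) + ln (laurent_abs (\<xi> - \<alpha> i)) < 0)"
    have step: "- (k + h + 2 * real d * ln (poly_height (S i))) \<le> ln (laurent_abs (eval_laurent P \<xi>))
        \<and> eval_laurent P \<xi> \<noteq> 0"
      if i: "i2 \<le> i" "good i" for i
    proof -
      have ii: "i0 \<le> i" using i i2 by simp
      define Hi where "Hi = poly_height (S i)"
      have Hi: "1 \<le> Hi" unfolding Hi_def by (rule poly_height_ge_1[OF S_nonzero[OF ii]])
      have nz: "eval_laurent P (\<alpha> i) \<noteq> 0"
        using irreducible_root_of_quadratic[OF P(1) degree_S[OF ii] root[OF ii]] irrational[OF ii] no[OF i(1)] by blast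
      define p where "p = laurent_abs (eval_laurent P (\<alpha> i))"
      define \<delta> where "\<delta> = laurent_abs (\<xi> - \<alpha> i)"
      have p: "0 < p" and \<delta>: "0 < \<delta>" using nz alpha_ne[OF ii] by (auto simp: p_def \<delta>_def)
      have "1 \<le> K * Hi ^ (2 * d) * poly_height P * p"
        unfolding Hi_def p_def
        by (rule liouville_quadratic[OF degree_S[OF ii] root[OF ii] irrational[OF ii] alpha_le[OF ii] K_ge lead[OF ii]])
           (use d_ge P nz in auto)
      hence "ln 1 \<le> ln (K * Hi ^ (2 * d) * poly_height P * p)"
        by (intro ln_mono) auto
      also have "\<dots> = k + 2 * real d * ln Hi + h + ln p"
        using K_ge Hi HP p by (simp add: ln_mult ln_realpow k_def h_def)
      finally have lnp: "- (k + h + 2 * real d * ln Hi) \<le> ln p" by simp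
      have "ln (poly_height P * \<delta>) = h + ln \<delta>" using HP \<delta> by (simp add: ln_mult h_def)
      also have "\<dots> < ln p" using i(2) lnp by (simp add: good_def Hi_def \<delta>_def)
      finally have "poly_height P * \<delta> < p" using HP \<delta> p by (simp add: ln_less_cancel_iff mult_pos_pos)
      moreover have "laurent_abs (eval_laurent P \<xi> - eval_laurent P (\<alpha> i)) \<le> poly_height P * \<delta>"
        unfolding \<delta>_def by (rule laurent_abs_eval_diff_le[OF xi_le alpha_le[OF ii]])
      ultimately have "laurent_abs (eval_laurent P (\<alpha> i) + (eval_laurent P \<xi> - eval_laurent P (\<alpha> i))) = p"
        unfolding p_def by (intro laurent_abs_add_eq) simp
      hence "laurent_abs (eval_laurent P \<xi>) = p" by simp
      thus ?thesis using lnp p by (auto simp: Hi_def)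
    qed
    have "\<exists>i. i2 \<le> i \<and> good i"
    proof -
      obtain j where j: "(k + 2 * h) / (9/5 * A * w) < w ^ j" using real_arch_pow[OF w_pos(2)] by blast
      define i where "i = max i2 j"
      have "w ^ j \<le> w ^ i" using w_pos by (intro power_increasing) (auto simp: i_def)
      hence "(k + 2 * h) / (9/5 * A * w) < w ^ i" using j by linarith
      hence "k + 2 * h < (9/5 * A * w) * w ^ i" using A_pos w_pos by (simp add: divide_less_eq mult_ac)
      moreover have "2 * real d * ln (poly_height (S i)) + ln (laurent_abs (\<xi> - \<alpha> i)) \<le> - (9/5 * A * w) * w ^ i"
        using i2 by (intro N1) (simp add: i_def)
      ultimately have "good i" unfolding good_def minus_mult_left[symmetric] by linarith
      thus ?thesis unfolding i_def by (intro exI[of _ "max i2 j"]) simp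
    qed
    define i where "i = (LEAST i. i2 \<le> i \<and> good i)"
    have i: "i2 \<le> i" "good i" unfolding i_def using LeastI_ex[OF \<open>\<exists>i. i2 \<le> i \<and> good i\<close>] by auto
    have nz: "eval_laurent P \<xi> \<noteq> 0" using step[OF i] by blast
    have "- (C + \<kappa> * h) \<le> ln (laurent_abs (eval_laurent P \<xi>))"
    proof (cases "i = i2")
      case True
      have "h \<le> \<kappa> * h" using mult_right_mono[OF kappa_ge h] by simp
      moreover have "k + 2 * real d * ln (poly_height (S i2)) \<le> C" by (simp add: C_def)
      ultimately show ?thesis using step[OF i] True by simp
    next
      case False
      then obtain j where j: "i = Suc j" "i2 \<le> j" using i by (cases i) auto
      have "\<not> good j" using not_less_Least[of j "\<lambda>i. i2 \<le> i \<and> good i"] j by (auto simp: i_def[symmetric])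
      \<comment> \<open>Failure at \<open>j\<close> bounds w^i by \<open>h\<close>: passing from
        \<open>j\<close> to \<open>i\<close> costs the factor w, which is just the factor by which
        the distance at \<open>j\<close> beats w^j.\<close>
      hence "9/5 * A * w ^ i \<le> k + 2 * h" using N1[of j] i2 j by (simp add: good_def mult_ac)
      hence "7 / 6 * \<rho> * (9/5 * A * w ^ i) \<le> 7 / 6 * \<rho> * (k + 2 * h)"
        using rho_pos by (intro mult_left_mono) auto
      moreover have "2 * real d * ln (poly_height (S i)) \<le> 7 / 6 * \<rho> * (9/5 * A * w ^ i)"
        using N2[of i] i i2 by (simp add: mult_ac)
      moreover have "7 / 6 * \<rho> * (k + 2 * h) = 7 / 6 * \<rho> * k + 7 / 3 * \<rho> * h"
        by (simp add: algebra_simps)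
      moreover have "k + 7 / 6 * \<rho> * k \<le> C" by (simp add: C_def)
      moreover have "\<kappa> * h = h + 7 / 3 * \<rho> * h" by (simp add: \<kappa>_def algebra_simps)
      ultimately show ?thesis using step[OF i] by linarith
    qed
    hence "exp (- (C + \<kappa> * h)) \<le> laurent_abs (eval_laurent P \<xi>)"
      using nz by (simp add: ln_ge_iff)
    moreover have "exp (- (C + \<kappa> * h)) = exp (- C) * poly_height P powr (- \<kappa>)"
      using HP by (simp add: powr_def h_def exp_add[symmetric])
    ultimately show ?thesis by simp
  qed
  thus ?thesis using i2 by (intro exI[of _ "exp (- C)"]) (meson exp_gt_zero order_trans)
qed

text \<open>Bounded content means that \<open>S i\<close> and the irreducible polynomial
  proportional to it differ by at most ln K on the logarithmic scale.\<close>

lemma ln_smult: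
  assumes i: "i0 \<le> i" and S: "S i = smult g P"
  shows "ln (laurent_abs (eval_laurent (S i) \<xi>)) - ln K \<le> ln (laurent_abs (eval_laurent P \<xi>))"
    and "ln (poly_height (S i)) - ln K \<le> ln (poly_height P)"
    and "ln (poly_height P) \<le> ln (poly_height (S i))" and "eval_laurent P \<xi> \<noteq> 0" "P \<noteq> 0"
proof -
  have g: "g \<noteq> 0" and P: "P \<noteq> 0" using S_nonzero[OF i] S by auto
  show "P \<noteq> 0" by fact
  have ev: "eval_laurent (S i) \<xi> = of_Tpoly g * eval_laurent P \<xi>" by (simp add: S eval_laurent_smult)
  show nz: "eval_laurent P \<xi> \<noteq> 0" using ev S_xi_nz[OF i] by auto
  have gK: "tabs g \<le> K" by (rule content[OF i S])
  have g1: "1 \<le> tabs g" using g by (rule tabs_ge_1)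
  have lg: "ln (tabs g) \<le> ln K" "0 \<le> ln (tabs g)"
    using gK g1 by (intro ln_mono, auto)
  have "ln (laurent_abs (eval_laurent (S i) \<xi>)) = ln (tabs g) + ln (laurent_abs (eval_laurent P \<xi>))"
    using g nz by (simp add: ev laurent_abs_mult ln_mult)
  thus "ln (laurent_abs (eval_laurent (S i) \<xi>)) - ln K \<le> ln (laurent_abs (eval_laurent P \<xi>))" using lg by simp
  have "poly_height P \<noteq> 0" using poly_height_ge_1[OF P] by linarith
  hence "ln (poly_height (S i)) = ln (tabs g) + ln (poly_height P)"
    using g by (simp add: S poly_height_smult ln_mult)
  thus "ln (poly_height (S i)) - ln K \<le> ln (poly_height P)"
    "ln (poly_height P) \<le> ln (poly_height (S i))" using lg by auto
qed

end

lemma poly_height_eq_power: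
  "P \<noteq> 0 \<Longrightarrow> \<exists>k. poly_height (P :: 'a::finite_field poly poly) = real CARD('a) ^ k"
proof -
  assume P: "P \<noteq> 0"
  obtain i where i: "poly_height P = tabs (Polynomial.coeff P i)" using poly_height_attained[of P] by blast
  have "Polynomial.coeff P i \<noteq> 0" using i poly_height_ge_1[OF P] by auto
  thus ?thesis using i tabs_eq by metis
qed

lemma extends_laurent_abs_minus:
  assumes v: "extends_laurent_abs v" shows "v (- x) = v x"
proof -
  have "v 1 = 1" using extends_laurent_absD(5)[OF v, of 1] by simp
  hence "v (- 1) * v (- 1) = 1" using extends_laurent_absD(3)[OF v, of "- 1" "- 1"] by simp
  hence "v (- 1) = 1" using extends_laurent_absD(1)[OF v, of "- 1"]
    by (metis abs_of_nonneg abs_mult_self_eq power2_eq_1_iff power2_eq_square abs_minus_cancel abs_one)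
  thus ?thesis using extends_laurent_absD(3)[OF v, of "- 1" x] by simp
qed

lemma eval_ac_quadratic:
  assumes "Polynomial.degree S = 2"
  shows "eval_ac S x = to_ac (of_Tpoly (Polynomial.coeff S 2)) * x\<^sup>2
    + to_ac (of_Tpoly (Polynomial.coeff S 1)) * x + to_ac (of_Tpoly (Polynomial.coeff S 0))"
proof -
  have "S = [:Polynomial.coeff S 0, Polynomial.coeff S 1, Polynomial.coeff S 2:]"
    using assms by (intro poly_eqI) (auto simp: coeff_pCons coeff_eq_0 numeral_2_eq_2 split: nat.splits)
  hence "eval_ac S x = eval_ac [:Polynomial.coeff S 0, Polynomial.coeff S 1, Polynomial.coeff S 2:] x"
    by simp
  thus ?thesis by (simp add: eval_ac_pCons power2_eq_square algebra_simps)
qed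

lemma quadratic_two_roots:
  fixes p q x :: "'a::field"
  assumes "c2 * p\<^sup>2 + c1 * p + c0 = 0" "c2 * q\<^sup>2 + c1 * q + c0 = 0" "p \<noteq> q"
  shows "c2 * x\<^sup>2 + c1 * x + c0 = c2 * (x - p) * (x - q)"
proof -
  have "(p - q) * (c2 * (p + q) + c1) = (c2 * p\<^sup>2 + c1 * p + c0) - (c2 * q\<^sup>2 + c1 * q + c0)"
    by (simp add: power2_eq_square algebra_simps)
  hence "(p - q) * (c2 * (p + q) + c1) = 0" unfolding assms(1,2) by simp
  hence s: "c2 * (p + q) + c1 = 0" using assms(3) by simp
  have "c2 * x\<^sup>2 + c1 * x + c0 - c2 * (x - p) * (x - q)
      = (c2 * p\<^sup>2 + c1 * p + c0) + (c2 * (p + q) + c1) * (x - p)"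
    by (simp add: power2_eq_square algebra_simps)
  thus ?thesis unfolding s assms(1) by simp
qed

lemma powr_bound_height:
  fixes H :: real
  assumes "1 \<le> H" "0 < c" "s < u" "c * H powr (- s) \<le> H powr (- u)"
  shows "H \<le> (1 / c) powr (1 / (u - s))"
proof -
  have "c * (H powr (- s) * H powr u) \<le> H powr (- u) * H powr u"
    using mult_right_mono[OF assms(4), of "H powr u"] by (simp add: mult.assoc)
  hence "c * H powr (u - s) \<le> 1" using assms(1) by (simp add: powr_add[symmetric])
  hence "H powr (u - s) \<le> 1 / c" using assms(2) by (simp add: field_simps)
  hence "(H powr (u - s)) powr (1 / (u - s)) \<le> (1 / c) powr (1 / (u - s))"
    using assms(3) by (intro powr_mono2) auto
  thus ?thesis using assms by (simp add: powr_powr)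
qed

context quad_approx
begin

lemma W0_eq: "W0 * (2 + \<eta>) = 2 * w - \<eta>" and W1_eq: "(W1 + 1) * (2 + \<eta>) = 2 * w"
  using eta_pos by (simp_all add: W0_def W1_def field_simps)

lemma W1_pos: "0 < W1" using kappa_less kappa_ge by linarith

lemma W0_pos: "0 < W0" using W1_pos W1_less_W0 by linarith

text \<open>All comparisons of exponents become signs of such combinations. The critical ones, with
  limit 0, are (p, q, r) = (1, 0, W0) and (0, 1, W1 + 1), by \<open>W0_eq\<close> and
  \<open>W1_eq\<close>.\<close>

lemma limit_combination:
  "(\<lambda>i. (p * ln (laurent_abs (eval_laurent (S i) \<xi>)) + q * ln (laurent_abs (\<xi> - \<alpha> i))
      + r * ln (poly_height (S i))) / w ^ i)
    \<longlonglongrightarrow> (p * (\<eta> - 2 * w) - q * (2 * w) + r * (2 + \<eta>)) * A"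
proof -
  have "(\<lambda>i. p * (ln (laurent_abs (eval_laurent (S i) \<xi>)) / w ^ i) + q * (ln (laurent_abs (\<xi> - \<alpha> i)) / w ^ i)
      + r * (ln (poly_height (S i)) / w ^ i))
    \<longlonglongrightarrow> p * ((\<eta> - 2 * w) * A) + q * (- (2 * w * A)) + r * ((2 + \<eta>) * A)"
    by (intro tendsto_intros lim_eval lim_dist lim_height)
  thus ?thesis by (simp add: add_divide_distrib algebra_simps)
qed

lemma combination_nonneg:
  assumes "0 < p * (\<eta> - 2 * w) - q * (2 * w) + r * (2 + \<eta>)"
  shows "\<exists>N. \<forall>i\<ge>N. 0 \<le> p * ln (laurent_abs (eval_laurent (S i) \<xi>)) + q * ln (laurent_abs (\<xi> - \<alpha> i))
      + r * ln (poly_height (S i))"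
  using eventually_ge_of_limit[OF limit_combination, of 0 p q r] assms A_pos w_pos by simp

lemma exceptional_bound:
  assumes i: "i0 \<le> i" "S i = smult g P" and t: "0 \<le> t"
    and y: "0 \<le> ln y + t * ln (poly_height (S i))" "0 < y"
  shows "exp (- (t * ln K)) * poly_height P powr (- t) \<le> y"
proof -
  have "poly_height P \<ge> 1" by (rule poly_height_ge_1[OF ln_smult(5)[OF i]])
  hence "exp (- (t * ln K)) * poly_height P powr (- t) = exp (- (t * (ln K + ln (poly_height P))))"
    by (simp add: powr_def exp_add[symmetric] algebra_simps)
  also have "\<dots> \<le> exp (- (t * ln (poly_height (S i))))"
    using ln_smult(2)[OF i] t by (simp add: mult_left_mono)
  also have "\<dots> \<le> exp (ln y)" unfolding exp_le_cancel_iff using y(1) by linarith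
  finally show ?thesis using y by simp
qed

lemma poly_lower_bound_irreducible:
  assumes \<epsilon>: "0 < \<epsilon>"
  shows "\<exists>c. 0 < c \<and> c \<le> 1 \<and> (\<forall>P. Factorial_Ring.irreducible P \<longrightarrow> Polynomial.degree P \<le> d \<longrightarrow>
    c * poly_height P powr (- (W0 + \<epsilon>)) \<le> laurent_abs (eval_laurent P \<xi>))"
proof -
  define t where "t = W0 + \<epsilon>"
  have t: "0 \<le> t" using W0_pos \<epsilon> by (simp add: t_def)
  have "1 * (\<eta> - 2 * w) - 0 * (2 * w) + t * (2 + \<eta>) = \<epsilon> * (2 + \<eta>)"
    using W0_eq by (simp add: t_def algebra_simps)
  hence "0 < 1 * (\<eta> - 2 * w) - 0 * (2 * w) + t * (2 + \<eta>)" using \<epsilon> eta_pos by simp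
  from combination_nonneg[OF this] obtain i1 where i1:
    "\<And>i. i1 \<le> i \<Longrightarrow> 0 \<le> ln (laurent_abs (eval_laurent (S i) \<xi>)) + t * ln (poly_height (S i))" by auto
  obtain c where c: "0 < c" "\<And>P. Factorial_Ring.irreducible P \<Longrightarrow> Polynomial.degree P \<le> d \<Longrightarrow>
     c * poly_height P powr (- \<kappa>) \<le> laurent_abs (eval_laurent P \<xi>) \<or> (\<exists>i\<ge>i1. i0 \<le> i \<and> (\<exists>g. S i = smult g P))"
    using irreducible_lower_bound[of i1] by blast
  define c' where "c' = min 1 (min c (exp (- (t * ln K)) / K))"
  have c': "0 < c'" "c' \<le> 1" "c' \<le> c" "c' \<le> exp (- (t * ln K)) / K" using c(1) K_ge by (auto simp: c'_def)
  have "c' * poly_height P powr (- t) \<le> laurent_abs (eval_laurent P \<xi>)"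
    if P: "Factorial_Ring.irreducible P" "Polynomial.degree P \<le> d" for P
    using c(2)[OF P]
  proof
    assume *: "c * poly_height P powr (- \<kappa>) \<le> laurent_abs (eval_laurent P \<xi>)"
    have "1 \<le> poly_height P" using P(1) by (intro poly_height_ge_1) auto
    hence "c' * poly_height P powr (- t) \<le> c * poly_height P powr (- \<kappa>)"
      using c c' kappa_less W1_less_W0 \<epsilon> by (intro mult_mono powr_mono) (auto simp: t_def)
    thus ?thesis using * by linarith
  next
    assume "\<exists>i\<ge>i1. i0 \<le> i \<and> (\<exists>g. S i = smult g P)"
    then obtain i g where i: "i1 \<le> i" "i0 \<le> i" "S i = smult g P" by blast
    let ?y = "laurent_abs (eval_laurent (S i) \<xi>)"
    have "exp (- (t * ln K)) * poly_height P powr (- t) \<le> ?y"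
      by (rule exceptional_bound[OF i(2,3) t i1[OF i(1)]]) (simp add: S_xi_nz[OF i(2)])
    moreover have "?y = tabs g * laurent_abs (eval_laurent P \<xi>)"
      using i(3) by (simp add: eval_laurent_smult laurent_abs_mult)
    moreover have "tabs g * laurent_abs (eval_laurent P \<xi>) \<le> K * laurent_abs (eval_laurent P \<xi>)"
      by (intro mult_right_mono content[OF i(2,3)]) simp
    ultimately have "exp (- (t * ln K)) * poly_height P powr (- t) \<le> K * laurent_abs (eval_laurent P \<xi>)" by simp
    hence "exp (- (t * ln K)) / K * poly_height P powr (- t) \<le> laurent_abs (eval_laurent P \<xi>)"
      using K_ge by (simp add: field_simps)
    moreover have "c' * poly_height P powr (- t) \<le> exp (- (t * ln K)) / K * poly_height P powr (- t)"
      using c' by (intro mult_right_mono) auto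
    ultimately show ?thesis by linarith
  qed
  thus ?thesis using c' unfolding t_def by blast
qed

text \<open>Both sides of the bound are multiplicative, so it passes from irreducible polynomials to all.\<close>
lemma poly_lower_bound:
  assumes \<epsilon>: "0 < \<epsilon>"
  shows "\<exists>c. 0 < c \<and> (\<forall>P. P \<noteq> 0 \<longrightarrow> Polynomial.degree P \<le> d \<longrightarrow>
    c * poly_height P powr (- (W0 + \<epsilon>)) \<le> laurent_abs (eval_laurent P \<xi>))"
proof -
  define t where "t = W0 + \<epsilon>"
  have t: "0 \<le> t" using W0_pos \<epsilon> by (simp add: t_def)
  obtain c where c: "0 < c" "c \<le> 1" "\<And>P. Factorial_Ring.irreducible P \<Longrightarrow> Polynomial.degree P \<le> d \<Longrightarrow>
    c * poly_height P powr (- t) \<le> laurent_abs (eval_laurent P \<xi>)"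
    using poly_lower_bound_irreducible[OF \<epsilon>] unfolding t_def by blast
  \<comment> \<open>Induction on the degree in X plus the exponent \<open>k\<close> of the height
    q^k. Both are additive over products and a non-unit has a positive sum, so factors constant in X
    are split off as well.\<close>
  have "c ^ Polynomial.degree P * poly_height P powr (- t) \<le> laurent_abs (eval_laurent P \<xi>)"
    if "Polynomial.degree P + k = n" "poly_height P = real CARD('a) ^ k" "P \<noteq> 0" "Polynomial.degree P \<le> d"
    for n k P
    using that
  proof (induction n arbitrary: P k rule: less_induct)
    case (less n)
    have H1: "1 \<le> poly_height P" by (rule poly_height_ge_1) fact
    have "poly_height P powr (- t) \<le> poly_height P powr 0" using H1 t by (intro powr_mono) auto
    hence le1: "poly_height P powr (- t) \<le> 1" using H1 by simp
    consider "Polynomial.degree P = 0" | "Factorial_Ring.irreducible P" "0 < Polynomial.degree P"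
      | Q R where "P = Q * R" "\<not> Q dvd 1" "\<not> R dvd 1"
      using less.prems(3) unfolding Factorial_Ring.irreducible_def
      by (metis is_unit_degree gr0I)
    thus ?case
    proof cases
      \<comment> \<open>Constants in X come with c^0 = 1; hence the number of such factors, which
        \<open>d\<close> does not bound, does not affect the final constant.\<close>
      case 1
      then obtain f where "P = [:f:]" by (elim degree_eq_zeroE)
      thus ?thesis using H1 le1 by (simp add: eval_laurent_pCons)
    next
      case 2
      have "c ^ Polynomial.degree P \<le> c ^ 1" using c 2 by (intro power_decreasing) auto
      hence "c ^ Polynomial.degree P * poly_height P powr (- t) \<le> c * poly_height P powr (- t)"
        by (intro mult_right_mono) auto
      thus ?thesis using c(3)[OF 2(1) less.prems(4)] by linarith
    next
      case 3
      have nz: "Q \<noteq> 0" "R \<noteq> 0" using 3 less.prems by auto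
      obtain k1 k2 where k: "poly_height Q = real CARD('a) ^ k1" "poly_height R = real CARD('a) ^ k2"
        using poly_height_eq_power nz by metis
      have pos: "0 < Polynomial.degree U + l" if "\<not> U dvd 1" "U \<noteq> 0" "poly_height U = real CARD('a) ^ l"
        for U :: "'a poly poly" and l
      proof (rule ccontr)
        assume "\<not> 0 < Polynomial.degree U + l"
        hence U: "Polynomial.degree U = 0" "poly_height U = 1" using that by auto
        then obtain f where f: "U = [:f:]" by (elim degree_eq_zeroE)
        have "f \<noteq> 0" using f that by auto
        hence "Polynomial.degree f = 0" using U f tabs_gt_1[of f] by auto
        hence "f dvd 1" using \<open>f \<noteq> 0\<close> by (simp add: is_unit_iff_degree)
        thus False using that f by (simp add: is_unit_const_poly_iff)
      qed
      have "real CARD('a) ^ (k1 + k2) = real CARD('a) ^ k"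
        using k less.prems(2) 3(1) by (simp add: poly_height_mult power_add)
      hence kk: "k1 + k2 = k" by (rule power_inject_exp[OF card_gt_1, THEN iffD1])
      have deg: "Polynomial.degree P = Polynomial.degree Q + Polynomial.degree R"
        using 3 nz by (simp add: degree_mult_eq)
      have IHQ: "c ^ Polynomial.degree Q * poly_height Q powr (- t) \<le> laurent_abs (eval_laurent Q \<xi>)"
        using less.prems deg kk k nz pos[OF 3(3) nz(2) k(2)] by (intro less.IH[OF _ refl]) auto
      have IHR: "c ^ Polynomial.degree R * poly_height R powr (- t) \<le> laurent_abs (eval_laurent R \<xi>)"
        using less.prems deg kk k nz pos[OF 3(2) nz(1) k(1)] by (intro less.IH[OF _ refl]) auto
      have "c ^ Polynomial.degree P * poly_height P powr (- t) =
         (c ^ Polynomial.degree Q * poly_height Q powr (- t)) * (c ^ Polynomial.degree R * poly_height R powr (- t))"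
        unfolding deg unfolding 3(1) poly_height_mult by (simp add: power_add powr_mult mult_ac)
      also have "\<dots> \<le> laurent_abs (eval_laurent Q \<xi>) * laurent_abs (eval_laurent R \<xi>)"
        using c by (intro mult_mono IHQ IHR) auto
      finally show ?thesis using 3 by (simp add: eval_laurent_mult laurent_abs_mult)
    qed
  qed
  hence *: "c ^ Polynomial.degree P * poly_height P powr (- t) \<le> laurent_abs (eval_laurent P \<xi>)"
    if "P \<noteq> 0" "Polynomial.degree P \<le> d" for P
    using that poly_height_eq_power by blast
  have "c ^ d * poly_height P powr (- t) \<le> laurent_abs (eval_laurent P \<xi>)"
    if P: "P \<noteq> 0" "Polynomial.degree P \<le> d" for P
  proof -
    have "c ^ d \<le> c ^ Polynomial.degree P" using c P by (intro power_decreasing) auto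
    hence "c ^ d * poly_height P powr (- t) \<le> c ^ Polynomial.degree P * poly_height P powr (- t)"
      by (intro mult_right_mono) auto
    thus ?thesis using *[OF P] by linarith
  qed
  thus ?thesis using c unfolding t_def by (intro exI[of _ "c ^ d"]) auto
qed

text \<open>Near \<xi> the Lipschitz bound gives |\<xi> - \<beta>| at least a constant times
  |P(\<xi>)| / H(P) for the minimal polynomial P, which suffices because \<kappa> < W1. If P is
  proportional to some \<open>S i\<close>, then \<beta> is \<alpha>_i or its conjugate, and the
  distance is known.\<close>

lemma algebraic_lower_bound:
  assumes \<epsilon>: "0 < \<epsilon>"
  shows "\<exists>c. 0 < c \<and> (\<forall>\<beta>\<in>algebraic_elements. alg_degree \<beta> \<le> d \<longrightarrow>
    c * alg_height \<beta> powr (- (W1 + 1 + \<epsilon>)) \<le> v (to_ac \<xi> - \<beta>))"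
proof -
  define t where "t = W1 + 1 + \<epsilon>"
  have t: "0 \<le> t" using W1_pos \<epsilon> by (simp add: t_def)
  have tt: "t * (2 + \<eta>) = 2 * w + \<epsilon> * (2 + \<eta>)" using W1_eq by (simp add: t_def algebra_simps)
  have "0 < 0 * (\<eta> - 2 * w) - 1 * (2 * w) + t * (2 + \<eta>)" using tt \<epsilon> eta_pos by simp
  from combination_nonneg[OF this] obtain N1 where N1:
    "\<And>i. N1 \<le> i \<Longrightarrow> 0 \<le> ln (laurent_abs (\<xi> - \<alpha> i)) + t * ln (poly_height (S i))" by auto
  \<comment> \<open>For the conjugate of \<alpha>_i, whose distance to \<xi> is |S_i(\<xi>)| / (|c2|
    |\<xi> - \<alpha>_i|). One power of the height is spent on \<open>c2\<close>, hence t -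
    1.\<close>
  have "1 * (\<eta> - 2 * w) - (- 1) * (2 * w) + (t - 1) * (2 + \<eta>) = 2 * w - 2 + \<epsilon> * (2 + \<eta>)"
    using tt by (simp add: algebra_simps)
  hence "0 < 1 * (\<eta> - 2 * w) - (- 1) * (2 * w) + (t - 1) * (2 + \<eta>)" using w_pos \<epsilon> eta_pos
    by (smt (verit) mult_pos_pos)
  from combination_nonneg[OF this] obtain N2 where N2:
    "\<And>i. N2 \<le> i \<Longrightarrow> 0 \<le> ln (laurent_abs (eval_laurent (S i) \<xi>)) - ln (laurent_abs (\<xi> - \<alpha> i))
       + (t - 1) * ln (poly_height (S i))" by auto
  obtain c where c: "0 < c" "\<And>P. Factorial_Ring.irreducible P \<Longrightarrow> Polynomial.degree P \<le> d \<Longrightarrow>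
     c * poly_height P powr (- \<kappa>) \<le> laurent_abs (eval_laurent P \<xi>) \<or>
     (\<exists>i\<ge>max N1 N2. i0 \<le> i \<and> (\<exists>g. S i = smult g P))"
    using irreducible_lower_bound[of "max N1 N2"] by blast
  obtain C0 where C0: "0 \<le> C0" "\<And>P x y. Polynomial.degree P \<le> d \<Longrightarrow> v x \<le> 2 \<Longrightarrow> v y \<le> 2 \<Longrightarrow>
    v (eval_ac P x - eval_ac P y) \<le> C0 * poly_height P * v (x - y)"
    using eval_ac_diff_bound[OF ext, of 2 d] by auto
  define C where "C = C0 + 1"
  define c' where "c' = min 1 (min (c / C) (exp (- (t * ln K))))"
  have C: "0 < C" "C0 \<le> C" using C0 by (auto simp: C_def)
  have c': "0 < c'" "c' \<le> 1" "c' \<le> c / C" "c' \<le> exp (- (t * ln K))" using c(1) C by (auto simp: c'_def)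
  note vD = extends_laurent_absD[OF ext]
  have "c' * alg_height \<beta> powr (- t) \<le> v (to_ac \<xi> - \<beta>)"
    if \<beta>: "\<beta> \<in> algebraic_elements" "alg_degree \<beta> \<le> d" for \<beta>
  proof -
    define P where "P = min_poly \<beta>"
    have "is_min_poly \<beta> P" unfolding P_def by (rule is_min_poly_min_poly[OF \<beta>(1)])
    note P = is_min_polyD[OF this]
    have deg: "Polynomial.degree P \<le> d" using \<beta>(2) by (simp add: alg_degree_def P_def)
    have hP: "alg_height \<beta> = poly_height P" by (simp add: alg_height_def P_def)
    have H1: "1 \<le> poly_height P" by (rule poly_height_ge_1[OF P(4)])
    define y where "y = v (to_ac \<xi> - \<beta>)"
    have "c' * poly_height P powr (- t) \<le> y"
    proof (cases "1 < y")
      case True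
      have "poly_height P powr (- t) \<le> poly_height P powr 0" using H1 t by (intro powr_mono) auto
      hence "c' * poly_height P powr (- t) \<le> 1 * 1" using H1 c' by (intro mult_mono) auto
      thus ?thesis using True by simp
    next
      case False
      from c(2)[OF P(3) deg] show ?thesis
      proof
        assume *: "c * poly_height P powr (- \<kappa>) \<le> laurent_abs (eval_laurent P \<xi>)"
        have vx: "v (to_ac \<xi>) \<le> 2" using xi_le by (simp add: vD)
        have "v \<beta> = v (to_ac \<xi> + (- (to_ac \<xi> - \<beta>)))" by simp
        also have "\<dots> \<le> v (to_ac \<xi>) + v (- (to_ac \<xi> - \<beta>))" by (rule vD(4))
        also have "\<dots> = v (to_ac \<xi>) + y" by (simp only: extends_laurent_abs_minus[OF ext] y_def)
        also have "\<dots> \<le> 2" using xi_le False by (simp add: vD)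
        finally have vb: "v \<beta> \<le> 2" .
        have "laurent_abs (eval_laurent P \<xi>) = v (eval_ac P (to_ac \<xi>) - eval_ac P \<beta>)"
          by (simp add: P eval_ac_to_ac vD)
        also have "\<dots> \<le> C0 * poly_height P * y" unfolding y_def by (rule C0(2)[OF deg vx vb])
        also have "\<dots> \<le> C * poly_height P * y"
          using C vD(1) by (intro mult_right_mono) (auto simp: y_def)
        finally have "c * poly_height P powr (- \<kappa>) \<le> C * poly_height P * y" using * by linarith
        hence "c / C * (poly_height P powr (- \<kappa>) / poly_height P) \<le> y"
          using C H1 by (simp add: field_simps)
        moreover have "poly_height P powr (- \<kappa>) / poly_height P = poly_height P powr (- \<kappa> - 1)"
          using H1 by (simp add: powr_diff)
        moreover have "c' * poly_height P powr (- t) \<le> c / C * poly_height P powr (- \<kappa> - 1)"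
          using c C c' H1 kappa_less \<epsilon> by (intro mult_mono powr_mono) (auto simp: t_def)
        ultimately show ?thesis by simp
      next
        assume "\<exists>i\<ge>max N1 N2. i0 \<le> i \<and> (\<exists>g. S i = smult g P)"
        then obtain i g where i: "N1 \<le> i" "N2 \<le> i" "i0 \<le> i" "S i = smult g P" by auto
        have root_b: "eval_ac (S i) \<beta> = 0" by (simp add: i P eval_ac_smult)
        have "0 \<le> ln y + t * ln (poly_height (S i)) \<and> 0 < y"
        proof (cases "\<beta> = to_ac (\<alpha> i)")
          case True
          hence "y = laurent_abs (\<xi> - \<alpha> i)" unfolding y_def by (simp add: vD(5) flip: to_ac_diff)
          thus ?thesis using N1[OF i(1)] alpha_ne[OF i(3)] by auto
        next
          case False
          define c2 where "c2 = Polynomial.coeff (S i) 2"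
          have "c2 \<noteq> 0" unfolding c2_def using degree_S[OF i(3)] S_nonzero[OF i(3)]
            by (metis leading_coeff_0_iff)
          have "eval_ac (S i) (to_ac (\<alpha> i)) = 0" by (simp add: eval_ac_to_ac root[OF i(3)])
          hence "eval_ac (S i) (to_ac \<xi>) = to_ac (of_Tpoly c2) * (to_ac \<xi> - to_ac (\<alpha> i)) * (to_ac \<xi> - \<beta>)"
            using root_b False unfolding eval_ac_quadratic[OF degree_S[OF i(3)]] c2_def
            by (intro quadratic_two_roots) auto
          hence "v (eval_ac (S i) (to_ac \<xi>)) = v (to_ac (of_Tpoly c2)) * v (to_ac (\<xi> - \<alpha> i)) * y"
            by (simp add: vD(3) y_def)
          hence eq: "laurent_abs (eval_laurent (S i) \<xi>) = tabs c2 * laurent_abs (\<xi> - \<alpha> i) * y"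
            unfolding eval_ac_to_ac vD(5) .
          have "y \<noteq> 0" using eq S_xi_nz[OF i(3)] by auto
          hence y: "0 < y" using vD(1) by (simp add: y_def less_le)
          have "ln (laurent_abs (eval_laurent (S i) \<xi>)) = ln (tabs c2) + ln (laurent_abs (\<xi> - \<alpha> i)) + ln y"
            unfolding eq using y \<open>c2 \<noteq> 0\<close> alpha_ne[OF i(3)] by (simp add: ln_mult)
          moreover have "ln (tabs c2) \<le> ln (poly_height (S i))"
            using \<open>c2 \<noteq> 0\<close> coeff_le_poly_height[of "S i" 2] by (intro ln_mono) (auto simp: c2_def)
          ultimately show ?thesis using N2[OF i(2)] y by (simp add: algebra_simps)
        qed
        hence "exp (- (t * ln K)) * poly_height P powr (- t) \<le> y"
          using i t by (intro exceptional_bound) auto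
        moreover have "c' * poly_height P powr (- t) \<le> exp (- (t * ln K)) * poly_height P powr (- t)"
          using c' by (intro mult_right_mono) auto
        ultimately show ?thesis by linarith
      qed
    qed
    thus ?thesis by (simp add: hP y_def)
  qed
  thus ?thesis using c' unfolding t_def by blast
qed

section \<open>Upper and lower bounds for the two exponents\<close>

lemma w_exp_upper:
  assumes n: "n \<le> d" and inf: "infinite {P. Polynomial.degree P \<le> n \<and>
     0 < laurent_abs (eval_laurent P \<xi>) \<and> laurent_abs (eval_laurent P \<xi>) \<le> poly_height P powr (- u)}"
  shows "u \<le> W0"
proof (rule ccontr)
  assume u: "\<not> u \<le> W0"
  define \<epsilon> where "\<epsilon> = (u - W0) / 2"
  have \<epsilon>: "0 < \<epsilon>" "W0 + \<epsilon> < u" using u by (auto simp: \<epsilon>_def field_simps)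
  obtain c where c: "0 < c" "\<And>P. P \<noteq> 0 \<Longrightarrow> Polynomial.degree P \<le> d \<Longrightarrow>
    c * poly_height P powr (- (W0 + \<epsilon>)) \<le> laurent_abs (eval_laurent P \<xi>)"
    using poly_lower_bound[OF \<epsilon>(1)] by blast
  let ?B = "(1 / c) powr (1 / (u - (W0 + \<epsilon>)))"
  have "{P. Polynomial.degree P \<le> n \<and> 0 < laurent_abs (eval_laurent P \<xi>) \<and>
      laurent_abs (eval_laurent P \<xi>) \<le> poly_height P powr (- u)}
    \<subseteq> {P. Polynomial.degree P \<le> n \<and> poly_height P \<le> ?B}"
  proof safe
    fix P assume P: "Polynomial.degree P \<le> n" "0 < laurent_abs (eval_laurent P \<xi>)"
      "laurent_abs (eval_laurent P \<xi>) \<le> poly_height P powr (- u)"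
    have "P \<noteq> 0" using P by auto
    show "poly_height P \<le> ?B"
      using c(2)[OF \<open>P \<noteq> 0\<close>] P n \<epsilon> c(1) poly_height_ge_1[OF \<open>P \<noteq> 0\<close>]
      by (intro powr_bound_height) auto
  qed
  thus False using inf finite_subset finite_bounded_height by blast
qed

lemma w_star_exp_upper:
  assumes n: "n \<le> d" and inf: "infinite {\<beta> \<in> algebraic_elements. alg_degree \<beta> \<le> n \<and>
     0 < v (to_ac \<xi> - \<beta>) \<and> v (to_ac \<xi> - \<beta>) \<le> alg_height \<beta> powr (- u - 1)}"
  shows "u \<le> W1"
proof (rule ccontr)
  assume u: "\<not> u \<le> W1"
  define \<epsilon> where "\<epsilon> = (u - W1) / 2"
  have \<epsilon>: "0 < \<epsilon>" "W1 + 1 + \<epsilon> < u + 1" using u by (auto simp: \<epsilon>_def field_simps)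
  obtain c where c: "0 < c" "\<And>\<beta>. \<beta> \<in> algebraic_elements \<Longrightarrow> alg_degree \<beta> \<le> d \<Longrightarrow>
    c * alg_height \<beta> powr (- (W1 + 1 + \<epsilon>)) \<le> v (to_ac \<xi> - \<beta>)"
    using algebraic_lower_bound[OF \<epsilon>(1)] by blast
  let ?B = "(1 / c) powr (1 / (u + 1 - (W1 + 1 + \<epsilon>)))"
  have "{\<beta> \<in> algebraic_elements. alg_degree \<beta> \<le> n \<and>
     0 < v (to_ac \<xi> - \<beta>) \<and> v (to_ac \<xi> - \<beta>) \<le> alg_height \<beta> powr (- u - 1)}
    \<subseteq> {\<beta> \<in> algebraic_elements. alg_degree \<beta> \<le> n \<and> alg_height \<beta> \<le> ?B}"
  proof safe
    fix \<beta> assume \<beta>: "\<beta> \<in> algebraic_elements" "alg_degree \<beta> \<le> n"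
      "v (to_ac \<xi> - \<beta>) \<le> alg_height \<beta> powr (- u - 1)"
    have "1 \<le> alg_height \<beta>" unfolding alg_height_def
      using is_min_polyD(4)[OF is_min_poly_min_poly[OF \<beta>(1)]] by (rule poly_height_ge_1)
    moreover have "c * alg_height \<beta> powr (- (W1 + 1 + \<epsilon>)) \<le> alg_height \<beta> powr (- (u + 1))"
      using c(2)[OF \<beta>(1)] \<beta> n by simp
    ultimately show "alg_height \<beta> \<le> ?B" using \<epsilon> c(1) by (intro powr_bound_height) auto
  qed
  thus False using inf finite_subset finite_alg_bounded_height by blast
qed

lemma w_exp_lower:
  assumes n: "2 \<le> n" and u: "0 \<le> u" "u < W0"
  shows "infinite {P. Polynomial.degree P \<le> n \<and>
     0 < laurent_abs (eval_laurent P \<xi>) \<and> laurent_abs (eval_laurent P \<xi>) \<le> poly_height P powr (- u)}"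
    (is "infinite ?Z")
proof
  assume fin: "finite ?Z"
  have "u * (2 + \<eta>) < 2 * w - \<eta>" using u W0_eq eta_pos by (metis add_pos_pos mult_strict_right_mono zero_less_numeral)
  hence "0 < (- 1) * (\<eta> - 2 * w) - 0 * (2 * w) + (- u) * (2 + \<eta>)" by simp
  from combination_nonneg[OF this] obtain N1 where N1:
    "\<And>i. N1 \<le> i \<Longrightarrow> ln (laurent_abs (eval_laurent (S i) \<xi>)) \<le> - u * ln (poly_height (S i))" by force
  have "A < (2 + \<eta>) * A" using A_pos eta_pos by simp
  from eventually_ge_of_limit[OF lim_height this w_pos(1)] obtain N2 where N2:
    "\<And>i. N2 \<le> i \<Longrightarrow> A * w ^ i \<le> ln (poly_height (S i))" by blast
  define N where "N = max i0 (max N1 N2)"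
  have "S i \<in> ?Z" if "N \<le> i" for i
  proof -
    have i: "i0 \<le> i" "N1 \<le> i" using that by (auto simp: N_def)
    have "laurent_abs (eval_laurent (S i) \<xi>) = exp (ln (laurent_abs (eval_laurent (S i) \<xi>)))"
      using S_xi_nz[OF i(1)] by simp
    also have "\<dots> \<le> exp (- u * ln (poly_height (S i)))" using N1[OF i(2)] by simp
    also have "\<dots> = poly_height (S i) powr (- u)"
      using poly_height_ge_1[OF S_nonzero[OF i(1)]] by (simp add: powr_def)
    finally show ?thesis using S_xi_nz[OF i(1)] degree_S[OF i(1)] n by simp
  qed
  hence "S ` {N..} \<subseteq> ?Z" by auto
  \<comment> \<open>Infinitude is seen on the heights, which are unbounded along the
    sequence.\<close>
  hence "finite ((\<lambda>P. ln (poly_height P)) ` S ` {N..})" using fin finite_subset by blast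
  then obtain B where B: "\<And>i. N \<le> i \<Longrightarrow> ln (poly_height (S i)) \<le> B"
    using bdd_above_finite[of "(\<lambda>P. ln (poly_height P)) ` S ` {N..}"] unfolding bdd_above_def by auto
  obtain j where j: "B / A < w ^ j" using real_arch_pow[OF w_pos(2)] by blast
  have "w ^ j \<le> w ^ max N j" using w_pos by (intro power_increasing) auto
  hence "B / A < w ^ max N j" using j by linarith
  hence "B < A * w ^ max N j" using A_pos by (simp add: divide_less_eq mult.commute)
  also have "\<dots> \<le> ln (poly_height (S (max N j)))" by (intro N2) (simp add: N_def)
  also have "\<dots> \<le> B" by (intro B) simp
  finally show False by simp
qed

lemma alg_approx:
  assumes i: "i0 \<le> i"
  shows "to_ac (\<alpha> i) \<in> algebraic_elements" "alg_degree (to_ac (\<alpha> i)) = 2"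
    "1 \<le> alg_height (to_ac (\<alpha> i))" "ln (alg_height (to_ac (\<alpha> i))) \<le> ln (poly_height (S i))"
proof -
  show alg: "to_ac (\<alpha> i) \<in> algebraic_elements"
    unfolding algebraic_elements_def using root[OF i] S_nonzero[OF i] by (auto simp: eval_ac_to_ac)
  define P where "P = min_poly (to_ac (\<alpha> i))"
  have "is_min_poly (to_ac (\<alpha> i)) P" unfolding P_def by (rule is_min_poly_min_poly[OF alg])
  note P = is_min_polyD[OF this]
  have "eval_laurent P (\<alpha> i) = 0" using P(1) by (simp add: eval_ac_to_ac)
  then obtain g where g: "S i = smult g P"
    using irreducible_root_of_quadratic[OF P(3) degree_S[OF i] root[OF i]] irrational[OF i] by blast
  have "g \<noteq> 0" using g S_nonzero[OF i] by auto
  thus "alg_degree (to_ac (\<alpha> i)) = 2" using g degree_S[OF i] by (simp add: alg_degree_def P_def)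
  show "1 \<le> alg_height (to_ac (\<alpha> i))" using poly_height_ge_1[OF P(4)] by (simp add: alg_height_def P_def)
  show "ln (alg_height (to_ac (\<alpha> i))) \<le> ln (poly_height (S i))"
    using ln_smult(3)[OF i g] by (simp add: alg_height_def P_def)
qed

lemma w_star_exp_lower:
  assumes n: "2 \<le> n" and u: "0 \<le> u" "u < W1"
  shows "infinite {\<beta> \<in> algebraic_elements. alg_degree \<beta> \<le> n \<and>
     0 < v (to_ac \<xi> - \<beta>) \<and> v (to_ac \<xi> - \<beta>) \<le> alg_height \<beta> powr (- u - 1)}"
    (is "infinite ?Z")
proof
  assume fin: "finite ?Z"
  have "(u + 1) * (2 + \<eta>) < (W1 + 1) * (2 + \<eta>)" using u eta_pos by (intro mult_strict_right_mono) auto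
  hence "0 < 0 * (\<eta> - 2 * w) - (- 1) * (2 * w) + (- (u + 1)) * (2 + \<eta>)"
    unfolding W1_eq minus_mult_left[symmetric] by simp
  from combination_nonneg[OF this] obtain N1 where N1:
    "\<And>i. N1 \<le> i \<Longrightarrow> ln (laurent_abs (\<xi> - \<alpha> i)) \<le> - (u + 1) * ln (poly_height (S i))" by force
  have "- (2 * w * A) < - (w * A)" using A_pos w_pos by simp
  from eventually_le_of_limit[OF lim_dist this w_pos(1)] obtain N2 where N2:
    "\<And>i. N2 \<le> i \<Longrightarrow> ln (laurent_abs (\<xi> - \<alpha> i)) \<le> - (w * A) * w ^ i" by blast
  define N where "N = max i0 (max N1 N2)"
  have vx: "v (to_ac \<xi> - to_ac (\<alpha> i)) = laurent_abs (\<xi> - \<alpha> i)" for i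
    by (simp add: extends_laurent_absD(5)[OF ext] flip: to_ac_diff)
  have "to_ac (\<alpha> i) \<in> ?Z" if "N \<le> i" for i
  proof -
    have i: "i0 \<le> i" "N1 \<le> i" using that by (auto simp: N_def)
    note h = alg_approx[OF i(1)]
    have "laurent_abs (\<xi> - \<alpha> i) = exp (ln (laurent_abs (\<xi> - \<alpha> i)))"
      using alpha_ne[OF i(1)] by simp
    also have "\<dots> \<le> exp (- (u + 1) * ln (alg_height (to_ac (\<alpha> i))))"
      using N1[OF i(2)] mult_left_mono[OF h(4), of "u + 1"] u
      unfolding exp_le_cancel_iff minus_mult_left[symmetric] by linarith
    also have "\<dots> = alg_height (to_ac (\<alpha> i)) powr (- u - 1)"
      using h(3) by (simp add: powr_def algebra_simps)
    finally show ?thesis using h alpha_ne[OF i(1)] n by (simp add: vx)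
  qed
  hence "(\<lambda>i. to_ac (\<alpha> i)) ` {N..} \<subseteq> ?Z" by auto
  hence "finite ((\<lambda>\<beta>. ln (v (to_ac \<xi> - \<beta>))) ` (\<lambda>i. to_ac (\<alpha> i)) ` {N..})"
    using fin finite_subset by blast
  then obtain B where B: "\<And>i. N \<le> i \<Longrightarrow> B \<le> ln (laurent_abs (\<xi> - \<alpha> i))"
    using bdd_below_finite[of "(\<lambda>\<beta>. ln (v (to_ac \<xi> - \<beta>))) ` (\<lambda>i. to_ac (\<alpha> i)) ` {N..}"]
    unfolding bdd_below_def by (auto simp: vx)
  have wA: "0 < w * A" using w_pos A_pos by simp
  obtain j where j: "- B / (w * A) < w ^ j" using real_arch_pow[OF w_pos(2)] by blast
  have "w ^ j \<le> w ^ max N j" using w_pos by (intro power_increasing) auto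
  hence "- B / (w * A) < w ^ max N j" using j by linarith
  hence "- B < (w * A) * w ^ max N j" unfolding pos_divide_less_eq[OF wA] by (simp only: mult.commute)
  moreover have "ln (laurent_abs (\<xi> - \<alpha> (max N j))) \<le> - (w * A) * w ^ max N j"
    by (intro N2) (simp add: N_def)
  moreover have "B \<le> ln (laurent_abs (\<xi> - \<alpha> (max N j)))" by (intro B) simp
  ultimately show False by simp
qed

theorem w_exp_eq: "2 \<le> n \<Longrightarrow> n \<le> d \<Longrightarrow> w_exp n \<xi> = ereal W0"
  unfolding w_exp_def
  by (rule Sup_ereal_eqI[where V = 0]) (use w_exp_upper w_exp_lower W0_pos in auto)

theorem w_star_exp_eq: "2 \<le> n \<Longrightarrow> n \<le> d \<Longrightarrow> w_star_exp v n \<xi> = ereal W1"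
  unfolding w_star_exp_def
  by (rule Sup_ereal_eqI[where V = 0]) (use w_star_exp_upper w_star_exp_lower W1_pos in auto)

end

subsection \<open>Asymptotics up to a linear error\<close>

text \<open>Errors linear in i arise because each block contributes a bounded number of letters
  other than \<open>a\<close>; they still vanish after division by w^i.\<close>

definition lin_approx :: "real \<Rightarrow> (nat \<Rightarrow> real) \<Rightarrow> real \<Rightarrow> bool" where
  "lin_approx w f l \<longleftrightarrow> (\<exists>C. \<forall>\<^sub>F i in sequentially. \<bar>f i - l * w ^ i\<bar> \<le> C * (real i + 1))"

lemma lin_approxI: "(\<And>i. i0 \<le> i \<Longrightarrow> \<bar>f i - l * w ^ i\<bar> \<le> C * (real i + 1)) \<Longrightarrow> lin_approx w f l"
  unfolding lin_approx_def eventually_sequentially by blast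

lemma lin_approx_add:
  assumes "lin_approx w f k" "lin_approx w g l"
  shows "lin_approx w (\<lambda>i. f i + g i) (k + l)"
proof -
  obtain C D where
    "\<forall>\<^sub>F i in sequentially. \<bar>f i - k * w ^ i\<bar> \<le> C * (real i + 1)"
    "\<forall>\<^sub>F i in sequentially. \<bar>g i - l * w ^ i\<bar> \<le> D * (real i + 1)"
    using assms unfolding lin_approx_def by blast
  hence "\<forall>\<^sub>F i in sequentially. \<bar>f i + g i - (k + l) * w ^ i\<bar> \<le> (C + D) * (real i + 1)"
    by eventually_elim (simp add: algebra_simps abs_le_iff)
  thus ?thesis unfolding lin_approx_def by blast
qed

lemma lin_approx_scale:
  assumes "lin_approx w f k" shows "lin_approx w (\<lambda>i. c * f i) (c * k)"
proof -
  obtain C where "\<forall>\<^sub>F i in sequentially. \<bar>f i - k * w ^ i\<bar> \<le> C * (real i + 1)"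
    using assms unfolding lin_approx_def by blast
  hence "\<forall>\<^sub>F i in sequentially. \<bar>c * f i - c * k * w ^ i\<bar> \<le> \<bar>c\<bar> * C * (real i + 1)"
  proof eventually_elim
    case (elim i)
    have "\<bar>c * f i - c * k * w ^ i\<bar> = \<bar>c\<bar> * \<bar>f i - k * w ^ i\<bar>"
      by (simp add: abs_mult[symmetric] algebra_simps)
    also have "\<dots> \<le> \<bar>c\<bar> * (C * (real i + 1))" using elim by (intro mult_left_mono) auto
    finally show ?case by (simp add: mult_ac)
  qed
  thus ?thesis unfolding lin_approx_def by blast
qed

lemma lin_approx_bounded:
  assumes "lin_approx w f k" "\<forall>\<^sub>F i in sequentially. \<bar>g i - f i\<bar> \<le> C * (real i + 1)"
  shows "lin_approx w g k"
proof -
  obtain D where "\<forall>\<^sub>F i in sequentially. \<bar>f i - k * w ^ i\<bar> \<le> D * (real i + 1)"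
    using assms unfolding lin_approx_def by blast
  with assms(2) have "\<forall>\<^sub>F i in sequentially. \<bar>g i - k * w ^ i\<bar> \<le> (C + D) * (real i + 1)"
    by eventually_elim (simp add: algebra_simps abs_le_iff)
  thus ?thesis unfolding lin_approx_def by blast
qed

lemma eventually_bounded:
  assumes "\<forall>i\<ge>N. \<bar>g i - f i\<bar> \<le> C" shows "\<forall>\<^sub>F i in sequentially. \<bar>g i - f i\<bar> \<le> C * (real i + 1)"
  unfolding eventually_sequentially
proof (intro exI[of _ N] allI impI)
  fix i assume "N \<le> i"
  hence le: "\<bar>g i - f i\<bar> \<le> C" using assms by blast
  hence "0 \<le> C" by linarith
  hence "C * 1 \<le> C * (real i + 1)" by (intro mult_left_mono) auto
  thus "\<bar>g i - f i\<bar> \<le> C * (real i + 1)" using le by linarith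
qed

lemma lin_approx_limit:
  assumes w: "1 < w" and f: "lin_approx w f k"
  shows "(\<lambda>i. f i / w ^ i) \<longlonglongrightarrow> k"
proof -
  obtain C where C: "\<forall>\<^sub>F i in sequentially. \<bar>f i - k * w ^ i\<bar> \<le> C * (real i + 1)"
    using f unfolding lin_approx_def by blast
  have lim: "(\<lambda>i. C * (real i * (1 / w) ^ i + (1 / w) ^ i)) \<longlonglongrightarrow> C * (0 + 0)"
    using w by (intro tendsto_intros powser_times_n_limit_0 LIMSEQ_power_zero) auto
  have "(\<lambda>i. f i / w ^ i - k) \<longlonglongrightarrow> 0"
  proof (rule tendsto_0_le[where K = 1])
    show "(\<lambda>i. C * (real i * (1 / w) ^ i + (1 / w) ^ i)) \<longlonglongrightarrow> 0" using lim by simp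
    show "\<forall>\<^sub>F i in sequentially. norm (f i / w ^ i - k) \<le> norm (C * (real i * (1 / w) ^ i + (1 / w) ^ i)) * 1"
      using C
    proof eventually_elim
      case (elim i)
      have wi: "0 < w ^ i" using w by simp
      have "\<bar>f i / w ^ i - k\<bar> = \<bar>f i - k * w ^ i\<bar> / w ^ i"
      proof -
        have "f i / w ^ i - k = (f i - k * w ^ i) / w ^ i" using w by (simp add: diff_divide_distrib)
        thus ?thesis using wi by simp
      qed
      also have "\<dots> \<le> C * (real i + 1) / w ^ i" using elim wi by (intro divide_right_mono) auto
      also have "\<dots> = C * (real i * (1 / w) ^ i + (1 / w) ^ i)" 
        by (simp only: power_inverse divide_inverse distrib_left distrib_right mult_1_left mult_1_right mult.assoc)
      finally show ?case by simp
    qed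
  qed
  thus ?thesis by (simp add: LIM_zero_iff)
qed

subsection \<open>The partial quotients of \<open>\<xi>\<^sub>w\<^sub>,\<^sub>\<eta>\<close>\<close>

locale xi_setup =
  fixes a b c :: "'a::finite_field poly" and v :: "'a fls alg_closure \<Rightarrow> real"
    and w \<eta> :: real and d :: nat
  assumes ext: "extends_laurent_abs v"
    and d_ge: "2 \<le> d" and w_ge: "121 * (real d)\<^sup>2 \<le> w"
    and dist: "distinct [a, b, c]"
    and deg: "0 < Polynomial.degree a" "0 < Polynomial.degree b" "0 < Polynomial.degree c"
    and eta_pos: "0 < \<eta>" and eta_less: "\<eta> < sqrt w / real d"
begin

abbreviation s :: "nat \<Rightarrow> 'a poly" where "s \<equiv> cf_seq a b c w \<eta>"

definition W :: "nat \<Rightarrow> nat" where "W i = nat \<lfloor>w ^ i\<rfloor>"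
definition E :: "nat \<Rightarrow> nat" where "E i = nat \<lfloor>\<eta> * w ^ i\<rfloor>"

lemma w_large: "484 \<le> w"
proof -
  have "2\<^sup>2 \<le> (real d)\<^sup>2" using d_ge by (intro power_mono) auto
  thus ?thesis using w_ge by simp
qed

lemma eta_le: "44 * \<eta> \<le> w"
proof -
  have "\<eta> * real d < sqrt w" using eta_less d_ge by (simp add: pos_less_divide_eq)
  moreover have "\<eta> * 2 \<le> \<eta> * real d" using d_ge eta_pos by (intro mult_left_mono) auto
  ultimately have 1: "\<eta> * 2 \<le> sqrt w" by linarith
  have "22 \<le> sqrt w" using w_large by (intro real_le_rsqrt) simp
  hence "22 * sqrt w \<le> sqrt w * sqrt w" using w_large by (intro mult_right_mono) auto
  also have "\<dots> = w" using w_large by simp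
  finally show ?thesis using 1 by linarith
qed

lemma w_power: "1 \<le> w ^ i" "0 < w ^ i"
  using w_large by auto

lemma W_floor: "int (W i) = \<lfloor>w ^ i\<rfloor>" and E_floor: "int (E i) = \<lfloor>\<eta> * w ^ i\<rfloor>"
  using w_power[of i] eta_pos by (auto simp: W_def E_def)

lemma W_bounds: "w ^ i - 1 < real (W i)" "real (W i) \<le> w ^ i"
proof -
  have "real (W i) = real_of_int \<lfloor>w ^ i\<rfloor>" using W_floor[of i] by (metis of_int_of_nat_eq)
  thus "w ^ i - 1 < real (W i)" "real (W i) \<le> w ^ i" by linarith+
qed

lemma E_bounds: "\<eta> * w ^ i - 1 < real (E i)" "real (E i) \<le> \<eta> * w ^ i"
proof -
  have "real (E i) = real_of_int \<lfloor>\<eta> * w ^ i\<rfloor>" using E_floor[of i] by (metis of_int_of_nat_eq)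
  thus "\<eta> * w ^ i - 1 < real (E i)" "real (E i) \<le> \<eta> * w ^ i" by linarith+
qed

lemma W_pos: "0 < W i"
  using W_bounds(1)[of i] w_power(1)[of i] by (cases "W i") auto

text \<open>Block \<open>i\<close> has room for a whole period with some margin, since both \<eta>
  and 1 are small against w.\<close>

lemma W_gap: "W i + E i + 3 < W (Suc i)"
proof -
  have "44 * (\<eta> * w ^ i) \<le> w * w ^ i" using mult_right_mono[OF eta_le, of "w ^ i"] w_power[of i] by simp
  moreover have "484 * w ^ i \<le> w * w ^ i" using w_large w_power[of i] by (intro mult_right_mono) auto
  moreover have "w * w ^ i - 1 < real (W (Suc i))" using W_bounds(1)[of "Suc i"] by simp
  ultimately have "real (W i) + real (E i) + 3 < real (W (Suc i))"
    using W_bounds(2)[of i] E_bounds(2)[of i] w_power(1)[of i] by linarith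
  thus ?thesis by linarith
qed

lemma W_strict_mono: "strict_mono W"
  using W_gap by (simp add: strict_mono_Suc_iff) (metis add_lessD1)

lemma W_less_iff: "W i < W j \<longleftrightarrow> i < j" and W_le_iff: "W i \<le> W j \<longleftrightarrow> i \<le> j"
  using W_strict_mono by (auto simp: strict_mono_less strict_mono_less_eq)

lemma floor_pred: "\<lfloor>w ^ i - 1\<rfloor> = int (W i) - 1"
  using W_floor[of i] by simp

text \<open>The + 1 comes from subtracting the floor of w^j - 1 instead of w^j. It lets the last
  term of block \<open>j\<close> fall on \<open>W (Suc j) + 1\<close>, one place inside the next
  block.\<close>

lemma m_bound_iff:
  assumes "0 < E j"
  shows "m \<le> m_bound w \<eta> j \<longleftrightarrow> m * int (E j) \<le> int (W (Suc j)) - int (W j) + 1"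
proof -
  have "m_bound w \<eta> j = \<lfloor>real_of_int (int (W (Suc j)) - (int (W j) - 1)) / real_of_int (int (E j))\<rfloor>"
    unfolding m_bound_def floor_pred W_floor[symmetric] E_floor[symmetric] by simp
  hence "m \<le> m_bound w \<eta> j \<longleftrightarrow> real_of_int m \<le> real_of_int (int (W (Suc j)) - (int (W j) - 1)) / real_of_int (int (E j))"
    by (simp only: le_floor_iff)
  also have "\<dots> \<longleftrightarrow> real_of_int m * real_of_int (int (E j)) \<le> real_of_int (int (W (Suc j)) - (int (W j) - 1))"
    using assms by (simp add: pos_le_divide_eq)
  also have "\<dots> \<longleftrightarrow> real_of_int (m * int (E j)) \<le> real_of_int (int (W (Suc j)) - (int (W j) - 1))"
    by simp
  also have "\<dots> \<longleftrightarrow> m * int (E j) \<le> int (W (Suc j)) - (int (W j) - 1)"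
    by (rule of_int_le_iff)
  finally show ?thesis by linarith
qed

text \<open>The bound is uniform in \<open>j\<close>: a nonzero floor is at least half of its
  argument, and for \<open>E j = 0\<close> the quotient is 0 by the convention on division.\<close>

lemma m_bound_le: "real_of_int (m_bound w \<eta> j) \<le> 2 * (w + 1) / \<eta>"
proof (cases "E j = 0")
  case True
  hence "m_bound w \<eta> j = 0" unfolding m_bound_def E_floor[symmetric] by simp
  thus ?thesis using w_large eta_pos by simp
next
  case False
  hence "m_bound w \<eta> j * int (E j) \<le> int (W (Suc j)) - int (W j) + 1"
    using m_bound_iff[of j "m_bound w \<eta> j"] by simp
  hence "real_of_int (m_bound w \<eta> j * int (E j)) \<le> real_of_int (int (W (Suc j)) - int (W j) + 1)"
    by (simp only: of_int_le_iff)
  hence 1: "real_of_int (m_bound w \<eta> j) * real (E j) \<le> w ^ Suc j + 1"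
    using W_bounds(2)[of "Suc j"] by simp
  have half: "\<eta> * w ^ j / 2 \<le> real (E j)" using False E_bounds(1)[of j] by linarith
  show ?thesis
  proof (cases "0 \<le> m_bound w \<eta> j")
    case True
    have "real_of_int (m_bound w \<eta> j) * (\<eta> * w ^ j / 2) \<le> real_of_int (m_bound w \<eta> j) * real (E j)"
      using half True by (intro mult_left_mono) auto
    also have "\<dots> \<le> (w + 1) * w ^ j" using 1 w_power(1)[of j] by (simp add: algebra_simps)
    finally have "(real_of_int (m_bound w \<eta> j) * \<eta> / 2) * w ^ j \<le> (w + 1) * w ^ j" by (simp add: algebra_simps)
    hence "real_of_int (m_bound w \<eta> j) * \<eta> / 2 \<le> w + 1" using w_power(2)[of j] by simp
    thus ?thesis using eta_pos by (simp add: pos_le_divide_eq)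
  next
    case False
    hence "real_of_int (m_bound w \<eta> j) \<le> 0" by simp
    also have "0 \<le> 2 * (w + 1) / \<eta>" using w_large eta_pos by simp
    finally show ?thesis .
  qed
qed

lemma s_W: "s (W i) = b"
  using W_pos[of i] W_floor[of i] unfolding cf_seq_def by auto

lemma s_cases: "0 < n \<Longrightarrow> s n = a \<or> s n = b \<or> s n = c"
  unfolding cf_seq_def by auto

lemma s_0: "s 0 = 0" by (simp add: cf_seq_def)

lemma cfrac_s: "cfrac s"
  using s_0 s_cases deg by unfold_locales metis+

section \<open>The periodic continuations of the blocks\<close>

definition pat :: "nat \<Rightarrow> nat \<Rightarrow> 'a poly" where
  "pat i n = (if E i dvd n - W i then c else a)"

lemma s_not_a:
  assumes "0 < n" "s n \<noteq> a"
  shows "\<exists>j m. n = W j + m * E j \<and> int m \<le> max 0 (m_bound w \<eta> j)"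
proof (cases "\<exists>i. int n = \<lfloor>w ^ i\<rfloor>")
  case True
  then obtain i where "n = W i" using W_floor by (metis of_nat_eq_iff)
  thus ?thesis by (intro exI[of _ i] exI[of _ 0]) simp
next
  case False
  then obtain j m where m: "1 \<le> m" "m \<le> m_bound w \<eta> j" "int n = \<lfloor>w ^ j\<rfloor> + m * \<lfloor>\<eta> * w ^ j\<rfloor>"
    using assms unfolding cf_seq_def by (auto split: if_splits)
  have "int n = int (W j) + m * int (E j)" using m(3) by (simp only: W_floor E_floor)
  also have "\<dots> = int (W j + nat m * E j)" using m(1) by simp
  finally have "n = W j + nat m * E j" by (simp only: of_nat_eq_iff)
  thus ?thesis using m by (intro exI[of _ j] exI[of _ "nat m"]) auto
qed

text \<open>In block \<open>i\<close> the pattern can only be disturbed at \<open>W i + 1\<close>, by the last term of block \<open>i - 1\<close>.\<close>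
lemma s_block:
  assumes n: "W i + 1 < n" "n < W (Suc i)" and i: "1 \<le> i" and Ei: "0 < E i"
  shows "s n = pat i n"
proof -
  have notW: "\<not> (\<exists>k. int n = \<lfloor>w ^ k\<rfloor>)"
  proof
    assume "\<exists>k. int n = \<lfloor>w ^ k\<rfloor>"
    then obtain k where "n = W k" using W_floor by (metis of_nat_eq_iff)
    hence "i < k" "k < Suc i" using n W_less_iff[of i k] W_less_iff[of k "Suc i"] by simp_all
    thus False by simp
  qed
  have "(\<exists>j\<ge>1. \<exists>m. 1 \<le> m \<and> m \<le> m_bound w \<eta> j \<and> int n = \<lfloor>w ^ j\<rfloor> + m * \<lfloor>\<eta> * w ^ j\<rfloor>) \<longleftrightarrow> E i dvd n - W i"
  proof
    assume "\<exists>j\<ge>1. \<exists>m. 1 \<le> m \<and> m \<le> m_bound w \<eta> j \<and> int n = \<lfloor>w ^ j\<rfloor> + m * \<lfloor>\<eta> * w ^ j\<rfloor>"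
    then obtain j m where m: "1 \<le> m" "m \<le> m_bound w \<eta> j" "int n = \<lfloor>w ^ j\<rfloor> + m * \<lfloor>\<eta> * w ^ j\<rfloor>" by blast
    have eq: "int n = int (W j) + m * int (E j)" using m(3) by (simp only: W_floor E_floor)
    have "0 \<le> m * int (E j)" using m(1) by simp
    hence "W j \<le> n" using eq by linarith
    hence "j \<le> i" using n W_less_iff[of j "Suc i"] by simp
    have "j = i"
    proof (rule ccontr)
      assume "j \<noteq> i"
      hence "Suc j \<le> i" using \<open>j \<le> i\<close> by simp
      hence le: "W (Suc j) \<le> W i" by (simp add: W_le_iff)
      show False
      proof (cases "E j = 0")
        case True
        hence "n = W j" using eq by simp
        thus False using notW W_floor by metis
      next
        case False
        hence "m * int (E j) \<le> int (W (Suc j)) - int (W j) + 1" using m_bound_iff m(2) by simp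
        thus False using eq le n by linarith
      qed
    qed
    hence "int (n - W i) = m * int (E i)" using eq n by simp
    hence "int (E i) dvd int (n - W i)" by simp
    thus "E i dvd n - W i" by (simp only: of_nat_dvd_iff)
  next
    assume "E i dvd n - W i"
    then obtain k where k: "n - W i = E i * k" by (elim dvdE)
    have eq: "int n = int (W i) + int k * int (E i)"
    proof -
      have "n = W i + E i * k" using k n by simp
      thus ?thesis by (simp add: mult.commute)
    qed
    have "1 \<le> int k" using k n by (cases k) auto
    moreover have "int k \<le> m_bound w \<eta> i" unfolding m_bound_iff[OF Ei] using eq n by linarith
    ultimately show "\<exists>j\<ge>1. \<exists>m. 1 \<le> m \<and> m \<le> m_bound w \<eta> j \<and> int n = \<lfloor>w ^ j\<rfloor> + m * \<lfloor>\<eta> * w ^ j\<rfloor>"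
      using i eq unfolding W_floor E_floor by blast
  qed
  thus ?thesis using notW n unfolding cf_seq_def pat_def by simp
qed

text \<open>The index \<open>W i + 1\<close> is still taken from \<open>s\<close>, since the
  previous block may have left a letter there; from \<open>W i + 2\<close> on, the pattern of block
  \<open>i\<close> is continued for ever.\<close>

definition t :: "nat \<Rightarrow> nat \<Rightarrow> 'a poly" where
  "t i n = (if n \<le> W i + 1 then s n else pat i n)"

text \<open>If \<open>W i + 1\<close> carries a foreign letter, the period starts only after it;
  otherwise that index already fits the pattern. Either way, for \<open>E i\<close> at least 2, the
  last letter before the period breaks it: \<open>b\<close> against \<open>c\<close>, or a letter
  other than \<open>a\<close> against \<open>a\<close>.\<close>

definition pre :: "nat \<Rightarrow> nat" where
  "pre i = (if s (W i + 1) = a then W i else W i + 1)"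

lemma pre_bounds: "W i \<le> pre i" "pre i \<le> W i + 1"
  by (auto simp: pre_def)

lemma t_cases: "0 < n \<Longrightarrow> t i n = a \<or> t i n = b \<or> t i n = c"
  using s_cases[of n] by (auto simp: t_def pat_def)

lemma cfrac_t: "cfrac (t i)"
proof
  show "t i 0 = 0" by (simp add: t_def s_0)
  show "0 < Polynomial.degree (t i n)" if "0 < n" for n using t_cases[OF that, of i] deg by auto
qed

lemma t_eq_s: "1 \<le> i \<Longrightarrow> 0 < E i \<Longrightarrow> n < W (Suc i) \<Longrightarrow> t i n = s n"
  using s_block[of i n] by (auto simp: t_def)

lemma periodic_t:
  assumes E2: "2 \<le> E i"
  shows "periodic_cfrac (t i) (pre i) (E i)"
proof -
  interpret cfrac "t i" by (rule cfrac_t)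
  show ?thesis
  proof
    show "0 < pre i" using pre_bounds(1)[of i] W_pos[of i] by linarith
    show "0 < E i" using E2 by simp
    show "t i (k + E i) = t i k" if k: "pre i < k" for k
    proof -
      have Wk: "W i < k" using k pre_bounds(1)[of i] by linarith
      have "k + E i - W i = (k - W i) + E i" using Wk by simp
      hence "pat i (k + E i) = pat i k" unfolding pat_def by simp
      moreover have "t i k = pat i k"
      proof (cases "k = W i + 1")
        case True
        hence "s (W i + 1) = a" using k by (auto simp: pre_def split: if_splits)
        thus ?thesis using True E2 by (simp add: t_def pat_def)
      next
        case False
        thus ?thesis using Wk by (simp add: t_def)
      qed
      moreover have "t i (k + E i) = pat i (k + E i)" using Wk E2 by (simp add: t_def)
      ultimately show ?thesis by simp
    qed
    show "t i (pre i + E i) \<noteq> t i (pre i)"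
    proof (cases "s (W i + 1) = a")
      case True
      hence "t i (pre i) = b" using s_W[of i] by (simp add: pre_def t_def)
      moreover have "t i (pre i + E i) = c" using True E2 by (simp add: pre_def t_def pat_def)
      ultimately show ?thesis using dist by auto
    next
      case False
      have "\<not> E i dvd Suc (E i)" using E2 dvd_add_right_iff[of "E i" "E i" 1] by simp
      hence "t i (pre i + E i) = a" using False E2 by (simp add: pre_def t_def pat_def)
      moreover have "t i (pre i) = s (W i + 1)" using False by (simp add: pre_def t_def)
      ultimately show ?thesis using False by simp
    qed
  qed
qed

definition Q :: "nat \<Rightarrow> 'a poly poly" where "Q i = cf_quad (t i) (pre i) (E i)"

text \<open>The starting point is moved to \<open>W i + E i\<close>, past any foreign letter, where
  the next period reads exactly a ... a c; this changes \<open>Q i\<close> only by a sign.\<close>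

lemma content_Q:
  assumes E2: "2 \<le> E i" and g: "\<And>k. g dvd Polynomial.coeff (Q i) k"
  shows "g dvd c - a"
proof (rule content_cf_quad[OF E2])
  interpret periodic_cfrac "t i" "pre i" "E i" by (rule periodic_t[OF E2])
  have nd: "\<not> E i dvd E i + j" if "0 < j" "j < E i" for j
    using that by (simp add: nat_dvd_not_less)
  show "t i (W i + E i + j) = a" if "0 < j" "j < E i" for j
    using nd[OF that] that E2 by (simp add: t_def pat_def)
  show "t i (W i + E i + E i) = c" using E2 by (simp add: t_def pat_def)
  fix k
  have "pre i \<le> W i + E i" using pre_bounds(2)[of i] E2 by linarith
  then obtain j where j: "W i + E i = pre i + j" using le_Suc_ex by blast
  have "cf_quad (t i) (W i + E i) (E i) = smult ((- 1) ^ j) (Q i)"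
    unfolding j Q_def by (rule cf_quad_shift_power) (rule periodic)
  thus "g dvd Polynomial.coeff (cf_quad (t i) (W i + E i) (E i)) k" using g by simp
qed

section \<open>Logarithmic size of the continuants of \<xi>\<close>

definition B :: real where "B = tabs a + tabs b + tabs c"

lemma tabs_le_B: "tabs a \<le> B" "tabs b \<le> B" "tabs c \<le> B" "1 \<le> B"
proof -
  have *: "0 \<le> tabs a" "0 \<le> tabs b" "0 \<le> tabs c" by simp_all
  thus "tabs a \<le> B" "tabs b \<le> B" "tabs c \<le> B" unfolding B_def by linarith+
  show "1 \<le> B" using tabs_gt_1[OF deg(1)] * unfolding B_def by linarith
qed

lemma ln_tabs: "0 < n \<Longrightarrow> \<bar>ln (tabs (s n)) - ln (tabs a)\<bar> \<le> (if s n = a then 0 else ln B)"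
proof -
  assume "0 < n"
  have le: "0 \<le> ln (tabs x) \<and> ln (tabs x) \<le> ln B" if "x = a \<or> x = b \<or> x = c" for x
  proof -
    have "1 < tabs x" "tabs x \<le> B" using that tabs_gt_1 deg tabs_le_B by auto
    thus ?thesis by (auto intro!: ln_mono)
  qed
  show ?thesis using le[of "s n"] le[of a] s_cases[OF \<open>0 < n\<close>] by auto
qed

text \<open>Such a letter is located by a block \<open>j\<close> up to \<open>Suc i\<close> and a
  multiplier whose bound \<open>M\<close> does not depend on the block; letters \<open>b\<close>
  have multiplier 0.\<close>

lemma card_not_a:
  assumes "n \<le> W (Suc i)"
  shows "real (card {k\<in>{1..n}. s k \<noteq> a}) \<le> (2 * (w + 1) / \<eta> + 2) * (real i + 2)"
proof -
  define M where "M = nat \<lfloor>2 * (w + 1) / \<eta>\<rfloor>"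
  have "0 \<le> 2 * (w + 1) / \<eta>" using w_large eta_pos by simp
  hence M: "real M \<le> 2 * (w + 1) / \<eta>" unfolding M_def by (simp add: of_nat_floor)
  have mM: "m \<le> M" if "int m \<le> max 0 (m_bound w \<eta> j)" for m j
  proof -
    have "max 0 (m_bound w \<eta> j) \<le> \<lfloor>2 * (w + 1) / \<eta>\<rfloor>"
      using m_bound_le[of j] \<open>0 \<le> 2 * (w + 1) / \<eta>\<close> by (simp add: le_floor_iff)
    thus ?thesis using that unfolding M_def by linarith
  qed
  have "{k\<in>{1..n}. s k \<noteq> a} \<subseteq> (\<lambda>(j, m). W j + m * E j) ` ({..Suc i} \<times> {..M})"
  proof
    fix k assume "k \<in> {k\<in>{1..n}. s k \<noteq> a}"
    hence k: "0 < k" "k \<le> n" "s k \<noteq> a" by auto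
    obtain j m where jm: "k = W j + m * E j" "int m \<le> max 0 (m_bound w \<eta> j)" using s_not_a[OF k(1,3)] by blast
    have "W j \<le> W (Suc i)" using jm(1) k(2) assms by linarith
    hence "j \<le> Suc i" by (simp add: W_le_iff)
    thus "k \<in> (\<lambda>(j, m). W j + m * E j) ` ({..Suc i} \<times> {..M})" using jm mM[OF jm(2)] by auto
  qed
  hence "card {k\<in>{1..n}. s k \<noteq> a} \<le> card ((\<lambda>(j, m). W j + m * E j) ` ({..Suc i} \<times> {..M}))"
    by (intro card_mono) auto
  also have "\<dots> \<le> card ({..Suc i} \<times> {..M})" by (rule card_image_le) simp
  also have "\<dots> = (i + 2) * (M + 1)" by simp
  finally have "real (card {k\<in>{1..n}. s k \<noteq> a}) \<le> real ((i + 2) * (M + 1))" by (rule of_nat_mono)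
  also have "\<dots> = (real M + 1) * (real i + 2)" by (simp add: algebra_simps)
  also have "\<dots> \<le> (2 * (w + 1) / \<eta> + 2) * (real i + 2)" using M by (intro mult_right_mono) auto
  finally show ?thesis .
qed

definition A :: real where "A = ln (tabs a)"

lemma A_pos: "0 < A" unfolding A_def using tabs_gt_1[OF deg(1)] by (rule ln_gt_zero)

lemma tabs_s_pos: "0 < n \<Longrightarrow> 0 < tabs (s n)"
  using s_cases[of n] deg by fastforce

lemma ln_cf_size:
  assumes "n \<le> W (Suc i)"
  shows "\<bar>ln (cf_size s n) - real n * A\<bar> \<le> (ln B * (2 * (w + 1) / \<eta> + 2) * 2) * (real i + 1)"
proof -
  have lnB: "0 \<le> ln B" using tabs_le_B by simp
  have "ln (cf_size s n) = (\<Sum>k\<in>{1..n}. ln (tabs (s k)))"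
    unfolding cf_size_def using tabs_s_pos by (intro ln_prod) auto
  hence "ln (cf_size s n) - real n * A = (\<Sum>k\<in>{1..n}. ln (tabs (s k)) - A)"
    by (simp add: sum_subtractf)
  also have "\<bar>\<dots>\<bar> \<le> (\<Sum>k\<in>{1..n}. if s k = a then 0 else ln B)"
    by (rule order_trans[OF sum_abs sum_mono]) (use ln_tabs in \<open>auto simp: A_def\<close>)
  also have "\<dots> = (\<Sum>k\<in>{k\<in>{1..n}. s k \<noteq> a}. ln B)"
    by (intro sum.mono_neutral_cong_right) auto
  also have "\<dots> = ln B * real (card {k\<in>{1..n}. s k \<noteq> a})" by simp
  also have "\<dots> \<le> ln B * ((2 * (w + 1) / \<eta> + 2) * (2 * (real i + 1)))"
  proof (intro mult_left_mono[OF _ lnB])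
    have "0 \<le> 2 * (w + 1) / \<eta> + 2" using w_large eta_pos by simp
    hence "(2 * (w + 1) / \<eta> + 2) * (real i + 2) \<le> (2 * (w + 1) / \<eta> + 2) * (2 * (real i + 1))"
      by (intro mult_left_mono) auto
    thus "real (card {k\<in>{1..n}. s k \<noteq> a}) \<le> (2 * (w + 1) / \<eta> + 2) * (2 * (real i + 1))"
      using card_not_a[OF assms] by linarith
  qed
  finally show ?thesis by (simp only: mult.assoc)
qed

lemma lin_approx_cf_size:
  assumes n: "\<And>i. n i \<le> W (Suc i)" and l: "\<And>i. \<bar>real (n i) - l * w ^ i\<bar> \<le> 2"
  shows "lin_approx w (\<lambda>i. ln (cf_size s (n i))) (l * A)"
proof (rule lin_approx_bounded)
  show "\<forall>\<^sub>F i in sequentially. \<bar>ln (cf_size s (n i)) - A * real (n i)\<bar> \<le>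
      (ln B * (2 * (w + 1) / \<eta> + 2) * 2) * (real i + 1)"
    using ln_cf_size[OF n] by (simp add: mult.commute)
  have "lin_approx w (\<lambda>i. real (n i)) l"
  proof (rule lin_approxI[where C = 2])
    fix i :: nat show "\<bar>real (n i) - l * w ^ i\<bar> \<le> 2 * (real i + 1)"
      using l[of i] by (simp add: algebra_simps)
  qed
  thus "lin_approx w (\<lambda>i. A * real (n i)) (l * A)" unfolding mult.commute[of l A] by (rule lin_approx_scale)
qed

end

section \<open>Height, distance and value of the quadratic approximations\<close>

context xi_setup
begin

definition \<alpha> :: "nat \<Rightarrow> 'a fls" where "\<alpha> i = cf_value (t i)"

definition \<delta> :: "nat \<Rightarrow> real" where "\<delta> i = laurent_abs (cf_value s - \<alpha> i)"

text \<open>The first summand serves the condition \<open>lead\<close> of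
  \<open>quad_approx\<close>, the second the condition \<open>content\<close>.\<close>

definition K :: real where "K = B\<^sup>2 + tabs (c - a)"

lemma large_E: "\<exists>N. \<forall>i\<ge>N. 1 \<le> i \<and> 2 \<le> E i"
proof -
  obtain j where j: "3 / \<eta> < w ^ j" using real_arch_pow[of w "3 / \<eta>"] w_large by auto
  have "2 \<le> E i" if "max 1 j \<le> i" for i
  proof -
    have "w ^ j \<le> w ^ i" using that w_large by (intro power_increasing) auto
    hence "3 / \<eta> < w ^ i" using j by linarith
    hence "3 < \<eta> * w ^ i" using eta_pos by (simp add: divide_less_eq mult.commute)
    thus ?thesis using E_bounds(1)[of i] by linarith
  qed
  thus ?thesis by (intro exI[of _ "max 1 j"]) auto
qed

lemma cf_size_t: "1 \<le> i \<Longrightarrow> 2 \<le> E i \<Longrightarrow> n < W (Suc i) \<Longrightarrow> cf_size (t i) n = cf_size s n"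
  unfolding cf_size_def by (intro prod.cong refl) (use t_eq_s[of i] in auto)

lemma pre_E_less: "pre i + E i < W (Suc i)"
  using pre_bounds(2)[of i] W_gap[of i] by linarith

lemma tabs_letter: "x = a \<or> x = b \<or> x = c \<Longrightarrow> 1 \<le> tabs x \<and> tabs x \<le> B"
  using tabs_gt_1 deg tabs_le_B by (auto intro: less_imp_le)

lemma cf_size_t_pred:
  assumes "0 < n" shows "cf_size (t i) n \<le> B * cf_size (t i) (n - 1)"
proof -
  interpret cfrac "t i" by (rule cfrac_t)
  obtain m where m: "n = Suc m" using assms by (cases n) auto
  have "tabs (t i n) \<le> B" using tabs_letter[OF t_cases[OF assms]] by blast
  hence "tabs (t i n) * cf_size (t i) m \<le> B * cf_size (t i) m"
    by (intro mult_right_mono) (auto intro: less_imp_le)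
  thus ?thesis by (simp add: m cf_size_Suc)
qed

text \<open>In \<open>tabs_lc\<close> both sizes are taken one index earlier; each shift costs at
  most one letter, hence the factor B^2.\<close>

lemma lead_bound:
  assumes E2: "2 \<le> E i"
  shows "cf_size (t i) (pre i) * cf_size (t i) (pre i + E i) \<le> B\<^sup>2 * tabs (Polynomial.coeff (Q i) 2)"
proof -
  interpret periodic_cfrac "t i" "pre i" "E i" by (rule periodic_t[OF E2])
  let ?G = "cf_size (t i) (pre i - 1) * cf_size (t i) (pre i + E i - 1)"
  have B0: "0 \<le> B" using tabs_le_B by simp
  have "cf_size (t i) (pre i) * cf_size (t i) (pre i + E i) \<le>
     (B * cf_size (t i) (pre i - 1)) * (B * cf_size (t i) (pre i + E i - 1))"
    using n_pos B0 by (intro mult_mono cf_size_t_pred mult_nonneg_nonneg) (auto intro: less_imp_le)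
  also have "\<dots> = B\<^sup>2 * ?G" by (simp add: power2_eq_square mult_ac)
  also have "?G \<le> tabs lc"
  proof -
    have "1 \<le> tabs (t i (pre i + E i) - t i (pre i))" using preperiod by (intro tabs_ge_1) simp
    hence "1 * ?G \<le> tabs (t i (pre i + E i) - t i (pre i)) * ?G"
      by (intro mult_right_mono) (auto intro: less_imp_le)
    thus ?thesis by (simp add: tabs_lc)
  qed
  hence "B\<^sup>2 * ?G \<le> B\<^sup>2 * tabs lc" by (intro mult_left_mono) auto
  finally show ?thesis by (simp add: Q_def coeff_2_cf_quad)
qed

lemma height_bounds:
  assumes i: "1 \<le> i" "2 \<le> E i"
  shows "poly_height (Q i) \<le> cf_size s (pre i) * cf_size s (pre i + E i)"
    and "cf_size s (pre i) * cf_size s (pre i + E i) \<le> B\<^sup>2 * tabs (Polynomial.coeff (Q i) 2)"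
proof -
  interpret periodic_cfrac "t i" "pre i" "E i" by (rule periodic_t[OF i(2)])
  have "cf_size (t i) (pre i) = cf_size s (pre i)" "cf_size (t i) (pre i + E i) = cf_size s (pre i + E i)"
    using pre_E_less[of i] i by (auto intro!: cf_size_t)
  thus "poly_height (Q i) \<le> cf_size s (pre i) * cf_size s (pre i + E i)"
    "cf_size s (pre i) * cf_size s (pre i + E i) \<le> B\<^sup>2 * tabs (Polynomial.coeff (Q i) 2)"
    using poly_height_cf_quad lead_bound[OF i(2)] by (simp_all add: Q_def)
qed

lemma size_pos: "0 < cf_size s n"
proof -
  interpret cfrac s by (rule cfrac_s)
  show ?thesis by simp
qed

text \<open>The two expansions first differ at \<open>W (Suc i)\<close>, where \<xi> has
  \<open>b\<close> and \<alpha>_i has \<open>a\<close> or \<open>c\<close>;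
  \<open>cfrac_diff\<close> then gives the distance up to bounded factors.\<close>

lemma delta_eq:
  assumes i: "1 \<le> i" "2 \<le> E i"
  shows "0 < \<delta> i" "\<bar>ln (\<delta> i) + 2 * ln (cf_size s (W (Suc i) - 1))\<bar> \<le> 2 * ln B"
proof -
  define n where "n = W (Suc i) - 1"
  have Wn: "W (Suc i) = Suc n" using W_pos[of "Suc i"] by (simp add: n_def)
  have sb: "s (Suc n) = b" using s_W[of "Suc i"] Wn by simp
  have ta: "t i (Suc n) = a \<or> t i (Suc n) = c"
    using W_gap[of i] Wn by (auto simp: t_def pat_def)
  define x where "x = t i (Suc n)"
  have ne: "b \<noteq> x" using ta dist by (auto simp: x_def)
  have eq: "s k = t i k" if "k \<le> n" for k using t_eq_s[of i k] i that Wn by simp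
  have \<delta>: "\<delta> i = tabs (b - x) / (tabs b * tabs x * (cf_size s n)\<^sup>2)"
    using cfrac_diff[OF cfrac_s cfrac_t[of i] eq, of n] ne unfolding \<delta>_def \<alpha>_def x_def sb by simp
  have tb: "1 \<le> tabs b" "tabs b \<le> B" and tx: "1 \<le> tabs x" "tabs x \<le> B"
    using tabs_letter[of b] tabs_letter[of x] ta by (auto simp: x_def)
  have tbx: "1 \<le> tabs (b - x)" "tabs (b - x) \<le> B"
    using tabs_ge_1[of "b - x"] ne tb tx by (auto simp: of_Tpoly_diff intro: laurent_abs_diff_bound)
  have pos: "0 < tabs b" "0 < tabs x" "0 < tabs (b - x)" "0 < cf_size s n"
    using tb tx tbx size_pos by (auto intro: less_le_trans[OF zero_less_one])
  show "0 < \<delta> i" unfolding \<delta> using pos by (intro divide_pos_pos mult_pos_pos) auto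
  have "ln (\<delta> i) = ln (tabs (b - x)) - (ln (tabs b) + ln (tabs x) + 2 * ln (cf_size s n))"
    unfolding \<delta> using pos by (simp add: ln_div ln_mult ln_realpow)
  moreover have "0 \<le> ln y \<and> ln y \<le> ln B" if "1 \<le> y" "y \<le> B" for y
    using that by auto
  note this[OF tb] this[OF tx] this[OF tbx]
  ultimately show "\<bar>ln (\<delta> i) + 2 * ln (cf_size s (W (Suc i) - 1))\<bar> \<le> 2 * ln B"
    unfolding n_def[symmetric] by linarith
qed

lemma lin_pre: "lin_approx w (\<lambda>i. ln (cf_size s (pre i))) A"
proof -
  have "\<bar>real (pre i) - 1 * w ^ i\<bar> \<le> 2" for i
  proof -
    have "real (W i) \<le> real (pre i)" "real (pre i) \<le> real (W i) + 1" using pre_bounds[of i] by linarith+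
    thus ?thesis using W_bounds[of i] by linarith
  qed
  hence "lin_approx w (\<lambda>i. ln (cf_size s (pre i))) (1 * A)"
    using pre_E_less by (intro lin_approx_cf_size) (auto intro: less_imp_le add_lessD1)
  thus ?thesis by simp
qed

lemma lin_pre_E: "lin_approx w (\<lambda>i. ln (cf_size s (pre i + E i))) ((1 + \<eta>) * A)"
proof -
  have "\<bar>real (pre i + E i) - (1 + \<eta>) * w ^ i\<bar> \<le> 2" for i
  proof -
    have "real (W i) \<le> real (pre i)" "real (pre i) \<le> real (W i) + 1" using pre_bounds[of i] by linarith+
    hence "\<bar>real (pre i) + real (E i) - (w ^ i + \<eta> * w ^ i)\<bar> \<le> 2"
      using W_bounds[of i] E_bounds[of i] by linarith
    thus ?thesis by (simp add: distrib_right)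
  qed
  thus ?thesis using pre_E_less by (intro lin_approx_cf_size) (auto intro: less_imp_le)
qed

lemma lin_W: "lin_approx w (\<lambda>i. ln (cf_size s (W (Suc i) - 1))) (w * A)"
proof -
  have "\<bar>real (W (Suc i) - 1) - w * w ^ i\<bar> \<le> 2" for i
  proof -
    have "real (W (Suc i) - 1) = real (W (Suc i)) - 1" using W_pos[of "Suc i"] by simp
    thus ?thesis using W_bounds[of "Suc i"] by simp
  qed
  thus ?thesis by (intro lin_approx_cf_size) auto
qed

lemma lin_height: "lin_approx w (\<lambda>i. ln (poly_height (Q i))) ((2 + \<eta>) * A)"
proof -
  obtain N where N: "\<And>i. N \<le> i \<Longrightarrow> 1 \<le> i \<and> 2 \<le> E i" using large_E by blast
  have "\<forall>i\<ge>N. \<bar>ln (poly_height (Q i)) - (ln (cf_size s (pre i)) + ln (cf_size s (pre i + E i)))\<bar> \<le> 2 * ln B"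
  proof (intro allI impI)
    fix i assume "N \<le> i"
    hence i: "1 \<le> i" "2 \<le> E i" using N by auto
    let ?G = "cf_size s (pre i) * cf_size s (pre i + E i)"
    have G: "0 < ?G" using size_pos by simp
    have up: "poly_height (Q i) \<le> ?G" by (rule height_bounds(1)[OF i])
    have lo: "?G \<le> B\<^sup>2 * poly_height (Q i)"
      using height_bounds(2)[OF i] mult_left_mono[OF coeff_le_poly_height[of "Q i" 2], of "B\<^sup>2"] by simp
    have B1: "1 \<le> B" by (rule tabs_le_B(4))
    have H: "0 < poly_height (Q i)" using lo G B1 poly_height_nonneg[of "Q i"]
      by (metis less_le mult_zero_right not_le)
    have "ln (poly_height (Q i)) \<le> ln ?G" using up H by (intro ln_mono) auto
    moreover have "ln ?G \<le> ln (B\<^sup>2 * poly_height (Q i))" using lo G by (intro ln_mono) auto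
    moreover have "ln (B\<^sup>2 * poly_height (Q i)) = 2 * ln B + ln (poly_height (Q i))"
      using B1 H by (simp add: ln_mult ln_realpow)
    moreover have "ln ?G = ln (cf_size s (pre i)) + ln (cf_size s (pre i + E i))"
      using size_pos[of "pre i"] size_pos[of "pre i + E i"] by (simp add: ln_mult)
    ultimately show "\<bar>ln (poly_height (Q i)) - (ln (cf_size s (pre i)) + ln (cf_size s (pre i + E i)))\<bar> \<le> 2 * ln B"
      by linarith
  qed
  hence "lin_approx w (\<lambda>i. ln (poly_height (Q i))) (A + (1 + \<eta>) * A)"
    by (intro lin_approx_bounded[OF lin_approx_add[OF lin_pre lin_pre_E]] eventually_bounded)
  thus ?thesis by (simp add: algebra_simps)
qed

lemma lin_dist: "lin_approx w (\<lambda>i. ln (\<delta> i)) (- (2 * w * A))"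
proof -
  obtain N where N: "\<And>i. N \<le> i \<Longrightarrow> 1 \<le> i \<and> 2 \<le> E i" using large_E by blast
  have "\<forall>i\<ge>N. \<bar>ln (\<delta> i) - (- 2) * ln (cf_size s (W (Suc i) - 1))\<bar> \<le> 2 * ln B"
    using N delta_eq(2) by simp
  hence "lin_approx w (\<lambda>i. ln (\<delta> i)) (- 2 * (w * A))"
    by (intro lin_approx_bounded[OF lin_approx_scale[OF lin_W, of "- 2"]] eventually_bounded)
  thus ?thesis by (simp add: mult_ac)
qed

lemma w_gt_1: "1 < w" using w_large by simp

text \<open>In the expansion of \<open>Q i\<close> at \<alpha>_i the quadratic term is at most p^2
  \<delta> times the linear one, with p the size at \<open>pre i\<close>. The logarithm of this
  factor behaves like (2 - 2 w) A w^i, so for large i the linear term alone decides.\<close>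

lemma eval_Q:
  "\<exists>N. \<forall>i\<ge>N. laurent_abs (eval_laurent (Q i) (cf_value s)) =
     \<delta> i * (cf_size s (pre i + E i) / cf_size s (pre i))"
proof -
  obtain N1 where N1: "\<And>i. N1 \<le> i \<Longrightarrow> 1 \<le> i \<and> 2 \<le> E i" using large_E by blast
  have lin: "lin_approx w (\<lambda>i. 2 * ln (cf_size s (pre i)) + ln (\<delta> i)) (2 * A + - (2 * w * A))"
    by (intro lin_approx_add lin_approx_scale lin_pre lin_dist)
  have "484 * A \<le> w * A" using w_large A_pos by (intro mult_right_mono) auto
  hence "2 * A + - (2 * w * A) < - A" using A_pos by simp
  from eventually_le_of_limit[OF lin_approx_limit[OF w_gt_1 lin] this] obtain N2 where N2:
    "\<And>i. N2 \<le> i \<Longrightarrow> 2 * ln (cf_size s (pre i)) + ln (\<delta> i) \<le> - A * w ^ i" using w_gt_1 by auto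
  have "laurent_abs (eval_laurent (Q i) (cf_value s)) = \<delta> i * (cf_size s (pre i + E i) / cf_size s (pre i))"
    if "max N1 N2 \<le> i" for i
  proof -
    have i: "1 \<le> i" "2 \<le> E i" "N2 \<le> i" using that N1[of i] by auto
    interpret periodic_cfrac "t i" "pre i" "E i" by (rule periodic_t[OF i(2)])
    let ?p = "cf_size s (pre i)" and ?q = "cf_size s (pre i + E i)"
    have sz: "cf_size (t i) (pre i) = ?p" "cf_size (t i) (pre i + E i) = ?q"
      using pre_E_less[of i] i by (auto intro!: cf_size_t)
    have pos: "0 < ?p" "0 < ?q" "0 < \<delta> i" using size_pos delta_eq(1)[OF i(1,2)] by auto
    have "0 < A * w ^ i" using A_pos w_power(2)[of i] by simp
    hence "ln (?p\<^sup>2 * \<delta> i) < 0" using N2[OF i(3)] pos by (simp add: ln_mult ln_realpow)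
    hence small: "?p\<^sup>2 * \<delta> i < 1" using pos by (simp add: ln_less_zero_iff)
    have "laurent_abs (of_Tpoly lc * (cf_value s - \<alpha> i)) = tabs lc * \<delta> i"
      by (simp add: laurent_abs_mult \<delta>_def)
    also have "tabs lc \<le> ?p * ?q"
      using coeff_le_poly_height[of "Q i" 2] height_bounds(1)[OF i(1,2)] coeff_2_cf_quad by (simp add: Q_def)
    hence "tabs lc * \<delta> i \<le> ?p * ?q * \<delta> i" using pos by (intro mult_right_mono) auto
    also have "\<dots> = (?p\<^sup>2 * \<delta> i) * (?q / ?p)" using pos by (simp add: power2_eq_square)
    also have "\<dots> < 1 * (?q / ?p)" using small pos by (intro mult_strict_right_mono) auto
    also have "\<dots> = laurent_abs slope" using laurent_abs_slope sz by simp
    finally have "laurent_abs (slope + of_Tpoly lc * (cf_value s - \<alpha> i)) = laurent_abs slope"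
      by (rule laurent_abs_add_eq)
    thus ?thesis unfolding Q_def eval_cf_quad laurent_abs_mult
      using laurent_abs_slope sz by (simp add: \<alpha>_def \<delta>_def)
  qed
  thus ?thesis by blast
qed

lemma lin_eval: "lin_approx w (\<lambda>i. ln (laurent_abs (eval_laurent (Q i) (cf_value s)))) ((\<eta> - 2 * w) * A)"
proof -
  obtain N1 where N1: "\<And>i. N1 \<le> i \<Longrightarrow> 1 \<le> i \<and> 2 \<le> E i" using large_E by blast
  obtain N2 where N2: "\<And>i. N2 \<le> i \<Longrightarrow> laurent_abs (eval_laurent (Q i) (cf_value s)) =
     \<delta> i * (cf_size s (pre i + E i) / cf_size s (pre i))" using eval_Q by blast
  have "\<forall>i\<ge>max N1 N2. \<bar>ln (laurent_abs (eval_laurent (Q i) (cf_value s))) -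
      (ln (\<delta> i) + (ln (cf_size s (pre i + E i)) + (- 1) * ln (cf_size s (pre i))))\<bar> \<le> 0"
  proof (intro allI impI)
    fix i assume i: "max N1 N2 \<le> i"
    have "0 < \<delta> i" using delta_eq(1) N1[of i] i by simp
    thus "\<bar>ln (laurent_abs (eval_laurent (Q i) (cf_value s))) -
      (ln (\<delta> i) + (ln (cf_size s (pre i + E i)) + (- 1) * ln (cf_size s (pre i))))\<bar> \<le> 0"
      using N2[of i] i size_pos[of "pre i"] size_pos[of "pre i + E i"] by (simp add: ln_mult ln_div)
  qed
  hence "lin_approx w (\<lambda>i. ln (laurent_abs (eval_laurent (Q i) (cf_value s))))
      (- (2 * w * A) + ((1 + \<eta>) * A + (- 1) * A))"
    by (intro lin_approx_bounded[OF lin_approx_add[OF lin_dist lin_approx_add[OF lin_pre_E lin_approx_scale[OF lin_pre]]]]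
        eventually_bounded)
  thus ?thesis by (simp add: algebra_simps)
qed

lemma quad_approx_xi: "\<exists>i0. quad_approx (cf_value s) v Q \<alpha> w \<eta> A K d i0"
proof -
  obtain N1 where N1: "\<And>i. N1 \<le> i \<Longrightarrow> 1 \<le> i \<and> 2 \<le> E i" using large_E by blast
  obtain N2 where N2: "\<And>i. N2 \<le> i \<Longrightarrow> laurent_abs (eval_laurent (Q i) (cf_value s)) =
     \<delta> i * (cf_size s (pre i + E i) / cf_size s (pre i))" using eval_Q by blast
  have B1: "1 \<le> B\<^sup>2" using tabs_le_B(4) by (simp add: one_le_power)
  have KB: "B\<^sup>2 \<le> K" "tabs (c - a) \<le> K" using B1 by (simp_all add: K_def)
  have "quad_approx (cf_value s) v Q \<alpha> w \<eta> A K d (max N1 N2)"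
  proof
    show "1 \<le> K" using B1 KB by linarith
    show "laurent_abs (cf_value s) \<le> 1" using cfrac.laurent_abs_value[OF cfrac_s] by simp
    show "(\<lambda>i. ln (poly_height (Q i)) / w ^ i) \<longlonglongrightarrow> (2 + \<eta>) * A"
      by (rule lin_approx_limit[OF w_gt_1 lin_height])
    show "(\<lambda>i. ln (laurent_abs (cf_value s - \<alpha> i)) / w ^ i) \<longlonglongrightarrow> - (2 * w * A)"
      using lin_approx_limit[OF w_gt_1 lin_dist] by (simp add: \<delta>_def)
    show "(\<lambda>i. ln (laurent_abs (eval_laurent (Q i) (cf_value s))) / w ^ i) \<longlonglongrightarrow> (\<eta> - 2 * w) * A"
      by (rule lin_approx_limit[OF w_gt_1 lin_eval])
  next
    fix i assume "max N1 N2 \<le> i"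
    hence i: "1 \<le> i" "2 \<le> E i" "N2 \<le> i" using N1[of i] by auto
    interpret periodic_cfrac "t i" "pre i" "E i" by (rule periodic_t[OF i(2)])
    show "laurent_abs (\<alpha> i) \<le> 1" using laurent_abs_value by (simp add: \<alpha>_def)
    show "Polynomial.degree (Q i) = 2" by (simp add: Q_def degree_cf_quad)
    show "eval_laurent (Q i) (\<alpha> i) = 0" by (simp add: Q_def \<alpha>_def eval_cf_quad_root)
    show "r = 0 \<and> e = 0" if "eval_laurent [:e, r:] (\<alpha> i) = 0" for e r
      using irrational that by (simp add: \<alpha>_def)
    have "B\<^sup>2 * tabs (Polynomial.coeff (Q i) 2) \<le> K * tabs (Polynomial.coeff (Q i) 2)"
      using KB by (intro mult_right_mono) auto
    thus "poly_height (Q i) \<le> K * tabs (Polynomial.coeff (Q i) 2)"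
      using height_bounds[OF i(1,2)] by linarith
    show "tabs g \<le> K" if "Q i = smult g R" for g R
    proof -
      have "g dvd c - a" by (rule content_Q[OF i(2)]) (simp add: that)
      then obtain h where h: "c - a = g * h" by (elim dvdE)
      have "h \<noteq> 0" using h dist by auto
      hence "tabs g * 1 \<le> tabs g * tabs h" by (intro mult_left_mono tabs_ge_1) auto
      thus ?thesis using KB(2) by (simp add: h tabs_mult)
    qed
    have pos: "0 < \<delta> i" by (rule delta_eq(1)[OF i(1,2)])
    thus "\<alpha> i \<noteq> cf_value s" by (auto simp: \<delta>_def)
    have "0 < laurent_abs (eval_laurent (Q i) (cf_value s))"
      unfolding N2[OF i(3)] using pos size_pos by (intro mult_pos_pos divide_pos_pos) auto
    thus "eval_laurent (Q i) (cf_value s) \<noteq> 0" by simp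
  qed (use ext d_ge w_ge eta_pos eta_less A_pos in auto)
  thus ?thesis by blast
qed

lemma exponents:
  assumes n: "2 \<le> n" "n \<le> d"
  shows "w_star_exp v n (xi a b c w \<eta>) = ereal ((2 * w - 2 - \<eta>) / (2 + \<eta>))"
    and "w_exp n (xi a b c w \<eta>) = ereal ((2 * w - \<eta>) / (2 + \<eta>))"
proof -
  obtain i0 where "quad_approx (cf_value s) v Q \<alpha> w \<eta> A K d i0" using quad_approx_xi by blast
  then interpret quad_approx "cf_value s" v Q \<alpha> w \<eta> A K d i0 .
  show "w_star_exp v n (xi a b c w \<eta>) = ereal ((2 * w - 2 - \<eta>) / (2 + \<eta>))"
    using w_star_exp_eq[OF n] by (simp add: xi_def W1_def)
  show "w_exp n (xi a b c w \<eta>) = ereal ((2 * w - \<eta>) / (2 + \<eta>))"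
    using w_exp_eq[OF n] by (simp add: xi_def W0_def)
qed

end

theorem theorem2p10:
  fixes a b c :: "'a::finite_field poly"
    and v :: "'a fls alg_closure \<Rightarrow> real"
    and w \<eta> :: real
    and d :: nat
  assumes "extends_laurent_abs v"
    and "2 \<le> d"
    and "121 * (real d)\<^sup>2 \<le> w"
    and "distinct [a, b, c]"
    and "0 < Polynomial.degree a" and "0 < Polynomial.degree b" and "0 < Polynomial.degree c"
    and "0 < \<eta>" and "\<eta> < sqrt w / real d"
  shows "\<forall>n. 2 \<le> n \<and> n \<le> d \<longrightarrow>
      w_star_exp v n (xi a b c w \<eta>) = ereal ((2 * w - 2 - \<eta>) / (2 + \<eta>)) \<and>
      w_exp n (xi a b c w \<eta>) = ereal ((2 * w - \<eta>) / (2 + \<eta>)) \<and>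
      w_exp n (xi a b c w \<eta>) - w_star_exp v n (xi a b c w \<eta>) = ereal (2 / (2 + \<eta>))"
proof -
  interpret xi_setup a b c v w \<eta> d by (unfold_locales) (use assms in auto)
  have "(2 * w - \<eta>) / (2 + \<eta>) - (2 * w - 2 - \<eta>) / (2 + \<eta>) = 2 / (2 + \<eta>)"
    by (simp add: diff_divide_distrib[symmetric])
  thus ?thesis by (simp add: exponents)
qed

end
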